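(* There exists a constant $c>0$, independent of $\nu,k,B,R$, such that for every $c'\in(0,c)$ the following holds, with an implicit constant in $\lesssim$ independent of $\nu,k,B,R$. Let $\nu>0$, $B\in\mathbb R\setminus\{0\}$, $R>1$, $k\in\mathbb Z$ with $|k|\ge1$. Let $w_k^l$ solve $$\partial_t w_k^l-\nu\Big(\partial_r^2-\frac{k^2-\frac14}{r^2}\Big)w_k^l+\frac{ikB}{r^2}w_k^l=0,\qquad w_k^l|_{t=0}=w_k(0),\qquad w_k^l|_{r=1,R}=0,$$ on $r\in[1,R]$, $t\ge0$, with $w_k(0)\in L^2$, and let $\varphi_k^l$ solve $\big(\partial_r^2-\frac{k^2-1/4}{r^2}\big)\varphi_k^l=w_k^l$, $\varphi_k^l|_{r=1,R}=0$. Put $a=c'(\nu k^2)^{1/3}|B|^{2/3}R^{-2}$. Then $$k^2|B|R^{-4}\Big(\|e^{at}\partial_r\varphi_k^l\|_{L^2L^2}^2+|k|^2\Big\|e^{at}\frac{\varphi_k^l}r\Big\|_{L^2L^2}^2\Big)$$ $$\lesssim(\log R)^{-2}R^{-4}\|r^2w_k(0)\|_{L^2}^2+R^6\Big\|\frac{w_k(0)}{r^3}\Big\|_{L^2}^2+\Big(\frac\nu{|kB|}\Big)^{2/3}R^2\|\partial_rw_k(0)\|_{L^2}^2$$ $$+\Big(\Big(\frac\nu{|kB|}\Big)^{1/3}\log R+1\Big)\Big(R^{-2}\|rw_k(0)\|_{L^2}^2+\Big(\frac\nu{|kB|}\Big)^{4/3}k^4R^2\Big\|\frac{w_k(0)}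r\Big\|_{L^2}^2\Big).$$
   Context: $L^2=L^2([1,R],dr)$ and $\|g\|_{L^pL^2}:=\big\|\,\|g(t,\cdot)\|_{L^2([1,R])}\big\|_{L^p_t([0,\infty))}$. The initial datum also satisfies $w_k(0)|_{r=1,R}=0$ (compatibility with the boundary condition). *)

theory Defs
  imports "HOL-Analysis.Analysis"
begin

text \<open>Squared norms are taken in \<^typ>\<open>ennreal\<close>, so that an estimate of such a norm includes
  the assertion that it is finite.\<close>

definition L2_sq :: "real \<Rightarrow> (real \<Rightarrow> complex) \<Rightarrow> ennreal" where
  "L2_sq R f = (\<integral>\<^sup>+ r. ennreal ((cmod (f r))\<^sup>2) \<partial>lebesgue_on {1..R})"

definition in_L2 :: "real \<Rightarrow> (real \<Rightarrow> complex) \<Rightarrow> bool" where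
  "in_L2 R f \<longleftrightarrow> f \<in> borel_measurable (lebesgue_on {1..R}) \<and> L2_sq R f < \<infinity>"

definition L2L2_sq :: "real \<Rightarrow> (real \<Rightarrow> real \<Rightarrow> complex) \<Rightarrow> ennreal" where
  "L2L2_sq R g = (\<integral>\<^sup>+ t. L2_sq R (g t) \<partial>lebesgue_on {0..})"

text \<open>\<open>f\<close> lies in the Sobolev space $H^1(1,R)$ with weak derivative \<open>g\<close>; here \<open>f\<close> is the
  absolutely continuous representative, so that its boundary values are meaningful.\<close>

definition H1_deriv :: "real \<Rightarrow> (real \<Rightarrow> complex) \<Rightarrow> (real \<Rightarrow> complex) \<Rightarrow> bool" where
  "H1_deriv R f g \<longleftrightarrow> in_L2 R f \<and> in_L2 R g \<and>
     (\<forall>r\<in>{1..R}. f r = f 1 + integral\<^sup>L (lebesgue_on {1..r}) g)"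

definition vanishes_at_ends :: "real \<Rightarrow> (real \<Rightarrow> complex) \<Rightarrow> bool" where
  "vanishes_at_ends R f \<longleftrightarrow> f 1 = 0 \<and> f R = 0"

text \<open>The classical radial derivative, one-sided at the end points.\<close>

definition dr :: "real \<Rightarrow> (real \<Rightarrow> complex) \<Rightarrow> real \<Rightarrow> complex" where
  "dr R f r = vector_derivative f (at r within {1..R})"

definition dt :: "(real \<Rightarrow> real \<Rightarrow> complex) \<Rightarrow> real \<Rightarrow> real \<Rightarrow> complex" where
  "dt w t r = vector_derivative (\<lambda>s. w s r) (at t)"

definition twice_differentiable :: "real \<Rightarrow> (real \<Rightarrow> complex) \<Rightarrow> bool" where
  "twice_differentiable R f \<longleftrightarrow>
     (\<forall>r\<in>{1..R}. f differentiable (at r within {1..R}) \<and>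
                 dr R f differentiable (at r within {1..R}))"

definition radial_op :: "int \<Rightarrow> real \<Rightarrow> (real \<Rightarrow> complex) \<Rightarrow> real \<Rightarrow> complex" where
  "radial_op k R f r =
     dr R (dr R f) r - complex_of_real (((real_of_int k)\<^sup>2 - 1/4) / r\<^sup>2) * f r"

definition C12 :: "real \<Rightarrow> (real \<Rightarrow> real \<Rightarrow> complex) \<Rightarrow> bool" where
  "C12 R w \<longleftrightarrow>
     (\<forall>t>0. twice_differentiable R (w t)) \<and>
     (\<forall>t>0. \<forall>r\<in>{1..R}. (\<lambda>s. w s r) differentiable (at t)) \<and>
     continuous_on ({0<..} \<times> {1..R}) (\<lambda>(t, r). w t r) \<and>
     continuous_on ({0<..} \<times> {1..R}) (\<lambda>(t, r). dt w t r) \<and>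
     continuous_on ({0<..} \<times> {1..R}) (\<lambda>(t, r). dr R (w t) r) \<and>
     continuous_on ({0<..} \<times> {1..R}) (\<lambda>(t, r). dr R (dr R (w t)) r)"

text \<open>The solution with initial datum in $L^2$: by parabolic smoothing it is classical on
  $(0,\infty)\times[1,R]$, and the initial datum is attained in $L^2$. The value \<open>w 0\<close> itself is
  not constrained.\<close>

definition vorticity_solution ::
  "real \<Rightarrow> int \<Rightarrow> real \<Rightarrow> real \<Rightarrow> (real \<Rightarrow> complex) \<Rightarrow> (real \<Rightarrow> real \<Rightarrow> complex) \<Rightarrow> bool" where
  "vorticity_solution \<nu> k B R w0 w \<longleftrightarrow>
     C12 R w \<and>
     (\<forall>t>0. \<forall>r\<in>{1..R}.
        dt w t r - complex_of_real \<nu> * radial_op k R (w t) r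
          + \<i> * complex_of_real (real_of_int k * B / r\<^sup>2) * w t r = 0) \<and>
     (\<forall>t>0. vanishes_at_ends R (w t)) \<and>
     ((\<lambda>t. L2_sq R (\<lambda>r. w t r - w0 r)) \<longlongrightarrow> 0) (at_right 0)"

definition stream_function ::
  "int \<Rightarrow> real \<Rightarrow> (real \<Rightarrow> complex) \<Rightarrow> (real \<Rightarrow> complex) \<Rightarrow> bool" where
  "stream_function k R f \<phi> \<longleftrightarrow>
     twice_differentiable R \<phi> \<and> (\<forall>r\<in>{1..R}. radial_op k R \<phi> r = f r) \<and>
     vanishes_at_ends R \<phi>"

end

theory Submission
  imports Defs
begin

text \<open>Write $\beta=|kB|$, $\delta=(\nu/\beta)^{1/3}$, $s=r^{-2}$ and $p=|k|$.

  Inviscid part. Integrating $\partial_r(r^p\bar\varphi)$ by parts bounds the energy of the stream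
  function by $\int|F|^2dr'$, where $F(r')=\int_{r'}^R(r'/r)^pw\,dr$. For $w=e^{-i\lambda ts}h$ each
  $F(t,r')$ is a Fourier transform in the variable $s$, so Bessel's inequality in $t$ and an integration
  over $r'$, which gains the factor $1/p$, bound $\iint|F|^2dr'dt$ by $\int r^4|h|^2dr$.

  Viscous part. On a time block of length $T=R^2/(\beta\delta)$ the profile $h=e^{i\lambda ts}w$ is controlled
  by a Sobolev inequality in time, at the cost of $T^{-1}\int\|w\|^2+T\int\|\partial_th\|^2$, where $\partial_th$
  is purely viscous. If $\delta p\le1$ these quantities are dissipated by the hypocoercive energy
  $\int|w|^2+\frac{\delta^2}{40}r^2|\partial_rw|^2\pm\frac{\delta}{100}\mathrm{Re}(ir\,\partial_rw\,\bar w)\,dr$,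
  which also decays at the enhanced rate. If $\delta p>1$, heat dissipation suffices.\<close>

section \<open>A continuous Bessel inequality\<close>

text \<open>Since \<nu> = \<beta>\<delta>^3, the equation is \<beta> times one that contains only
  \<delta>, K and a sign, and the rate a equals c'\<beta>\<delta>R^(-2). Thus T is the decay time:
  the weight e^(2at) changes by a bounded factor on a block, and T balances the zeroth-order against
  the second-order part of the dissipation. The smoothing estimate concerns the diagonal of a
  function of two times, one for the phase and one for the profile; Bessel acts on the former,
  Sobolev on the latter. Two obstacles shape the rest. The regularity class has no mixed derivative
  in t and r, while the hypocoercive energy contains the gradient, so its increments in time are
  integrated by parts in r before they are differentiated. The datum is attained only in L^2, while
  the energy at the start needs a gradient; at some arbitrarily small positive time the gradient is
  bounded by gradient and Hardy norm of the datum, and the weighted estimates start there. The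
  outcome involves mass, Hardy norm and gradient of the datum, which two terms of the right-hand
  side control.\<close>

lemma power2_sum_le: "(x + y)\<^sup>2 \<le> 2 * x\<^sup>2 + 2 * y\<^sup>2" for x y :: real
  using zero_le_power2[of "x - y"] by (simp add: power2_eq_square algebra_simps)

lemma has_integral_cis_period:
  fixes j :: int
  assumes "j \<noteq> 0"
  shows "((\<lambda>s. cis (2 * pi * of_int j * s)) has_integral 0) {0..1}"
proof -
  let ?c = "\<i> * complex_of_real (2 * pi * of_int j)"
  have nz: "?c \<noteq> 0" using assms by simp
  have "((\<lambda>s. cis (2 * pi * of_int j * s) / ?c) has_vector_derivative cis (2 * pi * of_int j * x))
      (at x within {0..1})" for x
  proof -
    have "((\<lambda>s. exp (of_real s * ?c) / ?c) has_vector_derivative exp (of_real x * ?c)) (at x within {0..1})"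
      by (rule has_vector_derivative_real_field derivative_eq_intros refl | use nz in simp)+
    moreover have "exp (of_real s * ?c) = cis (2 * pi * of_int j * s)" for s
      by (simp add: cis_conv_exp mult_ac)
    ultimately show ?thesis by simp
  qed
  then have "((\<lambda>s. cis (2 * pi * of_int j * s)) has_integral
      (cis (2 * pi * of_int j * 1) / ?c - cis (2 * pi * of_int j * 0) / ?c)) {0..1}"
    by (intro fundamental_theorem_of_calculus) auto
  moreover have "cis (2 * pi * of_int j * 1) = 1"
    using cis_multiple_2pi[of "of_int j"] by simp
  ultimately show ?thesis by simp
qed

text \<open>Parseval on [0,1] for distinct frequencies in one coset of 2\<pi>Z: only differences
  enter the inner products, so a common shift of all \<mu> n is allowed. Sampling in time produces
  exactly such frequencies.\<close>

lemma integral_trig_sum: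
  fixes \<mu> :: "nat \<Rightarrow> real" and c :: "nat \<Rightarrow> complex"
  assumes \<mu>: "\<And>n m. n < N \<Longrightarrow> m < N \<Longrightarrow> n \<noteq> m \<Longrightarrow> \<exists>j::int. j \<noteq> 0 \<and> \<mu> n - \<mu> m = 2 * pi * of_int j"
  shows "integral {0..1} (\<lambda>s. (cmod (\<Sum>n<N. c n * cis (\<mu> n * s)))\<^sup>2) = (\<Sum>n<N. (cmod (c n))\<^sup>2)"
proof -
  have int: "((\<lambda>s. cis ((\<mu> n - \<mu> m) * s)) has_integral (if m = n then 1 else 0)) {0..1}"
    if nm: "n < N" "m < N" for n m
  proof (cases "m = n")
    case True
    have "((\<lambda>s::real. 1::complex) has_integral 1) {0..1}"
      using has_integral_const_real[of "1::complex" 0 1] by simp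
    then show ?thesis using True by simp
  next
    case False
    then obtain j :: int where "j \<noteq> 0" "\<mu> n - \<mu> m = 2 * pi * of_int j"
      using \<mu>[of n m] nm by auto
    then show ?thesis using has_integral_cis_period[of j] False by simp
  qed
  have "((\<lambda>s. \<Sum>n<N. \<Sum>m<N. c n * cnj (c m) * cis ((\<mu> n - \<mu> m) * s)) has_integral
      (\<Sum>n<N. \<Sum>m<N. c n * cnj (c m) * (if m = n then 1 else 0))) {0..1}"
    by (intro has_integral_sum has_integral_mult_right int) auto
  moreover have "(\<Sum>n<N. \<Sum>m<N. c n * cnj (c m) * (if m = n then 1 else 0))
      = complex_of_real (\<Sum>n<N. (cmod (c n))\<^sup>2)"
    by (simp add: if_distrib flip: complex_norm_square of_real_power cong: if_cong)
  moreover have "(\<Sum>n<N. \<Sum>m<N. c n * cnj (c m) * cis ((\<mu> n - \<mu> m) * s))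
      = complex_of_real ((cmod (\<Sum>n<N. c n * cis (\<mu> n * s)))\<^sup>2)" for s
  proof -
    have "cis ((\<mu> n - \<mu> m) * s) = cis (\<mu> n * s) * cnj (cis (\<mu> m * s))" for n m
      by (simp add: cis_cnj cis_mult left_diff_distrib)
    then show ?thesis
      unfolding complex_norm_square by (simp add: sum_product mult_ac)
  qed
  ultimately have "((\<lambda>s. complex_of_real ((cmod (\<Sum>n<N. c n * cis (\<mu> n * s)))\<^sup>2)) has_integral
      complex_of_real (\<Sum>n<N. (cmod (c n))\<^sup>2)) {0..1}" by simp
  from has_integral_linear[OF this bounded_linear_Re]
  show ?thesis by (intro integral_unique) (simp add: o_def)
qed

text \<open>With s = r^(-2) and ds = -2r^(-3)dr the integrals are Fourier coefficients of f r^3/2,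
  and r0 \<ge> 1 places s in [0,1], where the exponentials are orthonormal. Bessel's inequality is
  proved by duality with the trigonometric polynomial g built from the coefficients, so that only g
  undergoes the change of variables.\<close>

lemma bessel_inverse_square:
  fixes f :: "real \<Rightarrow> complex" and \<mu> :: "nat \<Rightarrow> real"
  assumes r0: "1 \<le> r0" "r0 \<le> R" and f: "continuous_on {r0..R} f"
    and \<mu>: "\<And>n m. n < N \<Longrightarrow> m < N \<Longrightarrow> n \<noteq> m \<Longrightarrow> \<exists>j::int. j \<noteq> 0 \<and> \<mu> n - \<mu> m = 2 * pi * of_int j"
  shows "(\<Sum>n<N. (cmod (integral {r0..R} (\<lambda>r. f r * cis (- \<mu> n / r\<^sup>2))))\<^sup>2)
      \<le> integral {r0..R} (\<lambda>r. (cmod (f r))\<^sup>2 * r^3 / 2)"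
proof -
  define c where "c n = integral {r0..R} (\<lambda>r. f r * cis (- \<mu> n / r\<^sup>2))" for n
  define g where "g s = (\<Sum>n<N. c n * cis (\<mu> n * s))" for s
  define A where "A = (\<Sum>n<N. (cmod (c n))\<^sup>2)"
  have contg: "continuous_on S g" for S
    unfolding g_def by (intro continuous_intros)
  have contg2: "continuous_on S (\<lambda>s. (cmod (g s))\<^sup>2)" for S
    by (intro continuous_intros contg)
  have contgr: "continuous_on {r0..R} (\<lambda>r. g (1 / r\<^sup>2))"
    using r0 unfolding g_def by (intro continuous_intros) auto
  have rpos: "r \<noteq> 0" if "r \<in> {r0..R}" for r using that r0 by auto
  have gA: "integral {0..1} (\<lambda>s. (cmod (g s))\<^sup>2) = A"
    unfolding g_def A_def by (rule integral_trig_sum[OF \<mu>])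
  \<comment> \<open>G is an antiderivative of |g|^2 on [0,1]; the chain rule for G(r^(-2)) performs
    the substitution.\<close>
  define G where "G u = integral {0..u} (\<lambda>s. (cmod (g s))\<^sup>2)" for u
  have dG: "(G has_vector_derivative (cmod (g u))\<^sup>2) (at u within {0..1})" if "u \<in> {0..1}" for u
    unfolding G_def using integral_has_vector_derivative[OF contg2 that] .
  have inv01: "1 / r\<^sup>2 \<in> {0..1}" if "r \<in> {r0..R}" for r
    using that r0 by (auto simp: divide_le_eq power_le_one_iff one_le_power)
  have dGr: "((\<lambda>r. - G (1 / r\<^sup>2)) has_vector_derivative (cmod (g (1 / r\<^sup>2)))\<^sup>2 * (2 / r^3))
      (at r within {r0..R})" if r: "r \<in> {r0..R}" for r
  proof -
    have d1: "((\<lambda>r::real. 1 / r\<^sup>2) has_real_derivative (- 2 / r^3)) (at r within {r0..R})"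
      by (rule derivative_eq_intros refl | use rpos[OF r] in \<open>simp add: field_simps eval_nat_numeral\<close>)+
    have "(G has_real_derivative (cmod (g (1 / r\<^sup>2)))\<^sup>2) (at (1 / r\<^sup>2) within (\<lambda>r. 1 / r\<^sup>2) ` {r0..R})"
      using dG[OF inv01[OF r]] inv01
      by (auto simp: has_real_derivative_iff_has_vector_derivative intro: has_vector_derivative_within_subset)
    from DERIV_image_chain[OF this d1]
    have "((\<lambda>r. G (1 / r\<^sup>2)) has_real_derivative (cmod (g (1 / r\<^sup>2)))\<^sup>2 * (- 2 / r^3)) (at r within {r0..R})"
      by (simp add: o_def)
    from DERIV_minus[OF this] show ?thesis
      by (simp add: has_real_derivative_iff_has_vector_derivative)
  qed
  have S2: "((\<lambda>r. (cmod (g (1 / r\<^sup>2)))\<^sup>2 * (2 / r^3)) has_integral (G (1 / r0\<^sup>2) - G (1 / R\<^sup>2))) {r0..R}"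
    using fundamental_theorem_of_calculus[OF r0(2) dGr] by simp
  have Gle: "G (1 / r0\<^sup>2) \<le> A"
    unfolding G_def gA[symmetric]
    by (rule integral_subset_le)
       (use inv01[of r0] r0 in \<open>auto intro!: integrable_continuous_interval contg2\<close>)
  have Gge: "0 \<le> G (1 / R\<^sup>2)"
    unfolding G_def by (intro integral_nonneg integrable_continuous_interval contg2) auto
  have fg: "((\<lambda>r. f r * cnj (g (1 / r\<^sup>2))) has_integral complex_of_real A) {r0..R}"
  proof -
    have "((\<lambda>r. \<Sum>n<N. cnj (c n) * (f r * cis (- \<mu> n / r\<^sup>2))) has_integral (\<Sum>n<N. cnj (c n) * c n)) {r0..R}"
      unfolding c_def
      by (intro has_integral_sum has_integral_mult_right integrable_integral
          integrable_continuous_interval continuous_intros f) (use rpos in auto)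
    moreover have "(\<Sum>n<N. cnj (c n) * c n) = complex_of_real A"
      unfolding A_def by (simp add: complex_norm_square[symmetric] mult.commute flip: of_real_power)
    moreover have "(\<Sum>n<N. cnj (c n) * (f r * cis (- \<mu> n / r\<^sup>2))) = f r * cnj (g (1 / r\<^sup>2))" for r
      unfolding g_def by (simp add: sum_distrib_left cis_cnj mult_ac)
    ultimately show ?thesis by simp
  qed
  from has_integral_linear[OF this bounded_linear_Re]
  have fgR: "((\<lambda>r. Re (f r * cnj (g (1 / r\<^sup>2)))) has_integral A) {r0..R}" by (simp add: o_def)
  have ff: "((\<lambda>r. (cmod (f r))\<^sup>2 * r^3 / 2) has_integral integral {r0..R} (\<lambda>r. (cmod (f r))\<^sup>2 * r^3 / 2)) {r0..R}"
    by (intro integrable_integral integrable_continuous_interval continuous_intros f) auto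
  \<comment> \<open>The integrand is at least the square of |f|(r^3/2)^(1/2) - |g|(2/r^3)^(1/2). Its
    integral is at most the desired right-hand side minus 2A plus A, which gives the claim.\<close>
  have "((\<lambda>r. (cmod (f r))\<^sup>2 * r^3 / 2 - 2 * Re (f r * cnj (g (1 / r\<^sup>2))) + (cmod (g (1 / r\<^sup>2)))\<^sup>2 * (2 / r^3))
      has_integral (integral {r0..R} (\<lambda>r. (cmod (f r))\<^sup>2 * r^3 / 2) - 2 * A + (G (1 / r0\<^sup>2) - G (1 / R\<^sup>2)))) {r0..R}"
    by (intro has_integral_add has_integral_diff has_integral_mult_right ff fgR S2)
  moreover have "0 \<le> (cmod (f r))\<^sup>2 * r^3 / 2 - 2 * Re (f r * cnj (g (1 / r\<^sup>2))) + (cmod (g (1 / r\<^sup>2)))\<^sup>2 * (2 / r^3)"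
    if "r \<in> {r0..R}" for r
  proof -
    have r3: "r^3 > 0" using that r0 by simp
    have "Re (f r * cnj (g (1 / r\<^sup>2))) \<le> cmod (f r) * cmod (g (1 / r\<^sup>2))"
      using complex_Re_le_cmod[of "f r * cnj (g (1 / r\<^sup>2))"] by (simp add: norm_mult)
    moreover have "0 \<le> (cmod (f r) * r^3 - 2 * cmod (g (1 / r\<^sup>2)))\<^sup>2 / (2 * r^3)"
      using r3 by simp
    then have "0 \<le> (cmod (f r))\<^sup>2 * r^3 / 2 - 2 * (cmod (f r) * cmod (g (1 / r\<^sup>2))) + (cmod (g (1 / r\<^sup>2)))\<^sup>2 * (2 / r^3)"
      using r3 by (simp add: field_simps power2_eq_square)
    ultimately show ?thesis by linarith
  qed
  ultimately have "0 \<le> integral {r0..R} (\<lambda>r. (cmod (f r))\<^sup>2 * r^3 / 2) - 2 * A + (G (1 / r0\<^sup>2) - G (1 / R\<^sup>2))"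
    by (rule has_integral_nonneg)
  then show ?thesis using Gle Gge unfolding A_def c_def by linarith
qed

text \<open>Time is folded into one period P = 2\<pi>/|lam|. For fixed t the samples t + nP have
  frequencies lam(t + nP) that differ by multiples of 2\<pi>, so the discrete inequality bounds
  their sum; integration over one period multiplies the bound by P, and P/2 = \<pi>/|lam|.\<close>

lemma bessel_inverse_square_time:
  fixes f :: "real \<Rightarrow> complex"
  assumes r0: "1 \<le> r0" "r0 \<le> R" and f: "continuous_on {r0..R} f" and lam: "lam \<noteq> 0"
  shows "integral {t0..t1} (\<lambda>t. (cmod (integral {r0..R} (\<lambda>r. f r * cis (- (lam * t) / r\<^sup>2))))\<^sup>2)
      \<le> pi / \<bar>lam\<bar> * integral {r0..R} (\<lambda>r. (cmod (f r))\<^sup>2 * r^3)"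
proof -
  define y where "y t = (cmod (integral {r0..R} (\<lambda>r. f r * cis (- (lam * t) / r\<^sup>2))))\<^sup>2" for t
  define P where "P = 2 * pi / \<bar>lam\<bar>"
  have P: "P > 0" using lam by (simp add: P_def)
  have "continuous_on UNIV (\<lambda>t. integral (cbox r0 R) (\<lambda>r. f r * cis (- (lam * t) / r\<^sup>2)))"
  proof (rule integral_continuous_on_param)
    have "continuous_on (UNIV \<times> {r0..R}) (\<lambda>z. f (snd z))"
      by (rule continuous_on_compose2[OF f]) (auto intro: continuous_intros)
    then show "continuous_on (UNIV \<times> cbox r0 R) (\<lambda>(t, r). f r * cis (- (lam * t) / r\<^sup>2))"
      unfolding split_beta using r0 by (auto intro!: continuous_intros)
  qed
  then have y: "continuous_on S y" for S
    unfolding y_def by (auto intro!: continuous_intros elim: continuous_on_subset)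
  have yint: "y integrable_on {a..b}" for a b by (intro integrable_continuous_interval y)
  have ynn: "y t \<ge> 0" for t by (simp add: y_def)
  obtain N :: nat where N: "(t1 - t0) / P \<le> real N" using real_arch_simple by blast
  have split: "integral {t0..t0 + real n * P} y = integral {t0..t0 + P} (\<lambda>t. \<Sum>m<n. y (t + real m * P))" for n
  proof (induction n)
    case (Suc n)
    have "integral {t0..t0 + real (Suc n) * P} y
        = integral {t0..t0 + real n * P} y + integral {t0 + real n * P..t0 + real (Suc n) * P} y"
      using P by (intro Henstock_Kurzweil_Integration.integral_combine[symmetric] yint) (auto simp: algebra_simps)
    also have "integral {t0 + real n * P..t0 + real (Suc n) * P} y = integral {t0..t0 + P} (\<lambda>t. y (t + real n * P))"
    proof -
      have "((\<lambda>t. 1 *\<^sub>R y (t + real n * P)) has_integral integral {t0 + real n * P..t0 + P + real n * P} y) {t0..t0 + P}"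
        by (rule has_integral_substitution[OF _ _ _ y])
           (use P in \<open>auto intro!: derivative_eq_intros\<close>)
      then show ?thesis by (simp add: integral_unique algebra_simps)
    qed
    also have "integral {t0..t0 + real n * P} y + integral {t0..t0 + P} (\<lambda>t. y (t + real n * P))
        = integral {t0..t0 + P} (\<lambda>t. \<Sum>m<Suc n. y (t + real m * P))"
      unfolding Suc sum.lessThan_Suc
      by (intro integral_add[symmetric] integrable_continuous_interval continuous_intros
          continuous_on_compose2[OF y[of UNIV]]) auto
    finally show ?case .
  qed simp
  have "integral {t0..t1} y \<le> integral {t0..t0 + real N * P} y"
    by (rule integral_subset_le) (use N P in \<open>auto intro: yint ynn simp: field_simps\<close>)
  also have "\<dots> \<le> integral {t0..t0 + P} (\<lambda>t. integral {r0..R} (\<lambda>r. (cmod (f r))\<^sup>2 * r^3 / 2))"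
    unfolding split
  proof (rule integral_le)
    fix t
    have "\<exists>j::int. j \<noteq> 0 \<and> lam * (t + real n * P) - lam * (t + real m * P) = 2 * pi * of_int j"
      if "n \<noteq> m" for n m
    proof (intro exI conjI)
      let ?j = "(if lam > 0 then 1 else -1) * (int n - int m)"
      show "?j \<noteq> 0" using that by simp
      show "lam * (t + real n * P) - lam * (t + real m * P) = 2 * pi * of_int ?j"
        using lam by (auto simp: P_def field_simps)
    qed
    then show "(\<Sum>m<N. y (t + real m * P)) \<le> integral {r0..R} (\<lambda>r. (cmod (f r))\<^sup>2 * r^3 / 2)"
      unfolding y_def
      using bessel_inverse_square[OF r0 f, of N "\<lambda>n. lam * (t + real n * P)"] by simp
  qed (auto intro!: integrable_continuous_interval continuous_intros continuous_on_compose2[OF y[of UNIV]])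
  also have "\<dots> = pi / \<bar>lam\<bar> * integral {r0..R} (\<lambda>r. (cmod (f r))\<^sup>2 * r^3)"
    using P by (simp add: P_def)
  finally show ?thesis unfolding y_def .
qed

section \<open>Inequalities on an interval and integrals depending on a parameter\<close>

lemma square_integral_le:
  fixes g :: "real \<Rightarrow> real"
  assumes ab: "a \<le> b" and g: "continuous_on {a..b} g"
  shows "(integral {a..b} g)\<^sup>2 \<le> (b - a) * integral {a..b} (\<lambda>x. (g x)\<^sup>2)"
proof (cases "a = b")
  case False
  \<comment> \<open>Cauchy-Schwarz against the constant 1, read as nonnegativity of the variance
    about the mean m.\<close>
  define m where "m = integral {a..b} g / (b - a)"
  have ig: "(g has_integral (b - a) * m) {a..b}"
    using False by (simp add: m_def integrable_integral integrable_continuous_interval[OF g])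
  have ig2: "((\<lambda>x. (g x)\<^sup>2) has_integral integral {a..b} (\<lambda>x. (g x)\<^sup>2)) {a..b}"
    by (intro integrable_integral integrable_continuous_interval continuous_intros g)
  have "((\<lambda>x. (g x)\<^sup>2 - 2 * m * g x + m\<^sup>2) has_integral
      (integral {a..b} (\<lambda>x. (g x)\<^sup>2) - 2 * m * ((b - a) * m) + (b - a) * m\<^sup>2)) {a..b}"
    using has_integral_const_real[of "m\<^sup>2" a b] ab
    by (intro has_integral_add has_integral_diff has_integral_mult_right ig ig2) auto
  moreover have "(g x)\<^sup>2 - 2 * m * g x + m\<^sup>2 \<ge> 0" for x
    using zero_le_power2[of "g x - m"] by (simp add: power2_eq_square algebra_simps)
  ultimately have "0 \<le> integral {a..b} (\<lambda>x. (g x)\<^sup>2) - 2 * m * ((b - a) * m) + (b - a) * m\<^sup>2"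
    by (rule has_integral_nonneg)
  then have "(b - a) * m\<^sup>2 \<le> integral {a..b} (\<lambda>x. (g x)\<^sup>2)"
    by (simp add: power2_eq_square algebra_simps)
  then have "(b - a) * ((b - a) * m\<^sup>2) \<le> (b - a) * integral {a..b} (\<lambda>x. (g x)\<^sup>2)"
    using ab by (intro mult_left_mono) auto
  moreover have "integral {a..b} g = (b - a) * m" using False by (simp add: m_def)
  ultimately show ?thesis by (simp add: power2_eq_square mult_ac)
qed simp

text \<open>The value y t differs from every y s by at most the integral of |y'|, whose square is at
  most T times the integral of |y'|^2. Squaring and averaging over s in the interval gives the
  bound.\<close>

lemma sobolev_interval:
  fixes y :: "real \<Rightarrow> complex"
  assumes T: "T > 0"
    and y: "\<And>s. s \<in> {a..a + T} \<Longrightarrow> (y has_vector_derivative y' s) (at s within {a..a + T})"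
    and y': "continuous_on {a..a + T} y'" and t: "t \<in> {a..a + T}"
  shows "(cmod (y t))\<^sup>2 \<le> 2 / T * integral {a..a + T} (\<lambda>s. (cmod (y s))\<^sup>2)
      + 2 * T * integral {a..a + T} (\<lambda>s. (cmod (y' s))\<^sup>2)"
proof -
  let ?I = "{a..a + T}"
  define V where "V = integral ?I (\<lambda>s. (cmod (y' s))\<^sup>2)"
  have cy: "continuous_on ?I y"
    using has_vector_derivative_continuous[OF y] by (simp add: continuous_on_eq_continuous_within)
  have iy: "(\<lambda>s. cmod (y' s)) integrable_on ?I"
    by (intro integrable_continuous_interval continuous_intros y')
  have V: "(integral ?I (\<lambda>s. cmod (y' s)))\<^sup>2 \<le> T * V"
    unfolding V_def using square_integral_le[of a "a + T" "\<lambda>s. cmod (y' s)"] T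
    by (auto intro: continuous_intros y')
  have inc: "cmod (y u - y v) \<le> integral ?I (\<lambda>s. cmod (y' s))" if "u \<in> ?I" "v \<in> ?I" "v \<le> u" for u v
  proof -
    have "(y' has_integral (y u - y v)) {v..u}"
      by (rule fundamental_theorem_of_calculus[OF that(3)])
         (use that in \<open>auto intro: has_vector_derivative_within_subset[OF y]\<close>)
    then have "cmod (y u - y v) = cmod (integral {v..u} y')" by (simp add: integral_unique)
    also have "\<dots> \<le> integral {v..u} (\<lambda>s. cmod (y' s))"
      using that by (intro integral_norm_bound_integral integrable_continuous_interval continuous_intros
          continuous_on_subset[OF y']) auto
    also have "\<dots> \<le> integral ?I (\<lambda>s. cmod (y' s))"
      using that by (intro integral_subset_le iy integrable_continuous_interval continuous_intros
          continuous_on_subset[OF y']) auto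
    finally show ?thesis .
  qed
  have pt: "(cmod (y t))\<^sup>2 \<le> 2 * (cmod (y s))\<^sup>2 + 2 * (T * V)" if s: "s \<in> ?I" for s
  proof -
    have "cmod (y t - y s) \<le> integral ?I (\<lambda>s. cmod (y' s))"
      using inc[OF t s] inc[OF s t] by (cases "s \<le> t") (auto simp: norm_minus_commute)
    then have "(cmod (y t - y s))\<^sup>2 \<le> T * V"
      using V power_mono[of "cmod (y t - y s)" "integral ?I (\<lambda>s. cmod (y' s))" 2] by simp
    moreover have "(cmod (y t))\<^sup>2 \<le> (cmod (y s) + cmod (y t - y s))\<^sup>2"
      using norm_triangle_ineq[of "y s" "y t - y s"] by (intro power_mono) auto
    moreover note power2_sum_le[of "cmod (y s)" "cmod (y t - y s)"]
    ultimately show ?thesis by (smt (verit))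
  qed
  have "integral ?I (\<lambda>s. (cmod (y t))\<^sup>2) \<le> integral ?I (\<lambda>s. 2 * (cmod (y s))\<^sup>2 + 2 * (T * V))"
    by (intro integral_le integrable_continuous_interval continuous_intros cy pt) auto
  also have "\<dots> = 2 * integral ?I (\<lambda>s. (cmod (y s))\<^sup>2) + T * (2 * (T * V))"
    using T by (subst integral_add)
      (auto intro!: integrable_continuous_interval continuous_intros cy)
  finally have "T * (cmod (y t))\<^sup>2 \<le> 2 * integral ?I (\<lambda>s. (cmod (y s))\<^sup>2) + T * (2 * (T * V))"
    using T by simp
  then show ?thesis unfolding V_def using T by (simp add: field_simps)
qed

lemma continuous_on_slice:
  assumes f: "continuous_on (U \<times> S) (\<lambda>(x, r). f x r)" and x: "x \<in> U"
  shows "continuous_on S (f x)"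
proof -
  have "continuous_on S (\<lambda>r. case (x, r) of (x, r) \<Rightarrow> f x r)"
    by (rule continuous_on_compose2[OF f]) (use x in \<open>auto intro!: continuous_intros\<close>)
  then show ?thesis by simp
qed

lemma continuous_on_integral_from:
  fixes f :: "'a::topological_space \<Rightarrow> real \<Rightarrow> 'b::euclidean_space"
  assumes f: "continuous_on (U \<times> {1..R}) (\<lambda>(x, r). f x r)"
  shows "continuous_on (U \<times> {1..R}) (\<lambda>(x, r'). integral {r'..R} (f x))"
proof -
  \<comment> \<open>The substitution r = r' + u(R - r') moves the variable endpoint into the
    integrand, so that continuity under an integral over the fixed interval [0,1] applies.\<close>
  have eq: "integral {r'..R} (f x) = integral (cbox 0 1) (\<lambda>u. (R - r') *\<^sub>R f x (r' + u * (R - r')))"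
    if "x \<in> U" "r' \<in> {1..R}" for x r'
  proof -
    have "continuous_on {1..R} (f x)"
      using continuous_on_slice[OF f] that by simp
    then have "continuous_on {r'..R} (f x)" by (rule continuous_on_subset) (use that in auto)
    then have "((\<lambda>u. (R - r') *\<^sub>R f x (r' + u * (R - r'))) has_integral
        integral {r' + 0 * (R - r')..r' + 1 * (R - r')} (f x)) {0..1}"
    proof (intro has_integral_substitution[where c = r' and d = R])
      show "(\<lambda>u. r' + u * (R - r')) ` {0..1} \<subseteq> {r'..R}"
      proof clarify
        fix u :: real assume "u \<in> {0..1}"
        then show "r' + u * (R - r') \<in> {r'..R}"
          using that mult_left_le_one_le[of "R - r'" u] by auto
      qed
    qed (use that in \<open>auto intro!: derivative_eq_intros\<close>)
    from integral_unique[OF this] show ?thesis by simp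
  qed
  have "continuous_on (U \<times> {1..R}) (\<lambda>z. integral (cbox 0 1)
      (\<lambda>u. (R - snd z) *\<^sub>R f (fst z) (snd z + u * (R - snd z))))"
  proof (rule integral_continuous_on_param)
    have "continuous_on ((U \<times> {1..R}) \<times> {0..1}) (\<lambda>q. f (fst (fst q)) (snd (fst q) + snd q * (R - snd (fst q))))"
    proof (rule continuous_on_compose2[OF f, where f = "\<lambda>q. (fst (fst q), snd (fst q) + snd q * (R - snd (fst q)))",
          unfolded split_beta fst_conv snd_conv])
      have "1 \<le> r + u * (R - r) \<and> r + u * (R - r) \<le> R" if "1 \<le> r" "r \<le> R" "0 \<le> u" "u \<le> 1" for r u
      proof -
        have "0 \<le> u * (R - r)" "u * (R - r) \<le> R - r"
          using that by (auto intro: mult_left_le_one_le)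
        then show ?thesis using that by linarith
      qed
      then show "(\<lambda>q. (fst (fst q), snd (fst q) + snd q * (R - snd (fst q)))) ` ((U \<times> {1..R}) \<times> {0..1}) \<subseteq> U \<times> {1..R}"
        by auto
    qed (intro continuous_intros)
    then show "continuous_on ((U \<times> {1..R}) \<times> cbox 0 1)
        (\<lambda>(z, u). (R - snd z) *\<^sub>R f (fst z) (snd z + u * (R - snd z)))"
      unfolding split_beta by (auto intro!: continuous_intros)
  qed
  then show ?thesis
    by (rule continuous_on_eq) (auto simp: eq)
qed

text \<open>Fubini on the triangle r' < r: the integral of r'^q over [1,r] is below r^(q+1)/(q+1),
  the source of the factor 1/p in the smoothing estimate. It is carried out by differentiating
  u^(q+1) Z(u)/(q+1), where Z is a tail integral; the boundary term at 1 has the favourable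
  sign.\<close>

lemma integral_triangle_le:
  fixes z :: "real \<Rightarrow> real"
  assumes R: "1 \<le> R" and z: "continuous_on {1..R} z" and nn: "\<And>r. r \<in> {1..R} \<Longrightarrow> 0 \<le> z r"
  shows "integral {1..R} (\<lambda>r'. integral {r'..R} (\<lambda>r. z r * (r' / r) ^ q))
    \<le> integral {1..R} (\<lambda>r. r * z r) / real (q + 1)"
proof -
  define Z where "Z u = integral {u..R} (\<lambda>r. z r / r ^ q)" for u
  have cz: "continuous_on {1..R} (\<lambda>r. z r / r ^ q)" by (intro continuous_intros z) auto
  have dZ: "(Z has_real_derivative - (z u / u ^ q)) (at u within {1..R})" if "u \<in> {1..R}" for u
    unfolding Z_def has_real_derivative_iff_has_vector_derivative
    using integral_has_vector_derivative'[OF cz that] by simp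
  have Zc: "continuous_on {1..R} Z"
    using dZ by (intro DERIV_continuous_on)
  have Z1: "Z 1 \<ge> 0" unfolding Z_def by (intro integral_nonneg integrable_continuous_interval cz) (auto simp: nn)
  have ZR: "Z R = 0" by (simp add: Z_def)
  have eq: "integral {r'..R} (\<lambda>r. z r * (r' / r) ^ q) = r' ^ q * Z r'" for r'
  proof -
    have "integral {r'..R} (\<lambda>r. z r * (r' / r) ^ q) = integral {r'..R} (\<lambda>r. r' ^ q * (z r / r ^ q))"
      by (simp add: power_divide mult.commute)
    also have "\<dots> = r' ^ q * Z r'"
      unfolding Z_def by (rule integral_mult_right)
    finally show ?thesis .
  qed
  have "((\<lambda>u. u ^ q * Z u - u * z u / real (q + 1)) has_integral
      (R ^ (q + 1) * Z R / real (q + 1) - 1 ^ (q + 1) * Z 1 / real (q + 1))) {1..R}"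
  proof (rule fundamental_theorem_of_calculus[OF R])
    fix u assume u: "u \<in> {1..R}"
    then have u0: "u \<noteq> 0" by auto
    have "((\<lambda>u. u ^ (q + 1) * Z u / real (q + 1)) has_real_derivative
       ((real (q + 1) * u ^ q) * Z u + u ^ (q + 1) * - (z u / u ^ q)) / real (q + 1)) (at u within {1..R})"
      by (rule derivative_eq_intros dZ[OF u] refl | simp)+
    also have "((real (q + 1) * u ^ q) * Z u + u ^ (q + 1) * - (z u / u ^ q)) / real (q + 1)
       = u ^ q * Z u - u * z u / real (q + 1)"
      using u0 by (simp add: diff_divide_distrib add_divide_distrib)
    finally show "((\<lambda>u. u ^ (q + 1) * Z u / real (q + 1)) has_vector_derivative
       u ^ q * Z u - u * z u / real (q + 1)) (at u within {1..R})"
      by (simp add: has_real_derivative_iff_has_vector_derivative)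
  qed
  then have "integral {1..R} (\<lambda>u. u ^ q * Z u - u * z u / real (q + 1)) = - Z 1 / real (q + 1)"
    by (simp add: integral_unique ZR)
  moreover have "integral {1..R} (\<lambda>u. u ^ q * Z u - u * z u / real (q + 1))
    = integral {1..R} (\<lambda>u. u ^ q * Z u) - integral {1..R} (\<lambda>u. u * z u) / real (q + 1)"
    by (subst integral_diff) (auto intro!: integrable_continuous_interval continuous_intros Zc z)
  moreover have "- Z 1 / real (q + 1) \<le> 0" using Z1 by simp
  ultimately show ?thesis unfolding eq by linarith
qed

section \<open>Local smoothing for the free transport\<close>

lemma continuous_on_slice2:
  assumes f: "continuous_on (S \<times> V) (\<lambda>(x, r). f x r)" and r: "r \<in> V"
  shows "continuous_on S (\<lambda>x. f x r)"
proof -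
  have "continuous_on S (\<lambda>x. case (x, r) of (x, r) \<Rightarrow> f x r)"
    by (rule continuous_on_compose2[OF f]) (use r in \<open>auto intro!: continuous_intros\<close>)
  then show ?thesis by simp
qed

lemma continuous_on_swap_args:
  assumes f: "continuous_on (S \<times> V) (\<lambda>(x, r). f x r)"
  shows "continuous_on (V \<times> S) (\<lambda>(r, x). f x r)"
proof -
  have "continuous_on (V \<times> S) (\<lambda>z. case (snd z, fst z) of (x, r) \<Rightarrow> f x r)"
    by (rule continuous_on_compose2[OF f]) (auto intro!: continuous_intros)
  then show ?thesis by (simp add: split_beta)
qed

lemma integral_swap_interval:
  fixes f :: "real \<Rightarrow> real \<Rightarrow> 'a::banach"
  assumes "continuous_on ({a..b} \<times> {c..d}) (\<lambda>(x, y). f x y)"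
  shows "integral {a..b} (\<lambda>x. integral {c..d} (f x)) = integral {c..d} (\<lambda>y. integral {a..b} (\<lambda>x. f x y))"
  using integral_swap_continuous[of a c b d f] assms by (simp add: cbox_Pair_eq)

lemma continuous_on_integral_interval:
  fixes f :: "'a::topological_space \<Rightarrow> real \<Rightarrow> 'b::banach"
  assumes "continuous_on (U \<times> {a..b}) (\<lambda>(x, t). f x t)"
  shows "continuous_on U (\<lambda>x. integral {a..b} (f x))"
  using integral_continuous_on_param[of U a b f] assms by simp

text \<open>The profile is frozen at time s and the transport phase runs with t. For t = s the two
  phases cancel and the weighted tail integral of the solution returns; for fixed s the dependence
  on t is a Fourier transform in r^(-2).\<close>

definition phase_integral :: "real \<Rightarrow> real \<Rightarrow> nat \<Rightarrow> (real \<Rightarrow> real \<Rightarrow> complex) \<Rightarrow> real \<Rightarrow> real \<Rightarrow> real \<Rightarrow> complex" where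
  "phase_integral R lam p u t s r' = of_real (r' ^ p) *
     integral {r'..R} (\<lambda>r. u s r * cis (lam * s / r\<^sup>2) * cis (- (lam * t) / r\<^sup>2) / of_real (r ^ p))"

lemma continuous_on_phase_integral:
  assumes u: "continuous_on (I \<times> {1..R}) (\<lambda>(s, r). u s r)"
  shows "continuous_on ((UNIV \<times> I) \<times> {1..R}) (\<lambda>((t, s), r'). phase_integral R lam p u t s r')"
proof -
  have "continuous_on ((UNIV \<times> I) \<times> {1..R}) (\<lambda>z. u (snd (fst z)) (snd z))"
    by (rule continuous_on_compose2[OF u, where f = "\<lambda>z. (snd (fst z), snd z)", unfolded split_beta fst_conv snd_conv])
       (auto intro!: continuous_intros)
  then have "continuous_on ((UNIV \<times> I) \<times> {1..R}) (\<lambda>(x, r). u (snd x) r * cis (lam * snd x / r\<^sup>2)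
      * cis (- (lam * fst x) / r\<^sup>2) / of_real (r ^ p))"
    unfolding split_beta by (auto intro!: continuous_intros)
  from continuous_on_integral_from[OF this] show ?thesis
    unfolding phase_integral_def split_beta by (auto intro!: continuous_intros)
qed

text \<open>Bessel in t for each frozen s costs a weight r^3 and keeps the factor (r'/r)^(2p); the
  integration over r' turns this factor into r/(2p + 1), whence the weight r^4.\<close>

lemma phase_integral_bound:
  assumes R: "1 \<le> R" and lam: "lam \<noteq> 0" and ab: "a \<le> b"
    and u: "continuous_on ({a..b} \<times> {1..R}) (\<lambda>(s, r). u s r)"
  shows "integral {1..R} (\<lambda>r'. integral {a..b} (\<lambda>t. integral {a..b} (\<lambda>s. (cmod (phase_integral R lam p u t s r'))\<^sup>2)))
    \<le> pi / (\<bar>lam\<bar> * real (2 * p + 1)) * integral {a..b} (\<lambda>s. integral {1..R} (\<lambda>r. r ^ 4 * (cmod (u s r))\<^sup>2))"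
proof -
  let ?I = "{a..b}" and ?A = "phase_integral R lam p u"
  define z where "z s r = (cmod (u s r))\<^sup>2 * r ^ 3" for s r
  define B where "B s r' = r' ^ (2 * p) * integral {r'..R} (\<lambda>r. z s r / r ^ (2 * p))" for s r'
  have us: "continuous_on {1..R} (u s)" if "s \<in> ?I" for s
    using continuous_on_slice[OF u that] .
  have cz: "continuous_on (?I \<times> {1..R}) (\<lambda>(s, r). z s r)"
    using u unfolding z_def split_beta by (auto intro!: continuous_intros)
  have cB: "continuous_on (?I \<times> {1..R}) (\<lambda>(s, r'). B s r')"
  proof -
    have "continuous_on (?I \<times> {1..R}) (\<lambda>(s, r). z s r / r ^ (2 * p))"
      using cz unfolding split_beta by (auto intro!: continuous_intros)
    from continuous_on_integral_from[OF this] show ?thesis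
      unfolding B_def split_beta by (auto intro!: continuous_intros)
  qed
  have cA: "continuous_on ((UNIV \<times> ?I) \<times> {1..R}) (\<lambda>((t, s), r'). ?A t s r')"
    by (rule continuous_on_phase_integral[OF u])
  have cA1: "continuous_on (({1..R} \<times> ?I) \<times> ?I) (\<lambda>((r', s), t). (cmod (?A t s r'))\<^sup>2)"
  proof -
    have "continuous_on (({1..R} \<times> ?I) \<times> ?I) (\<lambda>q. ?A (snd q) (snd (fst q)) (fst (fst q)))"
      by (rule continuous_on_compose2[OF cA, where f = "\<lambda>q. ((snd q, snd (fst q)), fst (fst q))",
            unfolded split_beta fst_conv snd_conv])
         (auto intro!: continuous_intros)
    then show ?thesis unfolding split_beta by (auto intro!: continuous_intros)
  qed
  have cA2: "continuous_on ({1..R} \<times> ?I) (\<lambda>(r', s). integral ?I (\<lambda>t. (cmod (?A t s r'))\<^sup>2))"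
    using continuous_on_integral_interval[of "{1..R} \<times> ?I" a b "\<lambda>q t. (cmod (?A t (snd q) (fst q)))\<^sup>2"] cA1
    by (simp add: split_beta)
  have bessel: "integral ?I (\<lambda>t. (cmod (?A t s r'))\<^sup>2) \<le> pi / \<bar>lam\<bar> * B s r'"
    if s: "s \<in> ?I" and r': "r' \<in> {1..R}" for s r'
  proof -
    \<comment> \<open>The phase in s is unimodular and disappears from |f|^2; the powers combine to
      (r'/r)^(2p).\<close>
    define f where "f r = of_real (r' ^ p) * (u s r * cis (lam * s / r\<^sup>2) / of_real (r ^ p))" for r
    have cf: "continuous_on {r'..R} f"
      unfolding f_def using r' by (intro continuous_intros continuous_on_subset[OF us[OF s]]) auto
    have "?A t s r' = integral {r'..R} (\<lambda>r. f r * cis (- (lam * t) / r\<^sup>2))" for t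
      unfolding phase_integral_def f_def by (subst integral_mult_right[symmetric]) (simp add: mult_ac)
    moreover have "integral {r'..R} (\<lambda>r. (cmod (f r))\<^sup>2 * r ^ 3) = B s r'"
      unfolding B_def integral_mult_right[symmetric]
      by (intro integral_cong)
         (use r' in \<open>simp add: f_def z_def norm_mult norm_divide norm_power power_mult_distrib power_divide
            power_mult power_even_eq mult_ac\<close>)
    ultimately show ?thesis
      using bessel_inverse_square_time[OF _ _ cf lam, of a b] r' by simp
  qed
  have tri: "integral {1..R} (B s) \<le> integral {1..R} (\<lambda>r. r ^ 4 * (cmod (u s r))\<^sup>2) / real (2 * p + 1)"
    if s: "s \<in> ?I" for s
  proof -
    have "integral {1..R} (\<lambda>r'. integral {r'..R} (\<lambda>r. z s r * (r' / r) ^ (2 * p)))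
        \<le> integral {1..R} (\<lambda>r. r * z s r) / real (2 * p + 1)"
      by (rule integral_triangle_le[OF R continuous_on_slice[OF cz s]]) (simp add: z_def)
    moreover have "integral {r'..R} (\<lambda>r. z s r * (r' / r) ^ (2 * p)) = B s r'" for r'
      unfolding B_def integral_mult_right[symmetric] by (simp add: power_divide mult.commute)
    moreover have "r * z s r = r ^ 4 * (cmod (u s r))\<^sup>2" for r
      by (simp add: z_def eval_nat_numeral)
    ultimately show ?thesis by simp
  qed
  \<comment> \<open>The integral in t is moved innermost, because Bessel applies with s and r'
    fixed.\<close>
  have "integral {1..R} (\<lambda>r'. integral ?I (\<lambda>t. integral ?I (\<lambda>s. (cmod (?A t s r'))\<^sup>2)))
      = integral {1..R} (\<lambda>r'. integral ?I (\<lambda>s. integral ?I (\<lambda>t. (cmod (?A t s r'))\<^sup>2)))"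
  proof (rule integral_cong, rule integral_swap_interval)
    fix r' assume r': "r' \<in> {1..R}"
    have "continuous_on (?I \<times> ?I) (\<lambda>q. ?A (fst q) (snd q) r')"
      by (rule continuous_on_compose2[OF cA, where f = "\<lambda>q. ((fst q, snd q), r')",
            unfolded split_beta fst_conv snd_conv])
         (use r' in \<open>auto intro!: continuous_intros\<close>)
    then show "continuous_on (?I \<times> ?I) (\<lambda>(t, s). (cmod (?A t s r'))\<^sup>2)"
      unfolding split_beta by (auto intro!: continuous_intros)
  qed
  also have "\<dots> = integral ?I (\<lambda>s. integral {1..R} (\<lambda>r'. integral ?I (\<lambda>t. (cmod (?A t s r'))\<^sup>2)))"
    by (rule integral_swap_interval[OF cA2])
  also have "\<dots> \<le> integral ?I (\<lambda>s. pi / (\<bar>lam\<bar> * real (2 * p + 1)) * integral {1..R} (\<lambda>r. r ^ 4 * (cmod (u s r))\<^sup>2))"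
  proof (rule integral_le)
    show "(\<lambda>s. integral {1..R} (\<lambda>r'. integral ?I (\<lambda>t. (cmod (?A t s r'))\<^sup>2))) integrable_on ?I"
      by (intro integrable_continuous_interval continuous_on_integral_interval continuous_on_swap_args[OF cA2])
    show "(\<lambda>s. pi / (\<bar>lam\<bar> * real (2 * p + 1)) * integral {1..R} (\<lambda>r. r ^ 4 * (cmod (u s r))\<^sup>2)) integrable_on ?I"
      using u by (intro integrable_continuous_interval continuous_on_mult continuous_on_const
          continuous_on_integral_interval) (auto simp: split_beta intro!: continuous_intros)
    fix s assume s: "s \<in> ?I"
    have "integral {1..R} (\<lambda>r'. integral ?I (\<lambda>t. (cmod (?A t s r'))\<^sup>2)) \<le> integral {1..R} (\<lambda>r'. pi / \<bar>lam\<bar> * B s r')"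
    proof (intro integral_le bessel s integrable_continuous_interval)
      show "continuous_on {1..R} (\<lambda>r'. integral ?I (\<lambda>t. (cmod (?A t s r'))\<^sup>2))"
        by (rule continuous_on_slice2[OF cA2 s])
      show "continuous_on {1..R} (\<lambda>r'. pi / \<bar>lam\<bar> * B s r')"
        by (intro continuous_intros continuous_on_slice[OF cB s])
    qed
    also have "\<dots> = pi / \<bar>lam\<bar> * integral {1..R} (B s)" by simp
    also have "\<dots> \<le> pi / \<bar>lam\<bar> * (integral {1..R} (\<lambda>r. r ^ 4 * (cmod (u s r))\<^sup>2) / real (2 * p + 1))"
      by (intro mult_left_mono tri s) auto
    finally show "integral {1..R} (\<lambda>r'. integral ?I (\<lambda>t. (cmod (?A t s r'))\<^sup>2))
      \<le> pi / (\<bar>lam\<bar> * real (2 * p + 1)) * integral {1..R} (\<lambda>r. r ^ 4 * (cmod (u s r))\<^sup>2)"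
      by simp
  qed
  finally show ?thesis by simp
qed

text \<open>For fixed t and r' the Sobolev inequality is applied in s and evaluated at s = t.
  Differentiation in s hits the profile e^(i lam s/r^2) w, and its derivative is the same phase
  times wt + i lam r^(-2) w, a quantity that vanishes for pure transport.\<close>

lemma local_smoothing:
  fixes w wt :: "real \<Rightarrow> real \<Rightarrow> complex"
  assumes R: "1 \<le> R" and lam: "lam \<noteq> 0" and T: "T > 0"
    and wt: "\<And>t r. t \<in> {a..a + T} \<Longrightarrow> r \<in> {1..R} \<Longrightarrow>
      ((\<lambda>s. w s r) has_vector_derivative wt t r) (at t within {a..a + T})"
    and cw: "continuous_on ({a..a + T} \<times> {1..R}) (\<lambda>(t, r). w t r)"
    and cwt: "continuous_on ({a..a + T} \<times> {1..R}) (\<lambda>(t, r). wt t r)"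
  shows "integral {a..a + T} (\<lambda>t. integral {1..R} (\<lambda>r'. (cmod (of_real (r' ^ p) *
            integral {r'..R} (\<lambda>r. w t r / of_real (r ^ p))))\<^sup>2))
    \<le> pi / (\<bar>lam\<bar> * real (2 * p + 1)) *
       (2 / T * integral {a..a + T} (\<lambda>t. integral {1..R} (\<lambda>r. r ^ 4 * (cmod (w t r))\<^sup>2))
        + 2 * T * integral {a..a + T} (\<lambda>t. integral {1..R} (\<lambda>r. r ^ 4 *
            (cmod (wt t r + \<i> * of_real (lam / r\<^sup>2) * w t r))\<^sup>2)))"
proof -
  let ?I = "{a..a + T}"
  define G where "G t r = wt t r + \<i> * of_real (lam / r\<^sup>2) * w t r" for t r
  let ?A = "phase_integral R lam p w" and ?A' = "phase_integral R lam p G"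
  have cG: "continuous_on (?I \<times> {1..R}) (\<lambda>(t, r). G t r)"
    using cw cwt unfolding G_def split_beta by (auto intro!: continuous_intros)
  have cA: "continuous_on ((UNIV \<times> ?I) \<times> {1..R}) (\<lambda>((t, s), r'). phase_integral R lam p u t s r')"
    if "continuous_on (?I \<times> {1..R}) (\<lambda>(s, r). u s r)" for u
    by (rule continuous_on_phase_integral[OF that])
  have dA: "((\<lambda>s. ?A t s r') has_vector_derivative ?A' t s r') (at s within ?I)"
    if s: "s \<in> ?I" and r': "r' \<in> {1..R}" for t s r'
  proof -
    define f where "f s r = w s r * cis (lam * s / r\<^sup>2) * cis (- (lam * t) / r\<^sup>2) / of_real (r ^ p)" for s r
    define f' where "f' s r = G s r * cis (lam * s / r\<^sup>2) * cis (- (lam * t) / r\<^sup>2) / of_real (r ^ p)" for s r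
    have sub: "{r'..R} \<subseteq> {1..R}" using r' by auto
    have "((\<lambda>s. integral (cbox r' R) (f s)) has_vector_derivative integral (cbox r' R) (f' s)) (at s within ?I)"
    proof (rule leibniz_rule_vector_derivative[OF _ _ _ s])
      fix s r assume s: "s \<in> ?I" and "r \<in> cbox r' R"
      then have r: "r \<in> {1..R}" using sub by auto
      have dc: "((\<lambda>s. cis (lam * s / r\<^sup>2)) has_vector_derivative (\<i> * of_real (lam / r\<^sup>2)) * cis (lam * s / r\<^sup>2)) (at s within ?I)"
      proof -
        have "((\<lambda>s. exp (of_real s * (\<i> * of_real (lam / r\<^sup>2)))) has_vector_derivative
            (\<i> * of_real (lam / r\<^sup>2)) * exp (of_real s * (\<i> * of_real (lam / r\<^sup>2)))) (at s within ?I)"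
          by (rule has_vector_derivative_real_field derivative_eq_intros refl | simp)+
        moreover have "exp (of_real s * (\<i> * complex_of_real (lam / r\<^sup>2))) = cis (lam * s / r\<^sup>2)" for s
          by (simp add: cis_conv_exp mult_ac)
        ultimately show ?thesis by (simp only:)
      qed
      have "((\<lambda>s. (w s r * cis (lam * s / r\<^sup>2)) * (cis (- (lam * t) / r\<^sup>2) / of_real (r ^ p)))
          has_vector_derivative (w s r * ((\<i> * of_real (lam / r\<^sup>2)) * cis (lam * s / r\<^sup>2))
          + wt s r * cis (lam * s / r\<^sup>2)) * (cis (- (lam * t) / r\<^sup>2) / of_real (r ^ p))) (at s within ?I)"
        by (intro has_vector_derivative_mult_left has_vector_derivative_mult wt s r dc)
      then show "((\<lambda>s. f s r) has_vector_derivative f' s r) (at s within ?I)"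
        by (simp add: f_def f'_def G_def algebra_simps add_divide_distrib)
    next
      fix s assume s: "s \<in> ?I"
      show "f s integrable_on cbox r' R"
        unfolding f_def using r' continuous_on_subset[OF continuous_on_slice[OF cw s] sub]
        by (auto intro!: integrable_continuous_interval continuous_intros)
    next
      have "continuous_on (?I \<times> cbox r' R) (\<lambda>(t, r). G t r)"
        by (rule continuous_on_subset[OF cG]) (use sub in auto)
      then show "continuous_on (?I \<times> cbox r' R) (\<lambda>(x, t). f' x t)"
        unfolding f'_def split_beta using r' by (auto intro!: continuous_intros)
    qed auto
    then have "((\<lambda>s. integral {r'..R} (f s)) has_vector_derivative integral {r'..R} (f' s)) (at s within ?I)"
      by simp
    from has_vector_derivative_mult_right[OF this, of "of_real (r' ^ p)"]
    show ?thesis unfolding phase_integral_def f_def f'_def .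
  qed
  have diag: "?A t t r' = of_real (r' ^ p) * integral {r'..R} (\<lambda>r. w t r / of_real (r ^ p))" for t r'
    unfolding phase_integral_def by (simp add: mult.assoc cis_mult)
  have c1: "continuous_on (?I \<times> {1..R}) (\<lambda>(t, r'). (cmod (?A t t r'))\<^sup>2)"
  proof -
    have "continuous_on (?I \<times> {1..R}) (\<lambda>q. ?A (fst q) (fst q) (snd q))"
      by (rule continuous_on_compose2[OF cA[OF cw], where f = "\<lambda>q. ((fst q, fst q), snd q)",
            unfolded split_beta fst_conv snd_conv])
         (auto intro!: continuous_intros)
    then show ?thesis unfolding split_beta by (auto intro!: continuous_intros)
  qed
  have c2: "continuous_on ({1..R} \<times> ?I) (\<lambda>(r', t). integral ?I (\<lambda>s. (cmod (phase_integral R lam p u t s r'))\<^sup>2))"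
    if u: "continuous_on (?I \<times> {1..R}) (\<lambda>(s, r). u s r)" for u
  proof -
    have "continuous_on (({1..R} \<times> ?I) \<times> ?I) (\<lambda>q. phase_integral R lam p u (snd (fst q)) (snd q) (fst (fst q)))"
      by (rule continuous_on_compose2[OF cA[OF u], where f = "\<lambda>q. ((snd (fst q), snd q), fst (fst q))",
            unfolded split_beta fst_conv snd_conv])
         (auto intro!: continuous_intros)
    then have "continuous_on (({1..R} \<times> ?I) \<times> ?I) (\<lambda>(q, s). (cmod (phase_integral R lam p u (snd q) s (fst q)))\<^sup>2)"
      unfolding split_beta by (auto intro!: continuous_intros)
    from continuous_on_integral_interval[OF this] show ?thesis by (simp add: split_beta)
  qed
  note c2w = c2[OF cw] and c2G = c2[OF cG]
  have c3: "continuous_on {1..R} (\<lambda>r'. integral ?I (\<lambda>t. integral ?I (\<lambda>s. (cmod (phase_integral R lam p u t s r'))\<^sup>2)))"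
    if u: "continuous_on (?I \<times> {1..R}) (\<lambda>(s, r). u s r)" for u
    by (rule continuous_on_integral_interval[OF c2[OF u]])
  have "integral ?I (\<lambda>t. integral {1..R} (\<lambda>r'. (cmod (?A t t r'))\<^sup>2))
      = integral {1..R} (\<lambda>r'. integral ?I (\<lambda>t. (cmod (?A t t r'))\<^sup>2))"
    by (rule integral_swap_interval[OF c1])
  also have "\<dots> \<le> integral {1..R} (\<lambda>r'.
      2 / T * integral ?I (\<lambda>t. integral ?I (\<lambda>s. (cmod (?A t s r'))\<^sup>2))
      + 2 * T * integral ?I (\<lambda>t. integral ?I (\<lambda>s. (cmod (?A' t s r'))\<^sup>2)))"
  proof (rule integral_le)
    show "(\<lambda>r'. integral ?I (\<lambda>t. (cmod (?A t t r'))\<^sup>2)) integrable_on {1..R}"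
      by (intro integrable_continuous_interval continuous_on_integral_interval continuous_on_swap_args[OF c1])
    show "(\<lambda>r'. 2 / T * integral ?I (\<lambda>t. integral ?I (\<lambda>s. (cmod (?A t s r'))\<^sup>2))
      + 2 * T * integral ?I (\<lambda>t. integral ?I (\<lambda>s. (cmod (?A' t s r'))\<^sup>2))) integrable_on {1..R}"
      by (intro integrable_continuous_interval continuous_intros c3 cw cG)
    fix r' assume r': "r' \<in> {1..R}"
    have i1: "(\<lambda>t. integral ?I (\<lambda>s. (cmod (?A t s r'))\<^sup>2)) integrable_on ?I"
      and i2: "(\<lambda>t. integral ?I (\<lambda>s. (cmod (?A' t s r'))\<^sup>2)) integrable_on ?I"
      by (intro integrable_continuous_interval continuous_on_slice[OF c2w r'] continuous_on_slice[OF c2G r'])+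
    have "integral ?I (\<lambda>t. (cmod (?A t t r'))\<^sup>2) \<le> integral ?I (\<lambda>t.
        2 / T * integral ?I (\<lambda>s. (cmod (?A t s r'))\<^sup>2) + 2 * T * integral ?I (\<lambda>s. (cmod (?A' t s r'))\<^sup>2))"
    proof (rule integral_le)
      show "(\<lambda>t. (cmod (?A t t r'))\<^sup>2) integrable_on ?I"
        by (intro integrable_continuous_interval continuous_on_slice2[OF c1 r'])
      show "(\<lambda>t. 2 / T * integral ?I (\<lambda>s. (cmod (?A t s r'))\<^sup>2)
          + 2 * T * integral ?I (\<lambda>s. (cmod (?A' t s r'))\<^sup>2)) integrable_on ?I"
        by (intro integrable_add integrable_on_mult_right i1 i2)
      fix t assume t: "t \<in> ?I"
      have "continuous_on ?I (\<lambda>s. ?A' t s r')"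
        by (rule continuous_on_compose2[OF cA[OF cG], where f = "\<lambda>s. ((t, s), r')",
              unfolded split_beta fst_conv snd_conv])
           (use r' in \<open>auto intro!: continuous_intros\<close>)
      then show "(cmod (?A t t r'))\<^sup>2 \<le> 2 / T * integral ?I (\<lambda>s. (cmod (?A t s r'))\<^sup>2)
          + 2 * T * integral ?I (\<lambda>s. (cmod (?A' t s r'))\<^sup>2)"
        by (intro sobolev_interval T t dA r')
    qed
    also have "\<dots> = 2 / T * integral ?I (\<lambda>t. integral ?I (\<lambda>s. (cmod (?A t s r'))\<^sup>2))
        + 2 * T * integral ?I (\<lambda>t. integral ?I (\<lambda>s. (cmod (?A' t s r'))\<^sup>2))"
      by (subst integral_add) (simp_all only: integrable_on_mult_right i1 i2 integral_mult_right)
    finally show "integral ?I (\<lambda>t. (cmod (?A t t r'))\<^sup>2) \<le> \<dots>" .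
  qed
  also have "\<dots> = 2 / T * integral {1..R} (\<lambda>r'. integral ?I (\<lambda>t. integral ?I (\<lambda>s. (cmod (?A t s r'))\<^sup>2)))
      + 2 * T * integral {1..R} (\<lambda>r'. integral ?I (\<lambda>t. integral ?I (\<lambda>s. (cmod (?A' t s r'))\<^sup>2)))"
    by (subst integral_add)
       (simp_all only: integrable_on_mult_right integral_mult_right
          integrable_continuous_interval[OF c3[OF cw]] integrable_continuous_interval[OF c3[OF cG]])
  also have "\<dots> \<le> 2 / T * (pi / (\<bar>lam\<bar> * real (2 * p + 1)) * integral ?I (\<lambda>s. integral {1..R} (\<lambda>r. r ^ 4 * (cmod (w s r))\<^sup>2)))
      + 2 * T * (pi / (\<bar>lam\<bar> * real (2 * p + 1)) * integral ?I (\<lambda>s. integral {1..R} (\<lambda>r. r ^ 4 * (cmod (G s r))\<^sup>2)))"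
    using T by (intro add_mono mult_left_mono phase_integral_bound R lam cw cG) auto
  finally show ?thesis unfolding diag G_def by (simp add: algebra_simps)
qed

section \<open>Hypocoercivity\<close>

text \<open>Here a, b, c stand for |w|/r, |w1| and r|w2|. The mixed terms are absorbed into the
  diagonal ones; 1/40 and 1/100 are small enough for this whenever \<delta> \<le> 1 and \<delta>^2 K
  \<le> 1.\<close>

lemma hypocoercive_real_bound:
  fixes \<delta> K a b c :: real
  assumes \<delta>: "0 < \<delta>" "\<delta> \<le> 1" and K: "3 / 4 \<le> K" and \<delta>K: "\<delta>\<^sup>2 * K \<le> 1"
  shows "- 2 * \<delta>^3 * b\<^sup>2 - 2 * \<delta>^3 * K * a\<^sup>2 - 2 * (1/40) * \<delta>^5 * (c\<^sup>2 + 2 * (- (c * b)))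
      + 2 * (1/40) * \<delta>^5 * K * (a * c + 2 * (a * b)) + 4 * (1/40) * \<delta>\<^sup>2 * (a * b) - 2 * (1/100) * \<delta> * a\<^sup>2
      + (1/100) * \<delta>^4 * (a * c + 2 * (c * b) - 2 * K * (- (a * b)))
    \<le> - (\<delta>^3 * b\<^sup>2 + \<delta>^3 * K * a\<^sup>2 + \<delta> / 100 * a\<^sup>2 + \<delta>^5 / 80 * c\<^sup>2)"
proof -
  \<comment> \<open>One square for each mixed term, weighted so as to reproduce the mixed product
    exactly: cb, Kac, Kab at order \<delta>^5, then ab at order \<delta>^2, then ac, cb, Kab at
    order \<delta>^4. Their c^2 parts add up to 3\<delta>^5/80, which leaves \<delta>^5/80 of the
    available \<delta>^5/20.\<close>
  have sq: "0 \<le> \<delta>^5 / 80 * (c - 4 * b)\<^sup>2" "0 \<le> \<delta>^5 / 80 * (c - 2 * K * a)\<^sup>2" "0 \<le> \<delta>^5 / 20 * (b - K * a)\<^sup>2"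
    "0 \<le> \<delta> / 2 * (\<delta> * b - a / 10)\<^sup>2" "0 \<le> \<delta>^3 / 160 * (\<delta> * c - 4 / 5 * a)\<^sup>2"
    "0 \<le> \<delta>^3 / 160 * (\<delta> * c - 8 / 5 * b)\<^sup>2" "0 \<le> \<delta>^3 / 100 * (\<delta> * K * a - b)\<^sup>2"
    using \<delta> by simp_all
  have d53: "\<delta>^5 \<le> \<delta>^3" using \<delta> by (intro power_decreasing) auto
  have "\<delta>^5 * b\<^sup>2 \<le> \<delta>^3 * b\<^sup>2" by (intro mult_right_mono d53) auto
  moreover have "\<delta>^5 * (K\<^sup>2 * a\<^sup>2) \<le> \<delta>^3 * (K * a\<^sup>2)"
  proof -
    have "(\<delta>\<^sup>2 * K) * (\<delta>^3 * (K * a\<^sup>2)) \<le> 1 * (\<delta>^3 * (K * a\<^sup>2))"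
      using \<delta> K by (intro mult_right_mono \<delta>K) auto
    then show ?thesis by (simp add: eval_nat_numeral mult_ac)
  qed
  moreover have "\<delta>^3 * a\<^sup>2 \<le> 4 / 3 * (\<delta>^3 * (K * a\<^sup>2))"
  proof -
    have "3 / 4 * (\<delta>^3 * a\<^sup>2) \<le> K * (\<delta>^3 * a\<^sup>2)" using \<delta> K by (intro mult_right_mono) auto
    then show ?thesis by (simp add: mult_ac)
  qed
  moreover have "0 \<le> \<delta>^3 * b\<^sup>2" "0 \<le> \<delta>^3 * (K * a\<^sup>2)" "0 \<le> \<delta> * a\<^sup>2"
    using \<delta> K by simp_all
  ultimately show ?thesis using sq
    by (simp add: power2_diff power_mult_distrib algebra_simps eval_nat_numeral add_divide_distrib diff_divide_distrib)
qed

text \<open>The added multiples have integral zero for functions vanishing at both ends, so they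
  perform the integrations by parts pointwise. The decisive output is -2\<gamma>\<delta>|w/r|^2: it
  arises from the transport term paired with the cross term, because r d/dr maps r^(-2) to
  -2r^(-2).\<close>

lemma hypocoercive_identity:
  fixes w w1 w2 :: complex and r \<delta> K \<kappa> \<alpha> \<gamma> :: real
  assumes r: "r > 0" and \<kappa>: "\<kappa>\<^sup>2 = 1"
  defines "v \<equiv> of_real (\<delta>^3) * (w2 - of_real (K / r\<^sup>2) * w) - \<i> * of_real (\<kappa> / r\<^sup>2) * w"
  shows "Re (v * (2 * cnj w - of_real (2 * \<alpha> * \<delta>\<^sup>2) * cnj (of_real (r\<^sup>2) * w2 + of_real (2 * r) * w1)
           - \<i> * of_real (\<kappa> * \<gamma> * \<delta>) * (cnj w + of_real (2 * r) * cnj w1)))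
      - 2 * \<delta>^3 * Re (w2 * cnj w + w1 * cnj w1) - 2 * \<alpha> * \<delta>\<^sup>2 * Re (\<i> * of_real \<kappa> * (w * cnj w2 + w1 * cnj w1))
      + \<gamma> * \<delta> * (2 * Re (w * cnj w1) / r - (cmod w)\<^sup>2 / r\<^sup>2)
    = - 2 * \<delta>^3 * (cmod w1)\<^sup>2 - 2 * \<delta>^3 * K * (cmod w / r)\<^sup>2
      - 2 * \<alpha> * \<delta>^5 * ((r * cmod w2)\<^sup>2 + 2 * Re (of_real r * w2 * cnj w1))
      + 2 * \<alpha> * \<delta>^5 * K * (Re (w * cnj w2) + 2 * Re (w / of_real r * cnj w1))
      + 4 * \<alpha> * \<delta>\<^sup>2 * Re (\<i> * of_real \<kappa> * (w / of_real r) * cnj w1) - 2 * \<gamma> * \<delta> * (cmod w / r)\<^sup>2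
      + \<gamma> * \<delta>^4 * (Re (- \<i> * of_real \<kappa> * w2 * cnj w) + 2 * Re (- \<i> * of_real \<kappa> * (of_real r * w2) * cnj w1)
           - 2 * K * Re (- \<i> * of_real \<kappa> * (w / of_real r) * cnj w1))"
proof -
  have \<kappa>': "\<kappa> = 1 \<or> \<kappa> = - 1" using \<kappa> by (simp add: power2_eq_1_iff)
  \<comment> \<open>Writing w = r^2 u clears the denominators; in real coordinates the claim is a
    polynomial identity for each sign \<kappa>.\<close>
  define u where "u = w / of_real (r\<^sup>2)"
  have w: "w = of_real (r * r) * u" using r by (simp add: u_def power2_eq_square)
  have quot: "of_real (K / r\<^sup>2) * w = of_real K * u" "of_real (\<kappa> / r\<^sup>2) * w = of_real \<kappa> * u"
    "w / of_real r = of_real r * u" "cmod w / r = r * cmod u" "(cmod w)\<^sup>2 / r\<^sup>2 = (r * cmod u)\<^sup>2"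
    "Re (w * cnj w1) / r = r * Re (u * cnj w1)"
    using r by (simp_all add: w norm_mult power_mult_distrib power2_eq_square mult.assoc)
  have v: "v = of_real (\<delta>^3) * (w2 - of_real K * u) - \<i> * (of_real \<kappa> * u)"
    unfolding v_def quot[symmetric] by (simp add: mult.assoc)
  have c: "2 * Re (w * cnj w1) / r = 2 * (r * Re (u * cnj w1))"
    by (simp only: times_divide_eq_right[symmetric] quot(6))
  obtain x y x1 y1 x2 y2 where xy: "u = Complex x y" "w1 = Complex x1 y1" "w2 = Complex x2 y2"
    by (metis complex.exhaust)
  from \<kappa>' show ?thesis
    unfolding v c quot unfolding power_mult_distrib cmod_power2 unfolding w xy
    by (elim disjE) (simp_all add: power_mult_distrib cmod_power2 algebra_simps eval_nat_numeral)
qed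

text \<open>Each mixed real part is at most the product of two of the moduli |w|/r, |w1|, r|w2|,
  which reduces the identity to the scalar inequality.\<close>

lemma hypocoercive_pointwise:
  fixes w w1 w2 :: complex and r \<delta> K \<kappa> :: real
  assumes r: "r > 0" and \<kappa>: "\<kappa>\<^sup>2 = 1" and \<delta>: "0 < \<delta>" "\<delta> \<le> 1" and K: "3 / 4 \<le> K" and \<delta>K: "\<delta>\<^sup>2 * K \<le> 1"
  defines "v \<equiv> of_real (\<delta>^3) * (w2 - of_real (K / r\<^sup>2) * w) - \<i> * of_real (\<kappa> / r\<^sup>2) * w"
  shows "Re (v * (2 * cnj w - of_real (2 * (1/40) * \<delta>\<^sup>2) * cnj (of_real (r\<^sup>2) * w2 + of_real (2 * r) * w1)
           - \<i> * of_real (\<kappa> * (1/100) * \<delta>) * (cnj w + of_real (2 * r) * cnj w1)))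
      - 2 * \<delta>^3 * Re (w2 * cnj w + w1 * cnj w1) - 2 * (1/40) * \<delta>\<^sup>2 * Re (\<i> * of_real \<kappa> * (w * cnj w2 + w1 * cnj w1))
      + (1/100) * \<delta> * (2 * Re (w * cnj w1) / r - (cmod w)\<^sup>2 / r\<^sup>2)
    \<le> - (\<delta>^3 * (cmod w1)\<^sup>2 + \<delta>^3 * K * (cmod w / r)\<^sup>2 + \<delta> / 100 * (cmod w / r)\<^sup>2 + \<delta>^5 / 80 * (r * cmod w2)\<^sup>2)"
proof -
  let ?a = "cmod w / r" and ?b = "cmod w1" and ?c = "r * cmod w2"
  have \<kappa>1: "\<bar>\<kappa>\<bar> = 1" using \<kappa> by (simp add: power2_eq_1_iff abs_if) auto
  have b1: "- Re (of_real r * w2 * cnj w1) \<le> ?c * ?b"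
    using complex_Re_le_cmod[of "- (of_real r * w2 * cnj w1)"] r by (simp add: norm_mult)
  have b2: "Re (w * cnj w2) \<le> ?a * ?c"
    by (rule order_trans[OF complex_Re_le_cmod]) (use r in \<open>simp add: norm_mult\<close>)
  have b3: "Re (w / of_real r * cnj w1) \<le> ?a * ?b"
    by (rule order_trans[OF complex_Re_le_cmod]) (use r in \<open>simp add: norm_mult norm_divide\<close>)
  have b4: "\<bar>Re (\<i> * of_real \<kappa> * (w / of_real r) * cnj w1)\<bar> \<le> ?a * ?b"
    by (rule order_trans[OF abs_Re_le_cmod]) (use r \<kappa>1 in \<open>simp add: norm_mult norm_divide\<close>)
  have b5: "Re (- \<i> * of_real \<kappa> * w2 * cnj w) \<le> ?a * ?c"
    by (rule order_trans[OF complex_Re_le_cmod]) (use r \<kappa>1 in \<open>simp add: norm_mult mult.commute\<close>)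
  have b6: "Re (- \<i> * of_real \<kappa> * (of_real r * w2) * cnj w1) \<le> ?c * ?b"
    by (rule order_trans[OF complex_Re_le_cmod]) (use r \<kappa>1 in \<open>simp add: norm_mult\<close>)
  have b7: "- Re (- \<i> * of_real \<kappa> * (w / of_real r) * cnj w1) \<le> ?a * ?b"
    using complex_Re_le_cmod[of "\<i> * of_real \<kappa> * (w / of_real r) * cnj w1"] r \<kappa>1
    by (simp add: norm_mult norm_divide)
  show ?thesis
    unfolding v_def hypocoercive_identity[OF r \<kappa>]
    by (rule order_trans[OF _ hypocoercive_real_bound[OF \<delta> K \<delta>K]])
       (use b1 b2 b3 b4 b5 b6 b7 \<delta> K in \<open>intro add_mono diff_mono mult_left_mono order_refl; auto\<close>)
qed

section \<open>Time derivatives of quadratic functionals\<close>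

text \<open>For a quadratic N the increment is linear in w t - w t0, with a continuous factor Z that
  may contain spatial derivatives. Only w itself is then differentiated in t; the class
  \<open>C12\<close> provides no time derivative of the radial derivatives that occur in N.\<close>

lemma has_real_derivative_of_polarization:
  fixes w wt Z :: "real \<Rightarrow> real \<Rightarrow> complex" and N :: "real \<Rightarrow> real"
  assumes t0: "t0 > 0"
    and wt: "\<And>t r. t > 0 \<Longrightarrow> r \<in> {a..b} \<Longrightarrow> ((\<lambda>s. w s r) has_vector_derivative wt t r) (at t)"
    and cw: "continuous_on ({0<..} \<times> {a..b}) (\<lambda>(t, r). w t r)"
    and cwt: "continuous_on ({0<..} \<times> {a..b}) (\<lambda>(t, r). wt t r)"
    and cZ: "continuous_on ({0<..} \<times> {a..b}) (\<lambda>(t, r). Z t r)"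
    and N: "\<And>t. t > 0 \<Longrightarrow> N t - N t0 = integral {a..b} (\<lambda>r. Re ((w t r - w t0 r) * Z t r))"
  shows "(N has_real_derivative integral {a..b} (\<lambda>r. Re (wt t0 r * Z t0 r))) (at t0)"
proof -
  define h where "h s t = integral {a..b} (\<lambda>r. Re (wt s r * Z t r))" for s t
  have ch: "continuous_on ({0<..} \<times> {0<..}) (\<lambda>(s, t). h s t)"
  proof -
    have "continuous_on (({0<..} \<times> {0<..}) \<times> {a..b}) (\<lambda>q. wt (fst (fst q)) (snd q))"
      by (rule continuous_on_compose2[OF cwt, where f = "\<lambda>q. (fst (fst q), snd q)", unfolded split_beta fst_conv snd_conv])
         (auto intro!: continuous_intros)
    moreover have "continuous_on (({0<..} \<times> {0<..}) \<times> {a..b}) (\<lambda>q. Z (snd (fst q)) (snd q))"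
      by (rule continuous_on_compose2[OF cZ, where f = "\<lambda>q. (snd (fst q), snd q)", unfolded split_beta fst_conv snd_conv])
         (auto intro!: continuous_intros)
    ultimately have "continuous_on (({0<..} \<times> {0<..}) \<times> {a..b}) (\<lambda>(q, r). Re (wt (fst q) r * Z (snd q) r))"
      unfolding split_beta by (auto intro!: continuous_intros)
    from continuous_on_integral_interval[OF this] show ?thesis unfolding h_def by (simp add: split_beta)
  qed
  have dH: "((\<lambda>s. integral {a..b} (\<lambda>r. Re ((w s r - w t0 r) * Z t r))) has_real_derivative h s t) (at s)"
    if s: "s > 0" and t: "t > 0" for s t
  proof -
    have Zt: "continuous_on {a..b} (Z t)" by (rule continuous_on_slice[OF cZ]) (use t in auto)
    have w0: "continuous_on {a..b} (w s)" if "s > 0" for s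
      by (rule continuous_on_slice[OF cw]) (use that in auto)
    have "((\<lambda>s. integral (cbox a b) (\<lambda>r. Re ((w s r - w t0 r) * Z t r))) has_vector_derivative
       integral (cbox a b) (\<lambda>r. Re (wt s r * Z t r))) (at s within {0<..})"
    proof (rule leibniz_rule_vector_derivative)
      fix x r :: real assume x: "x \<in> {0<..}" and r: "r \<in> cbox a b"
      have "((\<lambda>x. w x r) has_vector_derivative wt x r) (at x within {0<..})"
        using wt[of x r] x r by (auto intro: has_vector_derivative_at_within)
      then have "((\<lambda>x. (w x r - w t0 r) * Z t r) has_vector_derivative (wt x r - 0) * Z t r) (at x within {0<..})"
        by (intro has_vector_derivative_mult_left has_vector_derivative_diff has_vector_derivative_const)
      from bounded_linear.has_vector_derivative[OF bounded_linear_Re this]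
      show "((\<lambda>x. Re ((w x r - w t0 r) * Z t r)) has_vector_derivative Re (wt x r * Z t r)) (at x within {0<..})"
        by (simp add: o_def)
    next
      fix x :: real assume "x \<in> {0<..}"
      then show "(\<lambda>r. Re ((w x r - w t0 r) * Z t r)) integrable_on cbox a b"
        using w0[of x] w0[OF t0] Zt by (auto intro!: integrable_continuous_interval continuous_intros)
    next
      have "continuous_on ({0<..} \<times> {a..b}) (\<lambda>q. Z t (snd q))"
        by (rule continuous_on_compose2[OF Zt]) (auto intro!: continuous_intros)
      then show "continuous_on ({0<..} \<times> cbox a b) (\<lambda>(x, r). Re (wt x r * Z t r))"
        using cwt unfolding split_beta by (auto intro!: continuous_intros)
    qed (use s in auto)
    then have "((\<lambda>s. integral (cbox a b) (\<lambda>r. Re ((w s r - w t0 r) * Z t r))) has_vector_derivative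
       integral (cbox a b) (\<lambda>r. Re (wt s r * Z t r))) (at s)"
      using s by (simp add: at_within_open[of s "{0<..}"])
    then show ?thesis by (simp add: h_def has_real_derivative_iff_has_vector_derivative)
  qed
  \<comment> \<open>Mean value theorem in the first time, with the argument of Z frozen at t. The
    increment becomes (t - t0) times h at a point near (t0, t0), and joint continuity of h
    identifies the limit.\<close>
  have mvt: "\<exists>\<xi>. \<xi> > 0 \<and> \<bar>\<xi> - t0\<bar> \<le> \<bar>t - t0\<bar> \<and> N t - N t0 = (t - t0) * h \<xi> t" if t: "t > 0" "t \<noteq> t0" for t
  proof -
    let ?H = "\<lambda>s. integral {a..b} (\<lambda>r. Re ((w s r - w t0 r) * Z t r))"
    have H0: "?H t0 = 0" by simp
    show ?thesis
    proof (cases "t0 < t")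
      case True
      obtain z where "t0 < z" "z < t" "?H t - ?H t0 = (t - t0) * h z t"
        using MVT2[OF True, of ?H "\<lambda>s. h s t"] dH t t0 by auto
      then show ?thesis using N[OF t(1)] H0 t0 by (intro exI[of _ z]) auto
    next
      case False
      then have lt: "t < t0" using t by simp
      obtain z where "t < z" "z < t0" "?H t0 - ?H t = (t0 - t) * h z t"
        using MVT2[OF lt, of ?H "\<lambda>s. h s t"] dH t by auto
      then show ?thesis using N[OF t(1)] H0 t by (intro exI[of _ z]) (auto simp: algebra_simps)
    qed
  qed
  show ?thesis
    unfolding has_field_derivative_iff h_def[symmetric]
  proof (rule LIM_I)
    fix e :: real assume e: "e > 0"
    obtain d where d: "d > 0" and dh: "\<And>q. q \<in> {0<..} \<times> {0<..} \<Longrightarrow> dist q (t0, t0) < d \<Longrightarrow>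
        dist (h (fst q) (snd q)) (h t0 t0) < e"
      using ch[unfolded continuous_on_iff, rule_format, of "(t0, t0)" e] e t0 by (auto simp: split_beta)
    show "\<exists>s>0. \<forall>t. t \<noteq> t0 \<and> norm (t - t0) < s \<longrightarrow> norm ((N t - N t0) / (t - t0) - h t0 t0) < e"
    proof (intro exI conjI allI impI)
      show "min t0 (d / 2) > 0" using d t0 by simp
      fix t assume t: "t \<noteq> t0 \<and> norm (t - t0) < min t0 (d / 2)"
      then have "t > 0" by (auto simp: abs_less_iff)
      with mvt t obtain \<xi> where \<xi>: "\<xi> > 0" "\<bar>\<xi> - t0\<bar> \<le> \<bar>t - t0\<bar>" "N t - N t0 = (t - t0) * h \<xi> t" by blast
      have "dist (\<xi>, t) (t0, t0) \<le> dist \<xi> t0 + dist t t0"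
        by (simp add: dist_Pair_Pair sqrt_sum_squares_le_sum)
      also have "\<dots> < d" using \<xi>(2) t by (simp add: dist_real_def)
      finally have "dist (h \<xi> t) (h t0 t0) < e"
        using dh[of "(\<xi>, t)"] \<xi>(1) \<open>t > 0\<close> by simp
      then show "norm ((N t - N t0) / (t - t0) - h t0 t0) < e"
        using \<xi>(3) t by (simp add: dist_real_def)
    qed
  qed
qed

section \<open>The rescaled equation and its energies\<close>

text \<open>The viscosity is \<beta>\<delta>^3, the transport coefficient is \<beta>\<kappa> with a
  sign \<kappa>, and K stands for k^2 - 1/4, hence at least 3/4. The derivatives are parameters w1,
  w2, wt, which keeps the calculus free of \<open>dr\<close> and \<open>dt\<close>.\<close>

locale radial_flow =
  fixes R \<beta> \<delta> K \<kappa> :: real and w w1 w2 wt :: "real \<Rightarrow> real \<Rightarrow> complex"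
  assumes R: "1 < R" and \<beta>: "0 < \<beta>" and \<delta>: "0 < \<delta>" and K: "3 / 4 \<le> K" and \<kappa>: "\<kappa>\<^sup>2 = 1"
    and dw: "\<And>t r. t > 0 \<Longrightarrow> r \<in> {1..R} \<Longrightarrow> (w t has_vector_derivative w1 t r) (at r within {1..R})"
    and dw1: "\<And>t r. t > 0 \<Longrightarrow> r \<in> {1..R} \<Longrightarrow> (w1 t has_vector_derivative w2 t r) (at r within {1..R})"
    and dwt: "\<And>t r. t > 0 \<Longrightarrow> r \<in> {1..R} \<Longrightarrow> ((\<lambda>s. w s r) has_vector_derivative wt t r) (at t)"
    and cw: "continuous_on ({0<..} \<times> {1..R}) (\<lambda>(t, r). w t r)"
    and cw1: "continuous_on ({0<..} \<times> {1..R}) (\<lambda>(t, r). w1 t r)"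
    and cw2: "continuous_on ({0<..} \<times> {1..R}) (\<lambda>(t, r). w2 t r)"
    and cwt: "continuous_on ({0<..} \<times> {1..R}) (\<lambda>(t, r). wt t r)"
    and bc: "\<And>t. t > 0 \<Longrightarrow> w t 1 = 0" "\<And>t. t > 0 \<Longrightarrow> w t R = 0"
    and eqn: "\<And>t r. t > 0 \<Longrightarrow> r \<in> {1..R} \<Longrightarrow> wt t r = of_real \<beta> *
      (of_real (\<delta>^3) * (w2 t r - of_real (K / r\<^sup>2) * w t r) - \<i> * of_real (\<kappa> / r\<^sup>2) * w t r)"
begin

lemma continuous_on_w:
  assumes "t > 0"
  shows "continuous_on {1..R} (w t)" "continuous_on {1..R} (w1 t)"
    "continuous_on {1..R} (w2 t)" "continuous_on {1..R} (wt t)"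
  by (rule continuous_on_slice[OF cw] continuous_on_slice[OF cw1] continuous_on_slice[OF cw2]
       continuous_on_slice[OF cwt]; use assms in simp)+

text \<open>The cross term, of first order in r, is what turns transport into decay. For \<alpha> =
  \<gamma> = 0 this is the mass, so one derivative formula serves both the mass and the hypocoercive
  energy.\<close>

definition energy :: "real \<Rightarrow> real \<Rightarrow> real \<Rightarrow> real" where
  "energy \<alpha> \<gamma> t = integral {1..R} (\<lambda>r. (cmod (w t r))\<^sup>2 + \<alpha> * \<delta>\<^sup>2 * (r * cmod (w1 t r))\<^sup>2
      + \<gamma> * \<delta> * \<kappa> * Re (\<i> * of_real r * w1 t r * cnj (w t r)))"

definition grad_sq :: "real \<Rightarrow> real" where
  "grad_sq t = integral {1..R} (\<lambda>r. (cmod (w1 t r))\<^sup>2)"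

definition hardy_sq :: "real \<Rightarrow> real" where
  "hardy_sq t = integral {1..R} (\<lambda>r. (cmod (w t r) / r)\<^sup>2)"

definition hess_sq :: "real \<Rightarrow> real" where
  "hess_sq t = integral {1..R} (\<lambda>r. (r * cmod (w2 t r))\<^sup>2)"

text \<open>Total derivative of w1 times the conjugate of w, a product vanishing at both ends. Its
  real and imaginary parts are two of the null terms added in the hypocoercive estimate.\<close>

lemma ftc_parts:
  assumes t: "t > 0"
  shows "((\<lambda>r. w2 t r * cnj (w t r) + w1 t r * cnj (w1 t r)) has_integral 0) {1..R}"
proof -
  have "((\<lambda>r. w1 t r * cnj (w t r)) has_vector_derivative w1 t r * cnj (w1 t r) + w2 t r * cnj (w t r))
      (at r within {1..R})" if "r \<in> {1..R}" for r
    by (intro has_vector_derivative_mult dw1 bounded_linear.has_vector_derivative[OF bounded_linear_cnj] dw t that)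
  from fundamental_theorem_of_calculus[OF _ this] show ?thesis
    using R bc[OF t] by (simp add: add.commute)
qed

text \<open>Total derivative of |w|^2/r. It trades the mixed term of w and w1 for the Hardy density
  |w|^2/r^2.\<close>

lemma ftc_hardy:
  assumes t: "t > 0"
  shows "((\<lambda>r. 2 * Re (w t r * cnj (w1 t r)) / r - (cmod (w t r))\<^sup>2 / r\<^sup>2) has_integral 0) {1..R}"
proof -
  have "((\<lambda>r. Re (w t r * cnj (w t r)) * (1 / r)) has_vector_derivative
      Re (w t r * cnj (w t r)) * (- 1 / r\<^sup>2) + Re (w t r * cnj (w1 t r) + w1 t r * cnj (w t r)) * (1 / r))
      (at r within {1..R})" if r: "r \<in> {1..R}" for r
  proof (intro has_vector_derivative_mult bounded_linear.has_vector_derivative[OF bounded_linear_cnj]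
      bounded_linear.has_vector_derivative[OF bounded_linear_Re] dw t r)
    show "((\<lambda>r. 1 / r) has_vector_derivative - 1 / r\<^sup>2) (at r within {1..R})"
      unfolding has_real_derivative_iff_has_vector_derivative[symmetric]
      by (rule derivative_eq_intros refl | use r in \<open>simp add: power2_eq_square\<close>)+
  qed
  from fundamental_theorem_of_calculus[OF _ this]
  have "((\<lambda>r. Re (w t r * cnj (w t r)) * (- 1 / r\<^sup>2) + Re (w t r * cnj (w1 t r) + w1 t r * cnj (w t r)) * (1 / r))
      has_integral 0) {1..R}"
    using R bc[OF t] by simp
  moreover have "Re (w t r * cnj (w t r)) * (- 1 / r\<^sup>2) + Re (w t r * cnj (w1 t r) + w1 t r * cnj (w t r)) * (1 / r)
      = 2 * Re (w t r * cnj (w1 t r)) / r - (cmod (w t r))\<^sup>2 / r\<^sup>2" for r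
    unfolding cmod_power2 by (simp add: algebra_simps add_divide_distrib power2_eq_square)
  ultimately show ?thesis by (simp only:)
qed

text \<open>The increment of the gradient part contains w1 t - w1 t0, for which no derivative in t
  is at hand. Since w t - w t0 vanishes at both ends, integration by parts in r moves the radial
  derivative onto the other factor and leaves the form needed for differentiation in t.\<close>

lemma energy_polarization:
  assumes t: "t > 0" and t0: "t0 > 0"
  shows "energy \<alpha> \<gamma> t - energy \<alpha> \<gamma> t0 = integral {1..R} (\<lambda>r. Re ((w t r - w t0 r) *
    (cnj (w t r + w t0 r)
     - of_real (\<alpha> * \<delta>\<^sup>2) * cnj (of_real (r\<^sup>2) * (w2 t r + w2 t0 r) + of_real (2 * r) * (w1 t r + w1 t0 r))
     - \<i> * of_real (\<kappa> * \<gamma> * \<delta>) * (cnj (w t r) + of_real r * cnj (w1 t r) + of_real r * cnj (w1 t0 r)))))"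
    (is "_ = integral _ (\<lambda>r. Re (?f r))")
proof -
  let ?e = "\<lambda>t r. (cmod (w t r))\<^sup>2 + \<alpha> * \<delta>\<^sup>2 * (r * cmod (w1 t r))\<^sup>2
      + \<gamma> * \<delta> * \<kappa> * Re (\<i> * of_real r * w1 t r * cnj (w t r))"
  note c = continuous_on_w
  have e: "energy \<alpha> \<gamma> t - energy \<alpha> \<gamma> t0 = integral {1..R} (\<lambda>r. ?e t r - ?e t0 r)"
    unfolding energy_def
    by (intro integral_diff[symmetric] integrable_continuous_interval continuous_intros c t t0)
  let ?D = "\<lambda>r. w t r - w t0 r" and ?D1 = "\<lambda>r. w1 t r - w1 t0 r"
  \<comment> \<open>\<open>?P\<close> is the boundary expression of this integration by parts and
    \<open>?P'\<close> its derivative; the integrands of the two sides differ by the real part of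
    \<open>?P'\<close>.\<close>
  let ?P = "\<lambda>r. of_real (\<alpha> * \<delta>\<^sup>2) * (?D r * cnj (of_real (r\<^sup>2) * (w1 t r + w1 t0 r)))
      + (\<i> * of_real (\<gamma> * \<delta> * \<kappa>)) * (?D r * (of_real r * cnj (w t r)))"
  let ?P' = "\<lambda>r. of_real (\<alpha> * \<delta>\<^sup>2) * (?D r * cnj (of_real (r\<^sup>2) * (w2 t r + w2 t0 r) + of_real (2 * r) * (w1 t r + w1 t0 r))
         + ?D1 r * cnj (of_real (r\<^sup>2) * (w1 t r + w1 t0 r)))
      + (\<i> * of_real (\<gamma> * \<delta> * \<kappa>)) * (?D r * (of_real r * cnj (w1 t r) + 1 * cnj (w t r)) + ?D1 r * (of_real r * cnj (w t r)))"
  have dr: "((\<lambda>r. of_real (r\<^sup>2)) has_vector_derivative complex_of_real (2 * r)) (at r within {1..R})"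
    "(of_real has_vector_derivative (1::complex)) (at r within {1..R})" for r
    by (auto intro!: has_vector_derivative_of_real derivative_eq_intros simp: has_vector_derivative_def scaleR_conv_of_real fun_eq_iff mult_ac)
  have "(?P has_vector_derivative ?P' r) (at r within {1..R})" if "r \<in> {1..R}" for r
    by (intro has_vector_derivative_add has_vector_derivative_mult_right has_vector_derivative_mult has_vector_derivative_diff
        bounded_linear.has_vector_derivative[OF bounded_linear_cnj] dr dw dw1 t t0 that)
  from fundamental_theorem_of_calculus[OF _ this]
  have "(?P' has_integral 0) {1..R}" using R bc[OF t] bc[OF t0] by simp
  from has_integral_linear[OF this bounded_linear_Re]
  have P: "((\<lambda>r. Re (?P' r)) has_integral 0) {1..R}" by (simp add: o_def)
  have f: "((\<lambda>r. Re (?f r)) has_integral integral {1..R} (\<lambda>r. Re (?f r))) {1..R}"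
    by (intro integrable_integral integrable_continuous_interval continuous_intros c t t0)
  have "?e t r - ?e t0 r = Re (?f r) + Re (?P' r)" for r
    unfolding power_mult_distrib cmod_power2
    by (simp add: algebra_simps eval_nat_numeral)
  then have "integral {1..R} (\<lambda>r. ?e t r - ?e t0 r) = integral {1..R} (\<lambda>r. Re (?f r))"
    using has_integral_add[OF f P] by (simp add: integral_unique)
  then show ?thesis using e by simp
qed

end

lemma integral_le_of_derivative_le:
  fixes f :: "real \<Rightarrow> real"
  assumes st: "s \<le> t" and f: "\<And>x. x \<in> {s..t} \<Longrightarrow> (f has_real_derivative f' x) (at x)"
    and le: "\<And>x. x \<in> {s..t} \<Longrightarrow> f' x \<le> - g x" and g: "continuous_on {s..t} g" and nn: "0 \<le> f t"
  shows "integral {s..t} g \<le> f s"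
proof -
  have "(f' has_integral (f t - f s)) {s..t}"
  proof (rule fundamental_theorem_of_calculus[OF st])
    fix x assume "x \<in> {s..t}"
    from has_field_derivative_at_within[OF f[OF this]]
    show "(f has_vector_derivative f' x) (at x within {s..t})"
      by (simp add: has_real_derivative_iff_has_vector_derivative)
  qed
  moreover have "((\<lambda>x. - g x) has_integral - integral {s..t} g) {s..t}"
    by (intro has_integral_neg integrable_integral integrable_continuous_interval g)
  ultimately have "f t - f s \<le> - integral {s..t} g" by (rule has_integral_le) (rule le)
  then show ?thesis using nn by linarith
qed

context radial_flow
begin

lemma has_integral_of_continuous:
  fixes f :: "real \<Rightarrow> 'b::banach"
  assumes "continuous_on {1..R} f"
  shows "(f has_integral integral {1..R} f) {1..R}"
  by (intro integrable_integral integrable_continuous_interval assms)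

lemma has_integral_squares:
  assumes t: "t > 0"
  shows "((\<lambda>r. (cmod (w1 t r))\<^sup>2) has_integral grad_sq t) {1..R}"
    "((\<lambda>r. (cmod (w t r) / r)\<^sup>2) has_integral hardy_sq t) {1..R}"
    "((\<lambda>r. (r * cmod (w2 t r))\<^sup>2) has_integral hess_sq t) {1..R}"
    "((\<lambda>r. (cmod (w t r))\<^sup>2) has_integral energy 0 0 t) {1..R}"
proof -
  note c = continuous_on_w[OF t]
  show "((\<lambda>r. (cmod (w1 t r))\<^sup>2) has_integral grad_sq t) {1..R}"
    unfolding grad_sq_def by (intro has_integral_of_continuous continuous_intros c)
  show "((\<lambda>r. (cmod (w t r) / r)\<^sup>2) has_integral hardy_sq t) {1..R}"
    unfolding hardy_sq_def by (intro has_integral_of_continuous continuous_intros c) auto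
  show "((\<lambda>r. (r * cmod (w2 t r))\<^sup>2) has_integral hess_sq t) {1..R}"
    unfolding hess_sq_def by (intro has_integral_of_continuous continuous_intros c)
  have "((\<lambda>r. (cmod (w t r))\<^sup>2) has_integral integral {1..R} (\<lambda>r. (cmod (w t r))\<^sup>2)) {1..R}"
    by (intro has_integral_of_continuous continuous_intros c)
  then show "((\<lambda>r. (cmod (w t r))\<^sup>2) has_integral energy 0 0 t) {1..R}"
    by (simp add: energy_def)
qed

lemma squares_nonneg:
  "0 \<le> grad_sq t" "0 \<le> hardy_sq t" "0 \<le> hess_sq t" if "t > 0"
  by (auto intro: has_integral_nonneg[OF has_integral_squares(1)[OF that]]
      has_integral_nonneg[OF has_integral_squares(2)[OF that]] has_integral_nonneg[OF has_integral_squares(3)[OF that]])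

lemma continuous_on_squares:
  "continuous_on {0<..} grad_sq" "continuous_on {0<..} hardy_sq" "continuous_on {0<..} hess_sq"
  "continuous_on {0<..} (energy \<alpha> \<gamma>)"
  unfolding grad_sq_def[abs_def] hardy_sq_def[abs_def] hess_sq_def[abs_def] energy_def[abs_def]
  using cw cw1 cw2
  by (auto intro!: continuous_on_integral_interval continuous_intros simp: split_beta)

lemma energy_derivative:
  assumes t: "t > 0"
  shows "(energy \<alpha> \<gamma> has_real_derivative integral {1..R} (\<lambda>r. Re (wt t r *
     (2 * cnj (w t r) - of_real (2 * \<alpha> * \<delta>\<^sup>2) * cnj (of_real (r\<^sup>2) * w2 t r + of_real (2 * r) * w1 t r)
           - \<i> * of_real (\<kappa> * \<gamma> * \<delta>) * (cnj (w t r) + of_real (2 * r) * cnj (w1 t r)))))) (at t)"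
proof -
  define Z where "Z s r = cnj (w s r + w t r)
     - of_real (\<alpha> * \<delta>\<^sup>2) * cnj (of_real (r\<^sup>2) * (w2 s r + w2 t r) + of_real (2 * r) * (w1 s r + w1 t r))
     - \<i> * of_real (\<kappa> * \<gamma> * \<delta>) * (cnj (w s r) + of_real r * cnj (w1 s r) + of_real r * cnj (w1 t r))" for s r
  have snd: "continuous_on ({0<..} \<times> {1..R}) (\<lambda>q. f (snd q))" if "continuous_on {1..R} f" for f :: "real \<Rightarrow> complex"
    by (rule continuous_on_compose2[OF that]) (auto intro!: continuous_intros)
  have "continuous_on ({0<..} \<times> {1..R}) (\<lambda>(s, r). Z s r)"
    unfolding Z_def split_beta
    using cw cw1 cw2 snd[OF continuous_on_w(1)[OF t]] snd[OF continuous_on_w(2)[OF t]] snd[OF continuous_on_w(3)[OF t]]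
    by (auto intro!: continuous_intros simp: split_beta)
  then have "(energy \<alpha> \<gamma> has_real_derivative integral {1..R} (\<lambda>r. Re (wt t r * Z t r))) (at t)"
    using t dwt cw cwt energy_polarization[OF _ t, of _ \<alpha> \<gamma>, folded Z_def]
    by (intro has_real_derivative_of_polarization[where w = w and wt = wt and Z = Z and a = 1 and b = R])
  moreover have "Z t r = 2 * cnj (w t r) - of_real (2 * \<alpha> * \<delta>\<^sup>2) * cnj (of_real (r\<^sup>2) * w2 t r + of_real (2 * r) * w1 t r)
           - \<i> * of_real (\<kappa> * \<gamma> * \<delta>) * (cnj (w t r) + of_real (2 * r) * cnj (w1 t r))" for r
    by (simp add: Z_def algebra_simps)
  ultimately show ?thesis by simp
qed

text \<open>The transport term is skew and drops out of the real part, so the mass sees only the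
  viscous dissipation.\<close>

lemma mass_derivative:
  assumes t: "t > 0"
  shows "(energy 0 0 has_real_derivative - 2 * \<beta> * \<delta>^3 * (grad_sq t + K * hardy_sq t)) (at t)"
proof -
  have "((\<lambda>r. 2 * \<beta> * \<delta>^3 * Re (w2 t r * cnj (w t r) + w1 t r * cnj (w1 t r))
        - 2 * \<beta> * \<delta>^3 * ((cmod (w1 t r))\<^sup>2 + K * (cmod (w t r) / r)\<^sup>2)) has_integral
      (2 * \<beta> * \<delta>^3 * Re 0 - 2 * \<beta> * \<delta>^3 * (grad_sq t + K * hardy_sq t))) {1..R}"
    using has_integral_linear[OF ftc_parts[OF t] bounded_linear_Re] unfolding o_def
    by (intro has_integral_diff has_integral_mult_right has_integral_add has_integral_squares t)
  moreover have "2 * \<beta> * \<delta>^3 * Re (w2 t r * cnj (w t r) + w1 t r * cnj (w1 t r))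
        - 2 * \<beta> * \<delta>^3 * ((cmod (w1 t r))\<^sup>2 + K * (cmod (w t r) / r)\<^sup>2) = Re (wt t r * (2 * cnj (w t r)))"
    if r: "r \<in> {1..R}" for r
    unfolding eqn[OF t r] power_divide cmod_power2
    using r by (simp add: algebra_simps power2_eq_square add_divide_distrib)
  ultimately have "((\<lambda>r. Re (wt t r * (2 * cnj (w t r)))) has_integral
      (2 * \<beta> * \<delta>^3 * Re 0 - 2 * \<beta> * \<delta>^3 * (grad_sq t + K * hardy_sq t))) {1..R}"
    by (rule has_integral_eq[rotated])
  then have "integral {1..R} (\<lambda>r. Re (wt t r * (2 * cnj (w t r)))) = - 2 * \<beta> * \<delta>^3 * (grad_sq t + K * hardy_sq t)"
    by (simp add: integral_unique)
  then show ?thesis using energy_derivative[OF t, of 0 0] by simp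
qed

abbreviation hypo_energy :: "real \<Rightarrow> real" where
  "hypo_energy \<equiv> energy (1/40) (1/100)"

text \<open>The terms with \<delta>^3 and \<delta>^5 are viscous. The term \<delta>/100 times
  \<open>hardy_sq\<close> comes from the cross term; being of order \<delta> instead of \<delta>^3,
  it yields the enhanced decay rate.\<close>

definition dissipation :: "real \<Rightarrow> real" where
  "dissipation t = \<delta>^3 * grad_sq t + \<delta>^3 * K * hardy_sq t + \<delta> / 100 * hardy_sq t + \<delta>^5 / 80 * hess_sq t"

lemma continuous_on_dissipation: "continuous_on {0<..} dissipation"
  unfolding dissipation_def[abs_def] by (intro continuous_intros continuous_on_squares)

lemma dissipation_nonneg: "t > 0 \<Longrightarrow> 0 \<le> dissipation t"
  unfolding dissipation_def using squares_nonneg[of t] \<delta> K by simp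

lemma hypo_energy_derivative:
  assumes t: "t > 0" and \<delta>1: "\<delta> \<le> 1" and \<delta>K: "\<delta>\<^sup>2 * K \<le> 1"
  obtains D where "(hypo_energy has_real_derivative D) (at t)" "D \<le> - \<beta> * dissipation t"
proof -
  note c = continuous_on_w[OF t]
  let ?n = "\<lambda>r. - 2 * \<delta>^3 * Re (w2 t r * cnj (w t r) + w1 t r * cnj (w1 t r))
       - 2 * (1/40) * \<delta>\<^sup>2 * Re (\<i> * of_real \<kappa> * (w t r * cnj (w2 t r) + w1 t r * cnj (w1 t r)))
       + (1/100) * \<delta> * (2 * Re (w t r * cnj (w1 t r)) / r - (cmod (w t r))\<^sup>2 / r\<^sup>2)"
  let ?d = "\<lambda>r. \<delta>^3 * (cmod (w1 t r))\<^sup>2 + \<delta>^3 * K * (cmod (w t r) / r)\<^sup>2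
       + \<delta> / 100 * (cmod (w t r) / r)\<^sup>2 + \<delta>^5 / 80 * (r * cmod (w2 t r))\<^sup>2"
  define Z where "Z r = 2 * cnj (w t r) - of_real (2 * (1/40) * \<delta>\<^sup>2) * cnj (of_real (r\<^sup>2) * w2 t r + of_real (2 * r) * w1 t r)
           - \<i> * of_real (\<kappa> * (1/100) * \<delta>) * (cnj (w t r) + of_real (2 * r) * cnj (w1 t r))" for r
  define D where "D = integral {1..R} (\<lambda>r. Re (wt t r * Z r))"
  have D: "(hypo_energy has_real_derivative D) (at t)"
    unfolding D_def Z_def using energy_derivative[OF t, of "1/40" "1/100"] .
  have cZ: "continuous_on {1..R} Z"
    unfolding Z_def by (intro continuous_intros c)
  have z1: "((\<lambda>r. Re (w2 t r * cnj (w t r) + w1 t r * cnj (w1 t r))) has_integral 0) {1..R}"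
    using has_integral_linear[OF ftc_parts[OF t] bounded_linear_Re] by (simp add: o_def)
  have z2: "((\<lambda>r. Re (\<i> * of_real \<kappa> * (w t r * cnj (w2 t r) + w1 t r * cnj (w1 t r)))) has_integral 0) {1..R}"
  proof -
    have "((\<lambda>r. \<kappa> * Im (w2 t r * cnj (w t r) + w1 t r * cnj (w1 t r))) has_integral \<kappa> * Im 0) {1..R}"
      using has_integral_linear[OF ftc_parts[OF t] bounded_linear_Im] unfolding o_def
      by (intro has_integral_mult_right)
    moreover have "\<kappa> * Im (w2 t r * cnj (w t r) + w1 t r * cnj (w1 t r))
        = Re (\<i> * of_real \<kappa> * (w t r * cnj (w2 t r) + w1 t r * cnj (w1 t r)))" for r
      by (simp add: algebra_simps)
    ultimately show ?thesis by (simp only: zero_complex.sel mult_zero_right)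
  qed
  \<comment> \<open>Three vanishing integrals are added to the derivative, after which the integrand
    is bounded pointwise by minus the dissipation density.\<close>
  have "((\<lambda>r. Re (wt t r * Z r) + \<beta> * ?n r) has_integral
     D + \<beta> * (- 2 * \<delta>^3 * 0 - 2 * (1/40) * \<delta>\<^sup>2 * 0 + (1/100) * \<delta> * 0)) {1..R}"
    unfolding D_def
    by (intro has_integral_add has_integral_diff has_integral_mult_right z1 z2 ftc_hardy t
        has_integral_of_continuous continuous_intros c cZ)
  moreover have "((\<lambda>r. - \<beta> * ?d r) has_integral - \<beta> * dissipation t) {1..R}"
    unfolding dissipation_def
    by (intro has_integral_mult_right has_integral_add has_integral_squares t)
  ultimately have "D + \<beta> * (- 2 * \<delta>^3 * 0 - 2 * (1/40) * \<delta>\<^sup>2 * 0 + (1/100) * \<delta> * 0) \<le> - \<beta> * dissipation t"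
  proof (rule has_integral_le)
    fix r assume r: "r \<in> {1..R}"
    define v where "v = of_real (\<delta>^3) * (w2 t r - of_real (K / r\<^sup>2) * w t r) - \<i> * of_real (\<kappa> / r\<^sup>2) * w t r"
    have r0: "r > 0" using r by simp
    have wtv: "wt t r = of_real \<beta> * v" using eqn[OF t r] by (simp add: v_def)
    have "Re (wt t r * Z r) = \<beta> * Re (v * Z r)" unfolding wtv by (simp add: algebra_simps)
    then have "Re (wt t r * Z r) + \<beta> * ?n r
      = \<beta> * (Re (v * Z r) - 2 * \<delta>^3 * Re (w2 t r * cnj (w t r) + w1 t r * cnj (w1 t r))
       - 2 * (1/40) * \<delta>\<^sup>2 * Re (\<i> * of_real \<kappa> * (w t r * cnj (w2 t r) + w1 t r * cnj (w1 t r)))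
       + (1/100) * \<delta> * (2 * Re (w t r * cnj (w1 t r)) / r - (cmod (w t r))\<^sup>2 / r\<^sup>2))"
      by (simp only: distrib_left right_diff_distrib mult_minus_left mult_minus_right minus_mult_left[symmetric])
    also have "\<dots> \<le> \<beta> * (- ?d r)"
      using \<beta> unfolding v_def Z_def
      by (intro mult_left_mono hypocoercive_pointwise[OF r0 \<kappa> \<delta> \<delta>1 K \<delta>K]) auto
    finally show "Re (wt t r * Z r) + \<beta> * ?n r
       \<le> - \<beta> * ?d r" by (simp only: mult_minus_left mult_minus_right)
  qed
  then have "D \<le> - \<beta> * dissipation t" by simp
  with D show ?thesis by (rule that)
qed

lemma mass_le_hardy: "t > 0 \<Longrightarrow> energy 0 0 t \<le> R\<^sup>2 * hardy_sq t"
proof (rule has_integral_le[OF has_integral_squares(4) has_integral_mult_right[OF has_integral_squares(2)]])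
  fix r assume r: "r \<in> {1..R}"
  have "(cmod (w t r))\<^sup>2 = r\<^sup>2 * (cmod (w t r) / r)\<^sup>2" using r by (simp add: power_divide)
  also have "\<dots> \<le> R\<^sup>2 * (cmod (w t r) / r)\<^sup>2" using r by (intro mult_right_mono power_mono) auto
  finally show "(cmod (w t r))\<^sup>2 \<le> R\<^sup>2 * (cmod (w t r) / r)\<^sup>2" .
qed auto

text \<open>By the inequality of arithmetic and geometric means the cross term is at most 1/200 of
  \<delta>^2|r w1|^2 + |w|^2, which the diagonal coefficients 1/40 and 1 dominate; in the upper
  bound r \<le> R removes the weight.\<close>

lemma hypo_energy_bounds:
  assumes t: "t > 0"
  shows "0 \<le> hypo_energy t" "hypo_energy t \<le> 2 * energy 0 0 t + \<delta>\<^sup>2 * R\<^sup>2 / 20 * grad_sq t"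
proof -
  note c = continuous_on_w[OF t]
  let ?e = "\<lambda>r. (cmod (w t r))\<^sup>2 + (1/40) * \<delta>\<^sup>2 * (r * cmod (w1 t r))\<^sup>2
      + (1/100) * \<delta> * \<kappa> * Re (\<i> * of_real r * w1 t r * cnj (w t r))"
  have e: "(?e has_integral hypo_energy t) {1..R}"
    unfolding energy_def by (intro has_integral_of_continuous continuous_intros c)
  have cross: "\<bar>(1/100) * \<delta> * \<kappa> * Re (\<i> * of_real r * w1 t r * cnj (w t r))\<bar>
      \<le> (\<delta>\<^sup>2 * (r * cmod (w1 t r))\<^sup>2 + (cmod (w t r))\<^sup>2) / 200" if r: "r \<in> {1..R}" for r
  proof -
    have \<kappa>1: "\<bar>\<kappa>\<bar> = 1" using \<kappa> by (auto simp: power2_eq_1_iff)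
    have "\<bar>Re (\<i> * of_real r * w1 t r * cnj (w t r))\<bar> \<le> r * cmod (w1 t r) * cmod (w t r)"
      by (rule order_trans[OF abs_Re_le_cmod]) (use r in \<open>simp add: norm_mult\<close>)
    then have "(1/100) * \<delta> * \<bar>Re (\<i> * of_real r * w1 t r * cnj (w t r))\<bar> \<le> (1/100) * \<delta> * (r * cmod (w1 t r) * cmod (w t r))"
      using \<delta> by (intro mult_left_mono) auto
    also have "\<dots> \<le> (\<delta>\<^sup>2 * (r * cmod (w1 t r))\<^sup>2 + (cmod (w t r))\<^sup>2) / 200"
      using zero_le_power2[of "\<delta> * (r * cmod (w1 t r)) - cmod (w t r)"]
      by (simp add: power2_diff power_mult_distrib mult_ac)
    finally show ?thesis using \<delta> \<kappa>1 by (simp add: abs_mult del: times_complex.sel)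
  qed
  have nn: "0 \<le> \<delta>\<^sup>2 * (r * cmod (w1 t r))\<^sup>2" for r by simp
  show "0 \<le> hypo_energy t"
  proof (rule has_integral_nonneg[OF e])
    fix r assume r: "r \<in> {1..R}"
    have *: "0 \<le> m + 1/40 * d * x + c" if "- c \<le> (d * x + m) / 200" "0 \<le> d * x" "0 \<le> m" for m d x c :: real
      using that by (simp add: field_simps)
    show "0 \<le> ?e r" by (rule *[OF cross[OF r, THEN abs_le_D2] nn zero_le_power2])
  qed
  show "hypo_energy t \<le> 2 * energy 0 0 t + \<delta>\<^sup>2 * R\<^sup>2 / 20 * grad_sq t"
  proof (rule has_integral_le[OF e])
    show "((\<lambda>r. 2 * (cmod (w t r))\<^sup>2 + \<delta>\<^sup>2 * R\<^sup>2 / 20 * (cmod (w1 t r))\<^sup>2) has_integral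
        (2 * energy 0 0 t + \<delta>\<^sup>2 * R\<^sup>2 / 20 * grad_sq t)) {1..R}"
      by (intro has_integral_add has_integral_mult_right has_integral_squares t)
    fix r assume r: "r \<in> {1..R}"
    have "\<delta>\<^sup>2 * (r * cmod (w1 t r))\<^sup>2 \<le> \<delta>\<^sup>2 * (R\<^sup>2 * (cmod (w1 t r))\<^sup>2)"
      unfolding power_mult_distrib using r by (intro mult_left_mono mult_right_mono power_mono) auto
    then have le: "\<delta>\<^sup>2 * (r * cmod (w1 t r))\<^sup>2 \<le> \<delta>\<^sup>2 * R\<^sup>2 * (cmod (w1 t r))\<^sup>2"
      by (simp only: mult.assoc)
    have *: "m + 1/40 * d * x + c \<le> 2 * m + e / 20 * y"
      if "d * x \<le> e * y" "c \<le> (d * x + m) / 200" "0 \<le> d * x" "0 \<le> m" for m d x c e y :: real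
      using that by (simp add: field_simps)
    show "?e r \<le> 2 * (cmod (w t r))\<^sup>2 + \<delta>\<^sup>2 * R\<^sup>2 / 20 * (cmod (w1 t r))\<^sup>2"
      by (rule *[OF le cross[OF r, THEN abs_le_D1] nn zero_le_power2])
  qed
qed

section \<open>Decay with exponential weights\<close>

text \<open>Half of the dissipation pays for the growth of the weight. The constant 800 comes from
  the mass part: 2a times 2R^2 \<open>hardy_sq\<close> has to stay below \<beta>/2 times
  (\<delta>/100) \<open>hardy_sq\<close>, that is, 4aR^2 \<le> \<beta>\<delta>/200.\<close>

lemma weighted_dissipation_bound:
  assumes \<delta>1: "\<delta> \<le> 1" and \<delta>K: "\<delta>\<^sup>2 * K \<le> 1" and a: "0 \<le> a" "a \<le> \<beta> * \<delta> / (800 * R\<^sup>2)"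
    and st: "0 < s" "s \<le> t"
  shows "integral {s..t} (\<lambda>x. exp (2 * a * x) * dissipation x) \<le> 2 / \<beta> * (exp (2 * a * s) * hypo_energy s)"
proof -
  have "\<forall>x. \<exists>D. x > 0 \<longrightarrow> (hypo_energy has_real_derivative D) (at x) \<and> D \<le> - \<beta> * dissipation x"
    using hypo_energy_derivative[OF _ \<delta>1 \<delta>K] by metis
  then obtain D where D: "\<And>x. x > 0 \<Longrightarrow> (hypo_energy has_real_derivative D x) (at x)"
    "\<And>x. x > 0 \<Longrightarrow> D x \<le> - \<beta> * dissipation x" by metis
  have cd: "continuous_on {s..t} dissipation"
    by (rule continuous_on_subset[OF continuous_on_dissipation]) (use st in auto)
  have "integral {s..t} (\<lambda>x. \<beta> / 2 * (exp (2 * a * x) * dissipation x)) \<le> exp (2 * a * s) * hypo_energy s"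
  proof (rule integral_le_of_derivative_le[OF st(2), where f = "\<lambda>x. exp (2 * a * x) * hypo_energy x"
        and f' = "\<lambda>x. exp (2 * a * x) * (2 * a * hypo_energy x + D x)"])
    fix x assume "x \<in> {s..t}"
    then have x: "x > 0" using st by auto
    show "((\<lambda>x. exp (2 * a * x) * hypo_energy x) has_real_derivative exp (2 * a * x) * (2 * a * hypo_energy x + D x)) (at x)"
      by (rule derivative_eq_intros D(1)[OF x] refl | simp add: algebra_simps)+
    have "2 * a * hypo_energy x \<le> 2 * a * (2 * (R\<^sup>2 * hardy_sq x) + \<delta>\<^sup>2 * R\<^sup>2 / 20 * grad_sq x)"
      using hypo_energy_bounds(2)[OF x] mass_le_hardy[OF x] a(1) by (intro mult_left_mono) auto
    also have "\<dots> \<le> 2 * (\<beta> * \<delta> / (800 * R\<^sup>2)) * (2 * (R\<^sup>2 * hardy_sq x) + \<delta>\<^sup>2 * R\<^sup>2 / 20 * grad_sq x)"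
      using squares_nonneg[OF x] a by (intro mult_right_mono mult_left_mono) auto
    also have "\<dots> = \<beta> / 2 * (\<delta> / 100 * hardy_sq x + \<delta>^3 / 4000 * grad_sq x)"
      using R by (simp add: field_simps eval_nat_numeral)
    also have "\<dots> \<le> \<beta> / 2 * dissipation x"
    proof (rule mult_left_mono)
      have "\<delta>^3 / 4000 * grad_sq x \<le> \<delta>^3 * grad_sq x"
        using squares_nonneg[OF x] \<delta> by (intro mult_right_mono) auto
      moreover have "0 \<le> \<delta>^3 * K * hardy_sq x" "0 \<le> \<delta>^5 / 80 * hess_sq x"
        using squares_nonneg[OF x] \<delta> K by simp_all
      ultimately show "\<delta> / 100 * hardy_sq x + \<delta>^3 / 4000 * grad_sq x \<le> dissipation x"
        unfolding dissipation_def by linarith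
    qed (use \<beta> in simp)
    finally have "2 * a * hypo_energy x + D x \<le> - (\<beta> / 2 * dissipation x)"
      using D(2)[OF x] by simp
    then have "exp (2 * a * x) * (2 * a * hypo_energy x + D x) \<le> exp (2 * a * x) * - (\<beta> / 2 * dissipation x)"
      by (rule mult_left_mono) simp
    then show "exp (2 * a * x) * (2 * a * hypo_energy x + D x) \<le> - (\<beta> / 2 * (exp (2 * a * x) * dissipation x))"
      by (simp add: mult_ac)
  next
    show "0 \<le> exp (2 * a * t) * hypo_energy t" using hypo_energy_bounds(1)[of t] st by simp
  qed (intro continuous_intros cd)
  then show ?thesis using \<beta> by (simp add: field_simps)
qed

text \<open>The Hardy part of the viscous term alone makes the mass decay at rate 2\<beta>\<delta>^3
  K/R^2; one half of this rate absorbs the weight, the other half bounds the integral.\<close>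

lemma weighted_mass_bound:
  assumes a: "0 \<le> a" "2 * a \<le> \<beta> * \<delta>^3 * K / R\<^sup>2" and st: "0 < s" "s \<le> t"
  shows "integral {s..t} (\<lambda>x. exp (2 * a * x) * energy 0 0 x) \<le> R\<^sup>2 / (\<beta> * \<delta>^3 * K) * (exp (2 * a * s) * energy 0 0 s)"
proof -
  let ?c = "\<beta> * \<delta>^3 * K / R\<^sup>2"
  have c: "?c > 0" using \<beta> \<delta> K R by simp
  have ce: "continuous_on {s..t} (energy 0 0)"
    by (rule continuous_on_subset[OF continuous_on_squares(4)]) (use st in auto)
  have nn: "0 \<le> energy 0 0 x" if "x > 0" for x
    by (rule has_integral_nonneg[OF has_integral_squares(4)[OF that]]) simp
  have "integral {s..t} (\<lambda>x. ?c * (exp (2 * a * x) * energy 0 0 x)) \<le> exp (2 * a * s) * energy 0 0 s"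
  proof (rule integral_le_of_derivative_le[OF st(2), where f = "\<lambda>x. exp (2 * a * x) * energy 0 0 x"
        and f' = "\<lambda>x. exp (2 * a * x) * (2 * a * energy 0 0 x + - 2 * \<beta> * \<delta>^3 * (grad_sq x + K * hardy_sq x))"])
    fix x assume "x \<in> {s..t}"
    then have x: "x > 0" using st by auto
    show "((\<lambda>x. exp (2 * a * x) * energy 0 0 x) has_real_derivative
        exp (2 * a * x) * (2 * a * energy 0 0 x + - 2 * \<beta> * \<delta>^3 * (grad_sq x + K * hardy_sq x))) (at x)"
      by (rule derivative_eq_intros mass_derivative[OF x] refl | simp add: algebra_simps)+
    have "2 * ?c * energy 0 0 x \<le> 2 * ?c * (R\<^sup>2 * hardy_sq x)"
      using c by (intro mult_left_mono mass_le_hardy x) auto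
    also have "\<dots> = 2 * \<beta> * \<delta>^3 * (K * hardy_sq x)" using R by simp
    also have "\<dots> \<le> 2 * \<beta> * \<delta>^3 * (grad_sq x + K * hardy_sq x)"
      using \<beta> \<delta> squares_nonneg[OF x] by (intro mult_left_mono) auto
    finally have "2 * a * energy 0 0 x + - 2 * \<beta> * \<delta>^3 * (grad_sq x + K * hardy_sq x) \<le> - (?c * energy 0 0 x)"
      using mult_right_mono[OF a(2) nn[OF x]] by linarith
    then have "exp (2 * a * x) * (2 * a * energy 0 0 x + - 2 * \<beta> * \<delta>^3 * (grad_sq x + K * hardy_sq x))
        \<le> exp (2 * a * x) * - (?c * energy 0 0 x)"
      by (rule mult_left_mono) simp
    then show "exp (2 * a * x) * (2 * a * energy 0 0 x + - 2 * \<beta> * \<delta>^3 * (grad_sq x + K * hardy_sq x))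
        \<le> - (?c * (exp (2 * a * x) * energy 0 0 x))"
      by (simp add: mult_ac)
  next
    show "0 \<le> exp (2 * a * t) * energy 0 0 t" using nn[of t] st by simp
  qed (intro continuous_intros ce)
  then have "integral {s..t} (\<lambda>x. exp (2 * a * x) * energy 0 0 x) * ?c \<le> exp (2 * a * s) * energy 0 0 s"
    by (simp add: mult.commute)
  then have "integral {s..t} (\<lambda>x. exp (2 * a * x) * energy 0 0 x) \<le> exp (2 * a * s) * energy 0 0 s / ?c"
    by (simp only: pos_le_divide_eq[OF c])
  then show ?thesis by (simp add: mult.commute)
qed

end

section \<open>Integrated bound for the weighted tail integrals\<close>

context radial_flow
begin

text \<open>Squared norm of the function to which the energy of the stream function is reduced; for
  p = |k| it is the left-hand side of the smoothing estimate at one time.\<close>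

definition profile_sq :: "nat \<Rightarrow> real \<Rightarrow> real" where
  "profile_sq p t = integral {1..R} (\<lambda>r'. (cmod (of_real (r' ^ p) * integral {r'..R} (\<lambda>r. w t r / of_real (r ^ p))))\<^sup>2)"

lemma continuous_on_profile:
  "continuous_on ({0<..} \<times> {1..R}) (\<lambda>(t, r'). of_real (r' ^ p) * integral {r'..R} (\<lambda>r. w t r / of_real (r ^ p)))"
proof -
  have "continuous_on ({0<..} \<times> {1..R}) (\<lambda>(t, r). w t r / of_real (r ^ p))"
    using cw unfolding split_beta by (auto intro!: continuous_intros)
  from continuous_on_integral_from[OF this] show ?thesis
    unfolding split_beta by (auto intro!: continuous_intros)
qed

lemma continuous_on_profile_sq: "continuous_on {0<..} (profile_sq p)"
  unfolding profile_sq_def[abs_def] using continuous_on_profile[of p]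
  by (intro continuous_on_integral_interval) (auto simp: split_beta intro!: continuous_intros)

lemma profile_sq_nonneg: "t > 0 \<Longrightarrow> 0 \<le> profile_sq p t"
  unfolding profile_sq_def
  by (intro integral_nonneg integrable_continuous_interval continuous_intros
      continuous_on_slice[OF continuous_on_profile]) auto

text \<open>Once transport is removed, the equation leaves only the viscous term
  \<beta>\<delta>^3(w2 - K r^(-2) w). Of the weight r^4, one factor r^2 is absorbed into r|w2| and
  |w|/r, and the other is bounded by R^2.\<close>

lemma quartic_moment_bounds:
  assumes t: "t > 0"
  shows "integral {1..R} (\<lambda>r. r^4 * (cmod (w t r))\<^sup>2) \<le> R^6 * hardy_sq t"
    "integral {1..R} (\<lambda>r. r^4 * (cmod (wt t r + \<i> * of_real (\<beta> * \<kappa> / r\<^sup>2) * w t r))\<^sup>2)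
      \<le> 2 * \<beta>\<^sup>2 * \<delta>^6 * R\<^sup>2 * (hess_sq t + K\<^sup>2 * hardy_sq t)"
proof -
  note c = continuous_on_w[OF t]
  show "integral {1..R} (\<lambda>r. r^4 * (cmod (w t r))\<^sup>2) \<le> R^6 * hardy_sq t"
  proof (rule has_integral_le[OF has_integral_of_continuous has_integral_mult_right[OF has_integral_squares(2)[OF t]]])
    show "continuous_on {1..R} (\<lambda>r. r^4 * (cmod (w t r))\<^sup>2)" by (intro continuous_intros c)
    fix r assume r: "r \<in> {1..R}"
    have "r^4 * (cmod (w t r))\<^sup>2 = r^6 * (cmod (w t r) / r)\<^sup>2"
      using r by (simp add: field_simps eval_nat_numeral)
    also have "\<dots> \<le> R^6 * (cmod (w t r) / r)\<^sup>2" using r by (intro mult_right_mono power_mono) auto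
    finally show "r^4 * (cmod (w t r))\<^sup>2 \<le> R^6 * (cmod (w t r) / r)\<^sup>2" .
  qed
  show "integral {1..R} (\<lambda>r. r^4 * (cmod (wt t r + \<i> * of_real (\<beta> * \<kappa> / r\<^sup>2) * w t r))\<^sup>2)
      \<le> 2 * \<beta>\<^sup>2 * \<delta>^6 * R\<^sup>2 * (hess_sq t + K\<^sup>2 * hardy_sq t)"
  proof (rule has_integral_le[OF has_integral_of_continuous])
    show "continuous_on {1..R} (\<lambda>r. r^4 * (cmod (wt t r + \<i> * of_real (\<beta> * \<kappa> / r\<^sup>2) * w t r))\<^sup>2)"
      by (intro continuous_intros c) auto
    show "((\<lambda>r. 2 * \<beta>\<^sup>2 * \<delta>^6 * R\<^sup>2 * ((r * cmod (w2 t r))\<^sup>2 + K\<^sup>2 * (cmod (w t r) / r)\<^sup>2)) has_integral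
        2 * \<beta>\<^sup>2 * \<delta>^6 * R\<^sup>2 * (hess_sq t + K\<^sup>2 * hardy_sq t)) {1..R}"
      by (intro has_integral_add has_integral_mult_right has_integral_squares t)
    fix r assume r: "r \<in> {1..R}"
    let ?b = "r * cmod (w2 t r)" and ?a = "cmod (w t r) / r"
    have r0: "r > 0" using r by simp
    have "wt t r + \<i> * of_real (\<beta> * \<kappa> / r\<^sup>2) * w t r = of_real (\<beta> * \<delta>^3) * (w2 t r - of_real (K / r\<^sup>2) * w t r)"
      unfolding eqn[OF t r] by (simp add: algebra_simps)
    then have "r * cmod (wt t r + \<i> * of_real (\<beta> * \<kappa> / r\<^sup>2) * w t r)
        \<le> r * (\<beta> * \<delta>^3 * (cmod (w2 t r) + K / r\<^sup>2 * cmod (w t r)))"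
      using norm_triangle_ineq4[of "w2 t r" "of_real (K / r\<^sup>2) * w t r"] r0 \<beta> \<delta> K
      by (auto simp: norm_mult norm_divide norm_power intro!: mult_left_mono)
    also have "\<dots> = \<beta> * \<delta>^3 * (?b + K * ?a)"
      using r0 by (simp add: field_simps power2_eq_square)
    finally have "(r * cmod (wt t r + \<i> * of_real (\<beta> * \<kappa> / r\<^sup>2) * w t r))\<^sup>2 \<le> (\<beta> * \<delta>^3 * (?b + K * ?a))\<^sup>2"
      using r0 by (intro power_mono) auto
    also have "\<dots> = \<beta>\<^sup>2 * \<delta>^6 * (?b + K * ?a)\<^sup>2" by (simp add: power_mult_distrib flip: power_mult)
    also have "\<dots> \<le> \<beta>\<^sup>2 * \<delta>^6 * (2 * (?b\<^sup>2 + K\<^sup>2 * ?a\<^sup>2))"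
    proof (rule mult_left_mono)
      show "(?b + K * ?a)\<^sup>2 \<le> 2 * (?b\<^sup>2 + K\<^sup>2 * ?a\<^sup>2)"
        using power2_sum_le[of ?b "K * ?a"] by (simp only: power_mult_distrib distrib_left)
    qed simp
    finally have "r\<^sup>2 * (r * cmod (wt t r + \<i> * of_real (\<beta> * \<kappa> / r\<^sup>2) * w t r))\<^sup>2
        \<le> R\<^sup>2 * (\<beta>\<^sup>2 * \<delta>^6 * (2 * (?b\<^sup>2 + K\<^sup>2 * ?a\<^sup>2)))"
      using r by (intro mult_mono power_mono) auto
    then show "r^4 * (cmod (wt t r + \<i> * of_real (\<beta> * \<kappa> / r\<^sup>2) * w t r))\<^sup>2
        \<le> 2 * \<beta>\<^sup>2 * \<delta>^6 * R\<^sup>2 * (?b\<^sup>2 + K\<^sup>2 * ?a\<^sup>2)"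
      by (simp only: power_mult_distrib[of r] mult.assoc[symmetric] power_add[symmetric] add_2_eq_Suc' numeral_plus_numeral)
         (simp add: mult_ac eval_nat_numeral)
  qed
qed

text \<open>The choice of T makes both terms of the smoothing estimate comparable with the
  dissipation: R^6/T gives \<beta>\<delta>R^4 in front of \<open>hardy_sq\<close>, and
  T\<beta>^2\<delta>^6R^2 gives \<beta>\<delta>^5R^4 in front of \<open>hess_sq\<close>.\<close>

lemma profile_block_bound:
  assumes \<delta>K: "\<delta>\<^sup>2 * K \<le> 1" and s: "s > 0"
  defines "T \<equiv> R\<^sup>2 / (\<beta> * \<delta>)"
  shows "real p * \<beta> / R^4 * integral {s..s + T} (profile_sq p) \<le> 640 * \<beta> * integral {s..s + T} dissipation"
proof -
  let ?I = "{s..s + T}"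
  have T: "T > 0" using \<beta> \<delta> R by (simp add: T_def)
  have pos: "x > 0" if "x \<in> ?I" for x using that s by simp
  have sub: "?I \<subseteq> {0<..}" using s by auto
  have sub2: "?I \<times> {1..R} \<subseteq> {0<..} \<times> {1..R}" using s by auto
  have \<kappa>1: "\<bar>\<kappa>\<bar> = 1" using \<kappa> by (auto simp: power2_eq_1_iff)
  have lam: "\<beta> * \<kappa> \<noteq> 0" "\<bar>\<beta> * \<kappa>\<bar> = \<beta>" using \<beta> \<kappa>1 by (auto simp: abs_mult)
  define A where "A t = integral {1..R} (\<lambda>r. r^4 * (cmod (w t r))\<^sup>2)" for t
  define B where "B t = integral {1..R} (\<lambda>r. r^4 * (cmod (wt t r + \<i> * of_real (\<beta> * \<kappa> / r\<^sup>2) * w t r))\<^sup>2)" for t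
  have cA: "continuous_on ?I A" and cB: "continuous_on ?I B"
    using continuous_on_subset[OF cw sub2] continuous_on_subset[OF cwt sub2] unfolding A_def B_def
    by (auto intro!: continuous_on_integral_interval continuous_intros simp: split_beta)
  note ci = continuous_on_subset[OF continuous_on_squares(1) sub] continuous_on_subset[OF continuous_on_squares(2) sub]
    continuous_on_subset[OF continuous_on_squares(3) sub] continuous_on_subset[OF continuous_on_dissipation sub]
  have smoothing: "integral ?I (profile_sq p) \<le> pi / (\<beta> * real (2 * p + 1)) * (2 / T * integral ?I A + 2 * T * integral ?I B)"
    unfolding profile_sq_def A_def B_def
    using local_smoothing[OF less_imp_le[OF R] lam(1) T has_vector_derivative_at_within[OF dwt[OF pos]]
        continuous_on_subset[OF cw sub2] continuous_on_subset[OF cwt sub2], of p] unfolding lam(2) by simp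
  have "2 / T * integral ?I A + 2 * T * integral ?I B = integral ?I (\<lambda>t. 2 / T * A t + 2 * T * B t)"
    by (subst integral_add) (simp_all only: integrable_on_mult_right integral_mult_right
        integrable_continuous_interval[OF cA] integrable_continuous_interval[OF cB])
  also have "integral ?I (\<lambda>t. 2 / T * A t + 2 * T * B t) \<le> integral ?I (\<lambda>t. 320 * \<beta> * R^4 * dissipation t)"
  proof (intro integral_le integrable_continuous_interval continuous_intros cA cB ci)
    fix t assume "t \<in> ?I"
    then have t: "t > 0" by (rule pos)
    have "2 / T * A t + 2 * T * B t \<le> 2 / T * (R^6 * hardy_sq t) + 2 * T * (2 * \<beta>\<^sup>2 * \<delta>^6 * R\<^sup>2 * (hess_sq t + K\<^sup>2 * hardy_sq t))"
      unfolding A_def B_def using T by (intro add_mono mult_left_mono quartic_moment_bounds t) auto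
    also have "\<dots> = \<beta> * R^4 * (2 * \<delta> * hardy_sq t + 4 * \<delta>^5 * hess_sq t + 4 * (\<delta>\<^sup>2 * K) * (\<delta>^3 * K * hardy_sq t))"
      using \<beta> \<delta> R unfolding T_def by (simp add: field_simps eval_nat_numeral)
    \<comment> \<open>The factor 320 is 4 times 80, as the coefficient \<delta>^5/80 of
      \<open>hess_sq\<close> requires; the Hardy term with K^2 uses \<delta>^2 K \<le> 1.\<close>
    also have "\<dots> \<le> \<beta> * R^4 * (320 * dissipation t)"
    proof (rule mult_left_mono)
      have "4 * (\<delta>\<^sup>2 * K) * (\<delta>^3 * K * hardy_sq t) \<le> 4 * 1 * (\<delta>^3 * K * hardy_sq t)"
        using \<delta> K squares_nonneg[OF t] by (intro mult_right_mono mult_left_mono \<delta>K) auto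
      moreover have "0 \<le> \<delta>^3 * grad_sq t" "0 \<le> \<delta> * hardy_sq t" "0 \<le> \<delta>^5 * hess_sq t" "0 \<le> \<delta>^3 * K * hardy_sq t"
        using \<delta> K squares_nonneg[OF t] by simp_all
      moreover have "2 * h + 4 * m + x \<le> 320 * (g + k + h / 100 + m / 80)"
        if "x \<le> 4 * 1 * k" "0 \<le> g" "0 \<le> h" "0 \<le> m" "0 \<le> k" for x g h m k :: real
        using that by simp
      ultimately show "2 * \<delta> * hardy_sq t + 4 * \<delta>^5 * hess_sq t + 4 * (\<delta>\<^sup>2 * K) * (\<delta>^3 * K * hardy_sq t) \<le> 320 * dissipation t"
        unfolding dissipation_def times_divide_eq_left mult.assoc[of 2 \<delta>] mult.assoc[of 4 "\<delta>^5"] by blast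
    qed (use \<beta> R in simp)
    finally show "2 / T * A t + 2 * T * B t \<le> 320 * \<beta> * R^4 * dissipation t" by (simp add: mult_ac)
  qed
  also have "\<dots> = 320 * \<beta> * R^4 * integral ?I dissipation" by simp
  finally have "pi / (\<beta> * real (2 * p + 1)) * (2 / T * integral ?I A + 2 * T * integral ?I B)
      \<le> pi / (\<beta> * real (2 * p + 1)) * (320 * \<beta> * R^4 * integral ?I dissipation)"
    using \<beta> by (intro mult_left_mono) auto
  with smoothing have "integral ?I (profile_sq p) \<le> pi / (\<beta> * real (2 * p + 1)) * (320 * \<beta> * R^4 * integral ?I dissipation)"
    by (rule order_trans)
  then have "real p * \<beta> / R^4 * integral ?I (profile_sq p)
      \<le> real p * \<beta> / R^4 * (pi / (\<beta> * real (2 * p + 1)) * (320 * \<beta> * R^4 * integral ?I dissipation))"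
    using \<beta> by (intro mult_left_mono) auto
  also have "\<dots> = (pi * real p / real (2 * p + 1)) * (320 * \<beta> * integral ?I dissipation)"
  proof -
    have "x * \<beta> / R^4 * (pi / (\<beta> * q) * (320 * \<beta> * R^4 * y)) = (pi * x / q) * (320 * \<beta> * y)" if "q \<noteq> 0" for x y q
      using \<beta> R that by (simp add: field_simps)
    then show ?thesis by simp
  qed
  \<comment> \<open>Here the gain 1/(2p + 1) offsets the prefactor p uniformly in p; with 320 this
    yields 640.\<close>
  also have "\<dots> \<le> 2 * (320 * \<beta> * integral ?I dissipation)"
  proof (rule mult_right_mono)
    have "pi * real p \<le> 4 * real p" using pi_less_4 by (intro mult_right_mono) auto
    then show "pi * real p / real (2 * p + 1) \<le> 2" by (simp add: divide_le_eq)
    have "0 \<le> integral ?I dissipation"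
      by (intro integral_nonneg integrable_continuous_interval ci dissipation_nonneg pos)
    then show "0 \<le> 320 * \<beta> * integral ?I dissipation" using \<beta> by simp
  qed
  finally show ?thesis by simp
qed

text \<open>On a block of length T the weight e^(2at) varies at most by a factor 3, since aT \<le>
  1/800, so the unweighted block bounds add up to a weighted one. The factor 640 becomes 1920, and
  the weighted dissipation bound doubles it.\<close>

lemma weighted_profile_bound:
  assumes \<delta>1: "\<delta> \<le> 1" and \<delta>K: "\<delta>\<^sup>2 * K \<le> 1" and a: "0 \<le> a" "a \<le> \<beta> * \<delta> / (800 * R\<^sup>2)"
    and st: "0 < s" "s \<le> t"
  shows "real p * \<beta> / R^4 * integral {s..t} (\<lambda>x. exp (2 * a * x) * profile_sq p x)
    \<le> 3840 * (exp (2 * a * s) * hypo_energy s)"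
proof -
  define T where "T = R\<^sup>2 / (\<beta> * \<delta>)"
  have T: "T > 0" using \<beta> \<delta> R by (simp add: T_def)
  let ?P = "\<lambda>x. exp (2 * a * x) * profile_sq p x" and ?D = "\<lambda>x. exp (2 * a * x) * dissipation x"
  let ?c = "real p * \<beta> / R^4"
  have c0: "0 \<le> ?c" using \<beta> by simp
  have iP: "?P integrable_on {u..v}" and iD: "?D integrable_on {u..v}"
    and ip: "profile_sq p integrable_on {u..v}" and id: "dissipation integrable_on {u..v}" if "u > 0" for u v
    using that by (auto intro!: integrable_continuous_interval continuous_intros
        continuous_on_subset[OF continuous_on_profile_sq] continuous_on_subset[OF continuous_on_dissipation])
  have e3: "exp (2 * a * T) \<le> 3"
  proof -
    have "a * T \<le> \<beta> * \<delta> / (800 * R\<^sup>2) * T" using a T by (intro mult_right_mono) auto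
    also have "\<dots> = 1 / 800" using \<beta> \<delta> R by (simp add: T_def)
    finally have "exp (2 * a * T) \<le> exp 1" by simp
    then show ?thesis using exp_le by linarith
  qed
  have block: "?c * integral {u..u + T} ?P \<le> 1920 * \<beta> * integral {u..u + T} ?D" if u: "u > 0" for u
  proof -
    have "integral {u..u + T} ?P \<le> integral {u..u + T} (\<lambda>x. exp (2 * a * (u + T)) * profile_sq p x)"
      using u a by (intro integral_le iP integrable_on_mult_right ip mult_right_mono profile_sq_nonneg) (auto intro: mult_left_mono)
    then have "?c * integral {u..u + T} ?P \<le> ?c * (exp (2 * a * (u + T)) * integral {u..u + T} (profile_sq p))"
      using c0 by (intro mult_left_mono) auto
    also have "\<dots> = exp (2 * a * (u + T)) * (?c * integral {u..u + T} (profile_sq p))" by simp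
    also have "\<dots> \<le> exp (2 * a * (u + T)) * (640 * \<beta> * integral {u..u + T} dissipation)"
      using profile_block_bound[OF \<delta>K u, of p] by (intro mult_left_mono) (auto simp: T_def)
    also have "\<dots> = exp (2 * a * T) * (640 * \<beta> * (exp (2 * a * u) * integral {u..u + T} dissipation))"
      by (simp add: distrib_left exp_add)
    also have "\<dots> \<le> 3 * (640 * \<beta> * (exp (2 * a * u) * integral {u..u + T} dissipation))"
    proof (rule mult_right_mono[OF e3])
      have "0 \<le> integral {u..u + T} dissipation"
        using u by (intro integral_nonneg id dissipation_nonneg) auto
      then show "0 \<le> 640 * \<beta> * (exp (2 * a * u) * integral {u..u + T} dissipation)" using \<beta> by simp
    qed
    also have "exp (2 * a * u) * integral {u..u + T} dissipation \<le> integral {u..u + T} ?D"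
      unfolding integral_mult_right[symmetric] using u a
      by (intro integral_le iD integrable_on_mult_right id mult_right_mono dissipation_nonneg) (auto intro: mult_left_mono)
    finally show ?thesis using \<beta> by simp
  qed
  have blocks: "?c * integral {s..s + real n * T} ?P \<le> 1920 * \<beta> * integral {s..s + real n * T} ?D" for n
  proof (induction n)
    case (Suc n)
    let ?m = "s + real n * T"
    have m: "?m > 0" "s \<le> ?m" "?m \<le> ?m + T" "s + real (Suc n) * T = ?m + T"
      using st T by (auto intro: add_pos_nonneg simp: algebra_simps)
    have "integral {s..?m + T} f = integral {s..?m} f + integral {?m..?m + T} f" if "f integrable_on {s..?m + T}" for f :: "real \<Rightarrow> real"
      by (rule Henstock_Kurzweil_Integration.integral_combine[symmetric, OF m(2,3) that])
    from this[OF iP[OF st(1)]] this[OF iD[OF st(1)]] show ?case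
      unfolding m(4) using Suc block[OF m(1)] by (simp add: distrib_left)
  qed simp
  \<comment> \<open>Finitely many blocks cover [s,t]. The overshoot beyond t only enlarges the
    integral on the left, and the dissipation bound holds up to every final time.\<close>
  obtain n where n: "(t - s) / T \<le> real n" using real_arch_simple by blast
  have tn: "t \<le> s + real n * T" using n T by (simp add: field_simps)
  have "integral {s..t} ?P \<le> integral {s..s + real n * T} ?P"
    using tn st by (intro integral_subset_le iP) (auto intro!: mult_nonneg_nonneg profile_sq_nonneg)
  then have "?c * integral {s..t} ?P \<le> ?c * integral {s..s + real n * T} ?P"
    using c0 by (rule mult_left_mono)
  also have "\<dots> \<le> 1920 * \<beta> * integral {s..s + real n * T} ?D" by (rule blocks)
  also have "\<dots> \<le> 1920 * \<beta> * (2 / \<beta> * (exp (2 * a * s) * hypo_energy s))"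
    using \<beta> T by (intro mult_left_mono weighted_dissipation_bound \<delta>1 \<delta>K a st(1)) auto
  finally show ?thesis using \<beta> by simp
qed

end

section \<open>The stream function\<close>

text \<open>Testing the equation with \<phi> bounds E by 4/3 of minus the integral of
  Re(conj(\<phi>) f), the factor coming from the exchange of K for p^2. Then either f is written
  through the derivative of its weighted tail, which shifts a derivative to \<phi>, or it is bounded
  directly with r \<le> R. Half of E is absorbed in both cases.\<close>

lemma stream_energy_bounds:
  fixes \<phi> \<phi>1 \<phi>2 f :: "real \<Rightarrow> complex" and p :: nat
  assumes R: "1 < R" and p: "1 \<le> p"
    and d\<phi>: "\<And>r. r \<in> {1..R} \<Longrightarrow> (\<phi> has_vector_derivative \<phi>1 r) (at r within {1..R})"
    and d\<phi>1: "\<And>r. r \<in> {1..R} \<Longrightarrow> (\<phi>1 has_vector_derivative \<phi>2 r) (at r within {1..R})"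
    and eq: "\<And>r. r \<in> {1..R} \<Longrightarrow> \<phi>2 r - of_real (((real p)\<^sup>2 - 1/4) / r\<^sup>2) * \<phi> r = f r"
    and bc: "\<phi> 1 = 0" "\<phi> R = 0" and f: "continuous_on {1..R} f"
  defines "E \<equiv> integral {1..R} (\<lambda>r. (cmod (\<phi>1 r))\<^sup>2 + (real p)\<^sup>2 * (cmod (\<phi> r) / r)\<^sup>2)"
  shows "continuous_on {1..R} \<phi>" "continuous_on {1..R} \<phi>1"
    "E \<le> 4 * integral {1..R} (\<lambda>r'. (cmod (of_real (r' ^ p) * integral {r'..R} (\<lambda>r. f r / of_real (r ^ p))))\<^sup>2)"
    "E \<le> 2 * R\<^sup>2 / (real p)\<^sup>2 * integral {1..R} (\<lambda>r. (cmod (f r))\<^sup>2)"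
proof -
  define K where "K = (real p)\<^sup>2 - 1/4"
  show c\<phi>: "continuous_on {1..R} \<phi>" and c\<phi>1: "continuous_on {1..R} \<phi>1"
    using has_vector_derivative_continuous[OF d\<phi>] has_vector_derivative_continuous[OF d\<phi>1]
    by (simp_all add: continuous_on_eq_continuous_within)
  define H where "H u = integral {u..R} (\<lambda>r. f r / of_real (r ^ p))" for u
  \<comment> \<open>The derivative of H is -r^(-p) f. Integrating by parts the product of r^p
    conj(\<phi>) and H replaces f by P, now paired with \<phi>1 + (p/r)\<phi>, whose squared modulus
    is at most twice the energy density.\<close>
  define P where "P u = of_real (u ^ p) * H u" for u
  have cfp: "continuous_on {1..R} (\<lambda>r. f r / of_real (r ^ p))" by (intro continuous_intros f) auto
  have dH: "(H has_vector_derivative - (f u / of_real (u ^ p))) (at u within {1..R})" if "u \<in> {1..R}" for u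
    unfolding H_def using integral_has_vector_derivative'[OF cfp that] .
  have cP: "continuous_on {1..R} P"
    using has_vector_derivative_continuous[OF dH] unfolding P_def
    by (intro continuous_intros) (simp add: continuous_on_eq_continuous_within)
  note cont = c\<phi> c\<phi>1 f cP
  have has: "(g has_integral integral {1..R} g) {1..R}" if "continuous_on {1..R} g" for g :: "real \<Rightarrow> 'b::banach"
    by (intro integrable_integral integrable_continuous_interval that)
  have E: "((\<lambda>r. (cmod (\<phi>1 r))\<^sup>2 + (real p)\<^sup>2 * (cmod (\<phi> r) / r)\<^sup>2) has_integral E) {1..R}"
    unfolding E_def by (intro has continuous_intros cont) auto
  have ftc1: "((\<lambda>r. Re (\<phi>1 r * cnj (\<phi>1 r) + \<phi>2 r * cnj (\<phi> r))) has_integral 0) {1..R}"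
  proof -
    have "((\<lambda>r. Re (\<phi>1 r * cnj (\<phi> r))) has_vector_derivative Re (\<phi>1 r * cnj (\<phi>1 r) + \<phi>2 r * cnj (\<phi> r)))
        (at r within {1..R})" if "r \<in> {1..R}" for r
      by (intro has_vector_derivative_mult bounded_linear.has_vector_derivative[OF bounded_linear_Re]
          bounded_linear.has_vector_derivative[OF bounded_linear_cnj] d\<phi> d\<phi>1 that)
    from fundamental_theorem_of_calculus[OF _ this] show ?thesis using R bc by simp
  qed
  have ftc2: "((\<lambda>r. Re (cnj (\<phi>1 r + of_real (real p / r) * \<phi> r) * P r - cnj (\<phi> r) * f r)) has_integral 0) {1..R}"
  proof -
    have "((\<lambda>r. Re ((of_real (r ^ p) * cnj (\<phi> r)) * H r)) has_vector_derivative
        Re ((of_real (r ^ p) * cnj (\<phi> r)) * - (f r / of_real (r ^ p))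
          + (of_real (r ^ p) * cnj (\<phi>1 r) + of_real (real p * r ^ (p - 1)) * cnj (\<phi> r)) * H r)) (at r within {1..R})"
      if r: "r \<in> {1..R}" for r
    proof (intro has_vector_derivative_mult bounded_linear.has_vector_derivative[OF bounded_linear_Re]
          bounded_linear.has_vector_derivative[OF bounded_linear_cnj] d\<phi> dH r)
      have "((\<lambda>r. r ^ p) has_real_derivative real p * r ^ (p - 1)) (at r within {1..R})"
        by (rule derivative_eq_intros refl | simp)+
      then show "((\<lambda>r. complex_of_real (r ^ p)) has_vector_derivative of_real (real p * r ^ (p - 1))) (at r within {1..R})"
        by (rule has_vector_derivative_of_real[unfolded o_def])
    qed
    from fundamental_theorem_of_calculus[OF _ this]
    have "((\<lambda>r. Re ((of_real (r ^ p) * cnj (\<phi> r)) * - (f r / of_real (r ^ p))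
          + (of_real (r ^ p) * cnj (\<phi>1 r) + of_real (real p * r ^ (p - 1)) * cnj (\<phi> r)) * H r)) has_integral 0) {1..R}"
      using R bc by simp
    moreover have "Re ((of_real (r ^ p) * cnj (\<phi> r)) * - (f r / of_real (r ^ p))
          + (of_real (r ^ p) * cnj (\<phi>1 r) + of_real (real p * r ^ (p - 1)) * cnj (\<phi> r)) * H r)
       = Re (cnj (\<phi>1 r + of_real (real p / r) * \<phi> r) * P r - cnj (\<phi> r) * f r)" if r: "r \<in> {1..R}" for r
    proof -
      have r0: "r \<noteq> 0" using r by auto
      then have "r ^ (p - 1) = r ^ p / r" using p by (cases p) auto
      then show ?thesis using r0 by (simp add: P_def algebra_simps)
    qed
    ultimately show ?thesis by (rule has_integral_eq[rotated])
  qed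
  \<comment> \<open>For p \<ge> 1 the subtracted 1/4 is at most a quarter of p^2, hence the factor
    4/3.\<close>
  have pK: "(real p)\<^sup>2 \<le> 4 / 3 * K"
    using p power_mono[of 1 "real p" 2] by (simp add: K_def)
  have eq': "(cmod (\<phi>1 r))\<^sup>2 + (real p)\<^sup>2 * (cmod (\<phi> r) / r)\<^sup>2
      \<le> 4 / 3 * Re (\<phi>1 r * cnj (\<phi>1 r) + \<phi>2 r * cnj (\<phi> r)) - 4 / 3 * Re (cnj (\<phi> r) * f r)"
    if r: "r \<in> {1..R}" for r
  proof -
    have "\<phi>2 r * cnj (\<phi> r) - cnj (\<phi> r) * f r = of_real (K / r\<^sup>2) * (\<phi> r * cnj (\<phi> r))"
      unfolding eq[OF r, symmetric] K_def by (simp add: algebra_simps)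
    also have "\<dots> = of_real (K * (cmod (\<phi> r) / r)\<^sup>2)"
      by (simp add: complex_norm_square[symmetric] power_divide)
    finally have "Re (\<phi>2 r * cnj (\<phi> r)) - Re (cnj (\<phi> r) * f r) = K * (cmod (\<phi> r) / r)\<^sup>2"
      by (metis Re_complex_of_real minus_complex.sel(1))
    moreover have "Re (\<phi>1 r * cnj (\<phi>1 r)) = (cmod (\<phi>1 r))\<^sup>2"
      by (simp add: complex_norm_square[symmetric] flip: of_real_power)
    moreover have "(real p)\<^sup>2 * (cmod (\<phi> r) / r)\<^sup>2 \<le> 4 / 3 * K * (cmod (\<phi> r) / r)\<^sup>2"
      by (intro mult_right_mono pK) simp
    moreover have "Re (\<phi>1 r * cnj (\<phi>1 r) + \<phi>2 r * cnj (\<phi> r)) = Re (\<phi>1 r * cnj (\<phi>1 r)) + Re (\<phi>2 r * cnj (\<phi> r))"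
      by (rule plus_complex.sel)
    ultimately show ?thesis using zero_le_power2[of "cmod (\<phi>1 r)"] by argo
  qed
  \<comment> \<open>Young's inequality in the form (4/3)xy \<le> x^2/4 + (16/9)y^2; as x^2 is at
    most twice the energy density, the first part is at most half of it. The resulting 32/9 is
    rounded up to 4.\<close>
  have "E \<le> 1 / 2 * E + 16 / 9 * integral {1..R} (\<lambda>r. (cmod (P r))\<^sup>2)"
  proof -
    have i: "((\<lambda>r. (1 / 2 * ((cmod (\<phi>1 r))\<^sup>2 + (real p)\<^sup>2 * (cmod (\<phi> r) / r)\<^sup>2) + 16 / 9 * (cmod (P r))\<^sup>2)
        + 4 / 3 * Re (\<phi>1 r * cnj (\<phi>1 r) + \<phi>2 r * cnj (\<phi> r))
        + 4 / 3 * Re (cnj (\<phi>1 r + of_real (real p / r) * \<phi> r) * P r - cnj (\<phi> r) * f r)) has_integral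
        ((1 / 2 * E + 16 / 9 * integral {1..R} (\<lambda>r. (cmod (P r))\<^sup>2)) + 4 / 3 * 0 + 4 / 3 * 0)) {1..R}"
      by (intro has_integral_add has_integral_mult_right E ftc1 ftc2 has continuous_intros cont)
    have "E \<le> (1 / 2 * E + 16 / 9 * integral {1..R} (\<lambda>r. (cmod (P r))\<^sup>2)) + 4 / 3 * 0 + 4 / 3 * 0"
    proof (rule has_integral_le[OF E i])
      fix r assume r: "r \<in> {1..R}"
      define \<rho> where "\<rho> = \<phi>1 r + of_real (real p / r) * \<phi> r"
      have "cmod \<rho> \<le> cmod (\<phi>1 r) + real p * (cmod (\<phi> r) / r)"
        unfolding \<rho>_def by (rule order_trans[OF norm_triangle_ineq]) (use r in \<open>simp add: norm_mult norm_divide\<close>)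
      then have "(cmod \<rho>)\<^sup>2 \<le> (cmod (\<phi>1 r) + real p * (cmod (\<phi> r) / r))\<^sup>2" by (intro power_mono) auto
      also have "\<dots> \<le> 2 * ((cmod (\<phi>1 r))\<^sup>2 + (real p)\<^sup>2 * (cmod (\<phi> r) / r)\<^sup>2)"
        using power2_sum_le[of "cmod (\<phi>1 r)" "real p * (cmod (\<phi> r) / r)"]
        by (simp only: power_mult_distrib distrib_left)
      finally have \<rho>2: "(cmod \<rho>)\<^sup>2 \<le> 2 * ((cmod (\<phi>1 r))\<^sup>2 + (real p)\<^sup>2 * (cmod (\<phi> r) / r)\<^sup>2)" .
      have re: "- Re (cnj \<rho> * P r) \<le> cmod \<rho> * cmod (P r)"
        using complex_Re_le_cmod[of "- (cnj \<rho> * P r)"] by (simp add: norm_mult)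
      have young: "4 / 3 * (x * y) \<le> 1 / 4 * x\<^sup>2 + 16 / 9 * y\<^sup>2" for x y :: real
        using zero_le_power2[of "1 / 2 * x - 4 / 3 * y"] by (simp add: power2_eq_square algebra_simps)
      have split: "Re (cnj \<rho> * P r - cnj (\<phi> r) * f r) = Re (cnj \<rho> * P r) - Re (cnj (\<phi> r) * f r)"
        by (rule minus_complex.sel)
      show "(cmod (\<phi>1 r))\<^sup>2 + (real p)\<^sup>2 * (cmod (\<phi> r) / r)\<^sup>2
          \<le> (1 / 2 * ((cmod (\<phi>1 r))\<^sup>2 + (real p)\<^sup>2 * (cmod (\<phi> r) / r)\<^sup>2) + 16 / 9 * (cmod (P r))\<^sup>2)
           + 4 / 3 * Re (\<phi>1 r * cnj (\<phi>1 r) + \<phi>2 r * cnj (\<phi> r))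
           + 4 / 3 * Re (cnj (\<phi>1 r + of_real (real p / r) * \<phi> r) * P r - cnj (\<phi> r) * f r)"
        using eq'[OF r] \<rho>2 re young[of "cmod \<rho>" "cmod (P r)"]
        unfolding \<rho>_def[symmetric] split by argo
    qed
    then show ?thesis by simp
  qed
  moreover have "0 \<le> integral {1..R} (\<lambda>r. (cmod (P r))\<^sup>2)"
    by (intro integral_nonneg integrable_continuous_interval continuous_intros cont) auto
  ultimately show "E \<le> 4 * integral {1..R} (\<lambda>r'. (cmod (of_real (r' ^ p) * integral {r'..R} (\<lambda>r. f r / of_real (r ^ p))))\<^sup>2)"
    unfolding P_def H_def by linarith
  define F where "F = integral {1..R} (\<lambda>r. (cmod (f r))\<^sup>2)"
  have F: "((\<lambda>r. (cmod (f r))\<^sup>2) has_integral F) {1..R}"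
    unfolding F_def by (intro has continuous_intros cont)
  have F0: "0 \<le> F" by (rule has_integral_nonneg[OF F]) simp
  have "E \<le> 1 / 2 * E + 8 / 9 * R\<^sup>2 / (real p)\<^sup>2 * F"
  proof -
    have i: "((\<lambda>r. (1 / 2 * ((cmod (\<phi>1 r))\<^sup>2 + (real p)\<^sup>2 * (cmod (\<phi> r) / r)\<^sup>2) + 8 / 9 * R\<^sup>2 / (real p)\<^sup>2 * (cmod (f r))\<^sup>2)
        + 4 / 3 * Re (\<phi>1 r * cnj (\<phi>1 r) + \<phi>2 r * cnj (\<phi> r))) has_integral
        ((1 / 2 * E + 8 / 9 * R\<^sup>2 / (real p)\<^sup>2 * F) + 4 / 3 * 0)) {1..R}"
      by (intro has_integral_add has_integral_mult_right E ftc1 F)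
    have "E \<le> (1 / 2 * E + 8 / 9 * R\<^sup>2 / (real p)\<^sup>2 * F) + 4 / 3 * 0"
    proof (rule has_integral_le[OF E i])
      fix r assume r: "r \<in> {1..R}"
      \<comment> \<open>The product |\<phi>||f| is bounded by (p|\<phi>|/r)(R|f|/p), so that the
        first factor is part of the energy and the second gains p^(-2) after squaring.\<close>
      define x where "x = real p * (cmod (\<phi> r) / r)"
      define y where "y = R * cmod (f r) / real p"
      have "- Re (cnj (\<phi> r) * f r) \<le> cmod (\<phi> r) * cmod (f r)"
        using complex_Re_le_cmod[of "- (cnj (\<phi> r) * f r)"] by (simp add: norm_mult)
      also have "\<dots> = r * (cmod (\<phi> r) / r * cmod (f r))" using r by simp
      also have "\<dots> \<le> R * (cmod (\<phi> r) / r * cmod (f r))" using r by (intro mult_right_mono) auto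
      also have "\<dots> = x * y" using p by (simp add: x_def y_def)
      finally have re: "- Re (cnj (\<phi> r) * f r) \<le> x * y" .
      have young: "4 / 3 * (x * y) \<le> 1 / 2 * x\<^sup>2 + 8 / 9 * y\<^sup>2"
        using zero_le_power2[of "x - 4 / 3 * y"] by (simp add: power2_eq_square algebra_simps)
      have x2: "x\<^sup>2 = (real p)\<^sup>2 * (cmod (\<phi> r) / r)\<^sup>2" unfolding x_def by (rule power_mult_distrib)
      have y2: "8 / 9 * R\<^sup>2 / (real p)\<^sup>2 * (cmod (f r))\<^sup>2 = 8 / 9 * y\<^sup>2"
        by (simp add: y_def power_mult_distrib power_divide)
      show "(cmod (\<phi>1 r))\<^sup>2 + (real p)\<^sup>2 * (cmod (\<phi> r) / r)\<^sup>2
          \<le> (1 / 2 * ((cmod (\<phi>1 r))\<^sup>2 + (real p)\<^sup>2 * (cmod (\<phi> r) / r)\<^sup>2) + 8 / 9 * R\<^sup>2 / (real p)\<^sup>2 * (cmod (f r))\<^sup>2)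
           + 4 / 3 * Re (\<phi>1 r * cnj (\<phi>1 r) + \<phi>2 r * cnj (\<phi> r))"
        using eq'[OF r] re young zero_le_power2[of "cmod (\<phi>1 r)"] unfolding x2[symmetric] y2 by argo
    qed
    then show ?thesis by simp
  qed
  then have "E \<le> 2 * (8 / 9 * R\<^sup>2 / (real p)\<^sup>2 * F)" by simp
  also have "\<dots> = 16 / 9 * (R\<^sup>2 / (real p)\<^sup>2 * F)" by simp
  also have "\<dots> \<le> 2 * (R\<^sup>2 / (real p)\<^sup>2 * F)" using F0 by (intro mult_right_mono) auto
  finally show "E \<le> 2 * R\<^sup>2 / (real p)\<^sup>2 * integral {1..R} (\<lambda>r. (cmod (f r))\<^sup>2)"
    by (simp add: F_def)
qed

section \<open>The initial layer\<close>

text \<open>The bridge between the extended Lebesgue norms of the statement and gauge integrals.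
  Absolute integrability of f follows from square integrability because the interval has finite
  measure.\<close>

lemma L2_sq_eq_ennreal_integral:
  assumes f: "in_L2 R f"
  shows "f absolutely_integrable_on {1..R}" "(\<lambda>r. (cmod (f r))\<^sup>2) integrable_on {1..R}"
    "L2_sq R f = ennreal (integral {1..R} (\<lambda>r. (cmod (f r))\<^sup>2))"
proof -
  let ?M = "lebesgue_on {1..R}"
  have meas: "f \<in> borel_measurable ?M" and fin: "(\<integral>\<^sup>+ r. ennreal ((cmod (f r))\<^sup>2) \<partial>?M) < \<infinity>"
    using f by (auto simp: in_L2_def L2_sq_def)
  have S: "{1..R} \<in> sets lebesgue" by simp
  have meas': "(\<lambda>r. cmod (f r)) \<in> borel_measurable ?M"
    by (rule measurable_compose[OF meas]) simp
  have i2: "integrable ?M (\<lambda>r. (cmod (f r))\<^sup>2)"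
  proof (rule integrableI_bounded)
    show "(\<lambda>r. (cmod (f r))\<^sup>2) \<in> borel_measurable ?M"
      by (intro borel_measurable_power meas')
    show "(\<integral>\<^sup>+ r. ennreal (norm ((cmod (f r))\<^sup>2)) \<partial>?M) < \<infinity>"
      using fin by simp
  qed
  interpret finite_measure ?M by (rule finite_measure_lebesgue_on) simp
  have "integrable ?M (\<lambda>r. cmod (f r))"
    by (rule square_integrable_imp_integrable[OF meas' i2])
  then show "f absolutely_integrable_on {1..R}"
    unfolding absolutely_integrable_measurable[OF S] o_def using meas by blast
  show "(\<lambda>r. (cmod (f r))\<^sup>2) integrable_on {1..R}"
    by (rule integrable_on_lebesgue_on[OF i2 S])
  show "L2_sq R f = ennreal (integral {1..R} (\<lambda>r. (cmod (f r))\<^sup>2))"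
    unfolding L2_sq_def lebesgue_integral_eq_integral[OF i2 S, symmetric]
    by (rule nn_integral_eq_integral[OF i2]) simp
qed

lemma in_L2_continuous:
  assumes "continuous_on {1..R} f"
  shows "in_L2 R f"
proof -
  have meas: "f \<in> borel_measurable (lebesgue_on {1..R})"
    using assms by (rule continuous_imp_measurable_on_sets_lebesgue) simp
  have "continuous_on {1..R} (\<lambda>r. (cmod (f r))\<^sup>2)" by (intro continuous_intros assms)
  from absolutely_integrable_imp_integrable[OF absolutely_integrable_continuous_real[OF this]]
  have "integrable (lebesgue_on {1..R}) (\<lambda>r. (cmod (f r))\<^sup>2)" by simp
  then have "(\<integral>\<^sup>+ r. ennreal (norm ((cmod (f r))\<^sup>2)) \<partial>lebesgue_on {1..R}) < \<infinity>"
    unfolding integrable_iff_bounded by (rule conjunct2)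
  then show ?thesis
    unfolding in_L2_def L2_sq_def using meas by simp
qed

text \<open>As g is only integrable, its indefinite integral u need not be differentiable at every
  point, and the fundamental theorem of calculus does not apply directly to v u. A datum of class
  H^1 calls for this version.\<close>

lemma integration_by_parts_indefinite_integral:
  fixes v v' g :: "real \<Rightarrow> complex"
  assumes ab: "a \<le> b" and v: "\<And>x. x \<in> {a..b} \<Longrightarrow> (v has_vector_derivative v' x) (at x within {a..b})"
    and v': "continuous_on {a..b} v'" and g: "g absolutely_integrable_on {a..b}"
  shows "((\<lambda>x. v' x * integral {a..x} g + v x * g x) has_integral v b * integral {a..b} g) {a..b}"
proof -
  have gi: "g integrable_on {a..b}" and gn: "(\<lambda>x. cmod (g x)) integrable_on {a..b}"
    using g by (auto simp: absolutely_integrable_on_def)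
  define u where "u x = integral {a..x} g" for x
  define \<Gamma> where "\<Gamma> x = integral {a..x} (\<lambda>x. cmod (g x))" for x
  have cu: "continuous_on {a..b} u" unfolding u_def by (rule indefinite_integral_continuous_1[OF gi])
  have cv: "continuous_on {a..b} v"
    using has_vector_derivative_continuous[OF v] by (simp add: continuous_on_eq_continuous_within)
  have vg: "(\<lambda>x. v x * g x) integrable_on {a..b}"
  proof -
    have "(\<lambda>x. v x * g x) absolutely_integrable_on {a..b}"
      by (rule absolutely_integrable_bounded_measurable_product[OF _ _ _ _ g, where h = "(*)"])
         (use cv in \<open>auto simp: bilinear_conv_bounded_bilinear bounded_bilinear_mult
            intro!: continuous_imp_measurable_on_sets_lebesgue compact_imp_bounded compact_continuous_image\<close>)
    then show ?thesis by (simp add: absolutely_integrable_on_def)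
  qed
  let ?f = "\<lambda>x. v' x * u x + v x * g x"
  have fi: "?f integrable_on {a..b}"
    by (intro integrable_add vg integrable_continuous_interval continuous_intros v' cu)
  obtain B where B: "\<And>x. x \<in> {a..b} \<Longrightarrow> cmod (v' x) \<le> B"
    using compact_imp_bounded[OF compact_continuous_image[OF v' compact_Icc]] unfolding bounded_iff by blast
  have B0: "B \<ge> 0" by (rule order_trans[OF norm_ge_zero B[of a]]) (use ab in simp)
  \<comment> \<open>h x is the error of the product rule accumulated on [a,x]; the claim is h b =
    0.\<close>
  define h where "h x = v x * u x - integral {a..x} ?f" for x
  have comb: "integral {a..y} k - integral {a..x} k = integral {x..y} k" "k integrable_on {x..y}"
    if "k integrable_on {a..b}" "a \<le> x" "x \<le> y" "y \<le> b" for k :: "real \<Rightarrow> 'b::banach" and x y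
  proof -
    have ky: "k integrable_on {a..y}" and kx: "k integrable_on {x..y}"
      using that by (auto intro: integrable_on_subinterval[OF that(1)])
    show "k integrable_on {x..y}" by (rule kx)
    show "integral {a..y} k - integral {a..x} k = integral {x..y} k"
      using Henstock_Kurzweil_Integration.integral_combine[OF that(2,3) ky] by (simp add: algebra_simps)
  qed
  have vdiff: "cmod (v s - v t) \<le> B * (s - t)" if "a \<le> t" "t \<le> s" "s \<le> b" for s t
  proof -
    have "(v' has_integral (v s - v t)) {t..s}"
      by (rule fundamental_theorem_of_calculus[OF that(2)])
         (use that in \<open>auto intro: has_vector_derivative_within_subset[OF v]\<close>)
    moreover have "cmod (integral {t..s} v') \<le> integral {t..s} (\<lambda>_. B)"
      using that by (intro integral_norm_bound_integral integrable_continuous_interval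
          continuous_on_subset[OF v'] continuous_on_const B) auto
    ultimately show ?thesis using that by (simp add: integral_unique mult.commute)
  qed
  have \<Gamma>diff: "\<Gamma> y - \<Gamma> x = integral {x..y} (\<lambda>x. cmod (g x))" if "a \<le> x" "x \<le> y" "y \<le> b" for x y
    unfolding \<Gamma>_def by (rule comb(1)[OF gn that])
  have udiff: "cmod (u y - u x) \<le> \<Gamma> y - \<Gamma> x" if "a \<le> x" "x \<le> y" "y \<le> b" for x y
    unfolding \<Gamma>diff[OF that] u_def comb(1)[OF gi that]
    by (rule integral_norm_bound_integral) (auto intro: comb(2)[OF gi that] comb(2)[OF gn that])
  text \<open>The defect of the product rule over \<open>[x, y]\<close> is small compared with \<open>y - x\<close>,
    so it vanishes after summation over fine partitions.\<close>
  have step: "cmod (h y - h x) \<le> 2 * B * (y - x) * (\<Gamma> y - \<Gamma> x)" if xy: "a \<le> x" "x \<le> y" "y \<le> b" for x y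
  proof -
    have sub: "{x..y} \<subseteq> {a..b}" using xy by auto
    have i1: "((\<lambda>r. v' r * u y) has_integral (v y - v x) * u y) {x..y}"
      by (intro has_integral_mult_left fundamental_theorem_of_calculus xy has_vector_derivative_within_subset[OF v sub])
         (use xy in auto)
    have i2: "((\<lambda>r. v x * g r) has_integral v x * (u y - u x)) {x..y}"
      unfolding u_def comb(1)[OF gi xy]
      by (intro has_integral_mult_right integrable_integral comb(2)[OF gi xy])
    have i3: "(?f has_integral integral {x..y} ?f) {x..y}"
      by (intro integrable_integral comb(2)[OF fi xy])
    have "((\<lambda>r. v' r * u y + v x * g r - ?f r) has_integral
        (v y - v x) * u y + v x * (u y - u x) - integral {x..y} ?f) {x..y}"
      by (intro has_integral_add has_integral_diff i1 i2 i3)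
    moreover have "(v y - v x) * u y + v x * (u y - u x) - integral {x..y} ?f = h y - h x"
      unfolding h_def comb(1)[OF fi xy, symmetric] by (simp add: algebra_simps)
    ultimately have hd: "((\<lambda>r. v' r * u y + v x * g r - ?f r) has_integral (h y - h x)) {x..y}" by simp
    have "cmod (h y - h x) \<le> integral {x..y} (\<lambda>r. B * (\<Gamma> y - \<Gamma> x) + B * (y - x) * cmod (g r))"
      unfolding integral_unique[OF hd, symmetric]
    proof (rule integral_norm_bound_integral)
      show "(\<lambda>r. v' r * u y + v x * g r - ?f r) integrable_on {x..y}" using hd by blast
      show "(\<lambda>r. B * (\<Gamma> y - \<Gamma> x) + B * (y - x) * cmod (g r)) integrable_on {x..y}"
        by (intro integrable_add integrable_const_ivl integrable_on_mult_right comb(2)[OF gn xy])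
      fix r assume r: "r \<in> {x..y}"
      \<comment> \<open>Each product contains an increment over part of [x,y]; integrated over
        [x,y], each is at most B(y - x) times the increment of \<Gamma>.\<close>
      have "v' r * u y + v x * g r - ?f r = v' r * (u y - u r) + (v x - v r) * g r"
        by (simp add: algebra_simps)
      also have "cmod \<dots> \<le> cmod (v' r) * cmod (u y - u r) + cmod (v x - v r) * cmod (g r)"
        by (rule order_trans[OF norm_triangle_ineq]) (simp add: norm_mult)
      also have "\<dots> \<le> B * (\<Gamma> y - \<Gamma> x) + B * (y - x) * cmod (g r)"
      proof (intro add_mono mult_mono mult_right_mono)
        show "cmod (v' r) \<le> B" using B r xy by auto
        have "cmod (u y - u r) \<le> \<Gamma> y - \<Gamma> r" using r xy by (intro udiff) auto
        moreover have "0 \<le> \<Gamma> r - \<Gamma> x"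
          by (rule order_trans[OF norm_ge_zero udiff]) (use r xy in auto)
        ultimately show "cmod (u y - u r) \<le> \<Gamma> y - \<Gamma> x" by simp
        have "cmod (v x - v r) \<le> B * (r - x)" using vdiff[of x r] r xy by (simp add: norm_minus_commute)
        also have "\<dots> \<le> B * (y - x)" using r B0 by (intro mult_left_mono) auto
        finally show "cmod (v x - v r) \<le> B * (y - x)" .
      qed (use B0 xy in auto)
      finally show "cmod (v' r * u y + v x * g r - ?f r) \<le> B * (\<Gamma> y - \<Gamma> x) + B * (y - x) * cmod (g r)" .
    qed
    also have "\<dots> = B * (\<Gamma> y - \<Gamma> x) * (y - x) + B * (y - x) * (\<Gamma> y - \<Gamma> x)"
      unfolding \<Gamma>diff[OF xy] using xy comb(2)[OF gn xy]
      by (subst integral_add) (auto intro: integrable_on_mult_right)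
    finally show ?thesis by (simp add: algebra_simps)
  qed
  have h0: "h a = 0" by (simp add: h_def u_def)
  \<comment> \<open>On a uniform partition into n parts every step bound carries the factor d = (b -
    a)/n, and the increments of \<Gamma> telescope; since n is arbitrary, h b must vanish.\<close>
  have small: "cmod (h b) * real n \<le> 2 * B * (b - a) * \<Gamma> b" if n: "n > 0" for n :: nat
  proof -
    define d where "d = (b - a) / real n"
    have d: "d \<ge> 0" "real n * d = b - a" using ab n by (auto simp: d_def)
    have "k \<le> n \<Longrightarrow> cmod (h (a + real k * d)) \<le> 2 * B * d * \<Gamma> (a + real k * d)" for k
    proof (induction k)
      case 0
      then show ?case by (simp add: h0 \<Gamma>_def)
    next
      case (Suc k)
      let ?x = "a + real k * d" and ?y = "a + real (Suc k) * d"
      have "real (Suc k) * d \<le> real n * d" using Suc.prems d by (intro mult_right_mono) auto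
      then have xy: "a \<le> ?x" "?x \<le> ?y" "?y \<le> b" using d by (auto simp: algebra_simps)
      have "cmod (h ?y) \<le> cmod (h ?x) + cmod (h ?y - h ?x)"
        using norm_triangle_ineq[of "h ?x" "h ?y - h ?x"] by simp
      also have "\<dots> \<le> 2 * B * d * \<Gamma> ?x + 2 * B * d * (\<Gamma> ?y - \<Gamma> ?x)"
        using Suc step[OF xy] by (intro add_mono) (auto simp: algebra_simps)
      finally show ?case by (simp add: algebra_simps)
    qed
    from this[of n] have "cmod (h b) \<le> 2 * B * d * \<Gamma> b" using d by simp
    then have "cmod (h b) * real n \<le> 2 * B * d * \<Gamma> b * real n" by (intro mult_right_mono) auto
    also have "\<dots> = 2 * B * (real n * d) * \<Gamma> b" by (simp add: mult_ac)
    finally show ?thesis by (simp add: d)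
  qed
  have "h b = 0"
  proof (rule ccontr)
    assume "h b \<noteq> 0"
    then have pos: "cmod (h b) > 0" by simp
    obtain n :: nat where "2 * B * (b - a) * \<Gamma> b / cmod (h b) < real n" using reals_Archimedean2 by blast
    then have "2 * B * (b - a) * \<Gamma> b < cmod (h b) * real n"
      using pos by (simp add: divide_less_eq mult.commute)
    also have "\<dots> \<le> cmod (h b) * real (Suc n)" by (intro mult_left_mono) auto
    finally have "2 * B * (b - a) * \<Gamma> b < cmod (h b) * real (Suc n)" .
    with small[of "Suc n"] show False by simp
  qed
  then have "integral {a..b} ?f = v b * u b" by (simp add: h_def)
  with integrable_integral[OF fi] show ?thesis by (simp add: u_def)
qed

section \<open>A flow that attains its datum in the mean-square sense\<close>

text \<open>\<open>lim\<close> is the only link between the flow and the datum: it says nothing on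
  the value at time 0 or on convergence of gradients.\<close>

locale radial_flow_datum = radial_flow +
  fixes w0 w0' :: "real \<Rightarrow> complex"
  assumes H1: "H1_deriv R w0 w0'" and bc0: "vanishes_at_ends R w0"
    and lim: "((\<lambda>t. L2_sq R (\<lambda>r. w t r - w0 r)) \<longlongrightarrow> 0) (at_right 0)"
begin

definition mass0 :: real where "mass0 = integral {1..R} (\<lambda>r. (cmod (w0 r))\<^sup>2)"
definition hardy0 :: real where "hardy0 = integral {1..R} (\<lambda>r. (cmod (w0 r) / r)\<^sup>2)"
definition grad0 :: real where "grad0 = integral {1..R} (\<lambda>r. (cmod (w0' r))\<^sup>2)"

definition defect :: "real \<Rightarrow> real" where
  "defect t = integral {1..R} (\<lambda>r. (cmod (w t r - w0 r))\<^sup>2)"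

lemma w0_facts:
  shows "w0' absolutely_integrable_on {1..R}" "(\<lambda>r. (cmod (w0' r))\<^sup>2) integrable_on {1..R}"
    "\<And>r. r \<in> {1..R} \<Longrightarrow> w0 r = integral {1..r} w0'" "continuous_on {1..R} w0" "integral {1..R} w0' = 0"
proof -
  have L2: "in_L2 R w0'" and w0: "\<And>r. r \<in> {1..R} \<Longrightarrow> w0 r = w0 1 + integral\<^sup>L (lebesgue_on {1..r}) w0'"
    using H1 unfolding H1_deriv_def by blast+
  show ai: "w0' absolutely_integrable_on {1..R}" and "(\<lambda>r. (cmod (w0' r))\<^sup>2) integrable_on {1..R}"
    using L2_sq_eq_ennreal_integral[OF L2] by blast+
  show eq: "w0 r = integral {1..r} w0'" if r: "r \<in> {1..R}" for r
  proof -
    have "w0' absolutely_integrable_on {1..r}"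
      by (rule absolutely_integrable_on_subinterval[OF ai]) (use r in auto)
    then have "integrable (lebesgue_on {1..r}) w0'" by (rule absolutely_integrable_imp_integrable) simp
    then have "integral\<^sup>L (lebesgue_on {1..r}) w0' = integral {1..r} w0'"
      by (rule lebesgue_integral_eq_integral) simp
    then show ?thesis using w0[OF r] bc0 by (simp add: vanishes_at_ends_def)
  qed
  have "w0' integrable_on {1..R}" using ai by (simp add: absolutely_integrable_on_def)
  from indefinite_integral_continuous_1[OF this] show "continuous_on {1..R} w0"
    by (rule continuous_on_eq) (simp add: eq)
  show "integral {1..R} w0' = 0" using eq[of R] bc0 R by (simp add: vanishes_at_ends_def)
qed

text \<open>The second derivative is tested against a datum whose derivative is only square
  integrable; the boundary term at R is a multiple of w0 R = 0.\<close>

lemma ftc_parts_datum: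
  assumes t: "t > 0"
  shows "((\<lambda>r. Re (w2 t r * cnj (w0 r) + w1 t r * cnj (w0' r))) has_integral 0) {1..R}"
proof -
  have g: "(\<lambda>r. cnj (w0' r)) absolutely_integrable_on {1..R}"
    using absolutely_integrable_linear[OF w0_facts(1) bounded_linear_cnj] by (simp add: o_def)
  have eq: "integral {1..r} (\<lambda>r. cnj (w0' r)) = cnj (w0 r)" if "r \<in> {1..R}" for r
    using w0_facts(3)[OF that] by (simp add: Henstock_Kurzweil_Integration.integral_cnj)
  have "((\<lambda>r. w2 t r * integral {1..r} (\<lambda>r. cnj (w0' r)) + w1 t r * cnj (w0' r)) has_integral
      w1 t R * integral {1..R} (\<lambda>r. cnj (w0' r))) {1..R}"
    using R by (intro integration_by_parts_indefinite_integral[OF _ dw1[OF t] continuous_on_w(3)[OF t] g]) auto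
  moreover have "integral {1..R} (\<lambda>r. cnj (w0' r)) = 0"
    using w0_facts(5) Henstock_Kurzweil_Integration.integral_cnj[of "{1..R}" w0'] by simp
  ultimately have "((\<lambda>r. w2 t r * integral {1..r} (\<lambda>r. cnj (w0' r)) + w1 t r * cnj (w0' r)) has_integral 0) {1..R}"
    by simp
  then have "((\<lambda>r. w2 t r * cnj (w0 r) + w1 t r * cnj (w0' r)) has_integral 0) {1..R}"
    by (rule has_integral_eq[rotated]) (simp add: eq)
  from has_integral_linear[OF this bounded_linear_Re] show ?thesis by (simp add: o_def)
qed

lemma has_integral_datum:
  "((\<lambda>r. (cmod (w0 r))\<^sup>2) has_integral mass0) {1..R}"
  "((\<lambda>r. (cmod (w0 r) / r)\<^sup>2) has_integral hardy0) {1..R}"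
  "((\<lambda>r. (cmod (w0' r))\<^sup>2) has_integral grad0) {1..R}"
  "t > 0 \<Longrightarrow> ((\<lambda>r. (cmod (w t r - w0 r))\<^sup>2) has_integral defect t) {1..R}"
  unfolding mass0_def hardy0_def grad0_def defect_def
  using integrable_integral[OF w0_facts(2)]
  by (auto intro: has_integral_of_continuous intro!: continuous_intros w0_facts(4) continuous_on_w)

lemma datum_nonneg: "0 \<le> mass0" "0 \<le> hardy0" "0 \<le> grad0"
  by (rule has_integral_nonneg[OF has_integral_datum(1)] has_integral_nonneg[OF has_integral_datum(2)]
      has_integral_nonneg[OF has_integral_datum(3)]; simp)+

lemma defect_nonneg: "t > 0 \<Longrightarrow> 0 \<le> defect t"
  by (rule has_integral_nonneg[OF has_integral_datum(4)]) auto

lemma defect_small: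
  assumes "\<epsilon> > 0"
  obtains d where "d > 0" "\<And>t. 0 < t \<Longrightarrow> t < d \<Longrightarrow> defect t < \<epsilon>"
proof -
  have "eventually (\<lambda>t. L2_sq R (\<lambda>r. w t r - w0 r) < ennreal \<epsilon>) (at_right 0)"
    by (rule order_tendstoD(2)[OF lim]) (use assms in simp)
  then obtain d where d: "d > 0" "\<And>t. 0 < t \<Longrightarrow> t < d \<Longrightarrow> L2_sq R (\<lambda>r. w t r - w0 r) < ennreal \<epsilon>"
    unfolding eventually_at_right_field by auto
  have "defect t < \<epsilon>" if t: "0 < t" "t < d" for t
  proof -
    have "in_L2 R (\<lambda>r. w t r - w0 r)"
      by (intro in_L2_continuous continuous_intros continuous_on_w w0_facts(4) t)
    from L2_sq_eq_ennreal_integral(3)[OF this] d(2)[OF t] show ?thesis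
      using assms defect_nonneg[OF t(1)] by (simp add: defect_def ennreal_less_iff)
  qed
  with d(1) show ?thesis by (rule that)
qed

text \<open>An upper bound for the derivative of \<open>defect\<close>. The parameter \<theta> of
  Young's inequality splits the transport contribution: small \<theta> controls the part of the
  datum, while \<open>defect\<close>/\<theta> is small close to the initial time.\<close>

definition defect_rate :: "real \<Rightarrow> real \<Rightarrow> real" where
  "defect_rate \<theta> t = \<beta> * (- (\<delta>^3) * (grad_sq t + K * hardy_sq t) + \<delta>^3 * (grad0 + K * hardy0) + \<theta> * mass0 + defect t / \<theta>)"

text \<open>The equation is paired with w - w0. Transport is skew on w - w0 and leaves only its
  product with w0; in the viscous part the mixed products with the datum are split so that half of
  the coercive terms survives.\<close>

lemma defect_derivative:
  assumes t: "t > 0" and \<theta>: "\<theta> > 0"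
  obtains D where "(defect has_real_derivative D) (at t)"
    "D \<le> defect_rate \<theta> t"
proof -
  note c = continuous_on_w[OF t] w0_facts(4)
  define Z where "Z s r = cnj (w s r + w t r - 2 * w0 r)" for s r
  let ?l = "\<lambda>r. Re (wt t r * Z t r) - 2 * \<beta> * \<delta>^3 * Re (w2 t r * cnj (w t r) + w1 t r * cnj (w1 t r))
      + 2 * \<beta> * \<delta>^3 * Re (w2 t r * cnj (w0 r) + w1 t r * cnj (w0' r))"
  let ?b = "\<lambda>r. \<beta> * (- (\<delta>^3) * ((cmod (w1 t r))\<^sup>2 + K * (cmod (w t r) / r)\<^sup>2)
      + \<delta>^3 * ((cmod (w0' r))\<^sup>2 + K * (cmod (w0 r) / r)\<^sup>2) + \<theta> * (cmod (w0 r))\<^sup>2 + (cmod (w t r - w0 r))\<^sup>2 / \<theta>)"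
  define D where "D = integral {1..R} (\<lambda>r. Re (wt t r * Z t r))"
  have D: "(defect has_real_derivative D) (at t)"
    unfolding D_def
  proof (rule has_real_derivative_of_polarization[OF t dwt cw cwt])
    have snd: "continuous_on ({0<..} \<times> {1..R}) (\<lambda>q. f (snd q))" if "continuous_on {1..R} f" for f :: "real \<Rightarrow> complex"
      by (rule continuous_on_compose2[OF that]) (auto intro!: continuous_intros)
    show "continuous_on ({0<..} \<times> {1..R}) (\<lambda>(s, r). Z s r)"
      using cw snd[OF c(1)] snd[OF w0_facts(4)] unfolding Z_def split_beta
      by (auto intro!: continuous_intros)
    fix s :: real assume s: "s > 0"
    have "defect s - defect t = integral {1..R} (\<lambda>r. (cmod (w s r - w0 r))\<^sup>2 - (cmod (w t r - w0 r))\<^sup>2)"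
      using has_integral_diff[OF has_integral_datum(4)[OF s] has_integral_datum(4)[OF t]] by (simp add: integral_unique)
    also have "\<dots> = integral {1..R} (\<lambda>r. Re ((w s r - w t r) * Z s r))"
      unfolding Z_def cmod_power2
      by (intro integral_cong) (simp add: power2_eq_square algebra_simps)
    finally show "defect s - defect t = integral {1..R} (\<lambda>r. Re ((w s r - w t r) * Z s r))" .
  qed
  have z1: "((\<lambda>r. Re (w2 t r * cnj (w t r) + w1 t r * cnj (w1 t r))) has_integral 0) {1..R}"
    using has_integral_linear[OF ftc_parts[OF t] bounded_linear_Re] by (simp add: o_def)
  have "((\<lambda>r. ?l r) has_integral
      (D - 2 * \<beta> * \<delta>^3 * 0 + 2 * \<beta> * \<delta>^3 * 0)) {1..R}"
    unfolding D_def Z_def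
    by (intro has_integral_add has_integral_diff has_integral_mult_right z1 ftc_parts_datum t
        has_integral_of_continuous continuous_intros c)
  moreover have "((\<lambda>r. ?b r) has_integral defect_rate \<theta> t) {1..R}"
    unfolding defect_rate_def
    by (intro has_integral_mult_right has_integral_add has_integral_squares has_integral_datum has_integral_divide t)
  ultimately have "D - 2 * \<beta> * \<delta>^3 * 0 + 2 * \<beta> * \<delta>^3 * 0
      \<le> defect_rate \<theta> t"
  proof (rule has_integral_le)
    fix r assume r: "r \<in> {1..R}"
    have r0: "r > 0" using r by simp
    let ?x = "w t r" and ?y = "w0 r" and ?z = "w1 t r" and ?g = "w0' r"
    have \<kappa>1: "\<bar>\<kappa>\<bar> = 1" using \<kappa> by (auto simp: power2_eq_1_iff)
    have id: "?l r
      = \<beta> * (- 2 * \<delta>^3 * ((cmod ?z)\<^sup>2 + K * (cmod ?x / r)\<^sup>2) + 2 * \<delta>^3 * (Re (?z * cnj ?g) + K * Re (?x * cnj ?y) / r\<^sup>2)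
        + 2 * Re (\<i> * of_real (\<kappa> / r\<^sup>2) * (?x - ?y) * cnj ?y))"
    proof -
      have "Re (of_real \<beta> * (of_real d * (u2 - of_real k * u) - \<i> * of_real m * u) * cnj (u + u - 2 * u0))
          - 2 * \<beta> * d * Re (u2 * cnj u + u1 * cnj u1) + 2 * \<beta> * d * Re (u2 * cnj u0 + u1 * cnj g)
        = \<beta> * (- 2 * d * ((cmod u1)\<^sup>2 + k * (cmod u)\<^sup>2) + 2 * d * (Re (u1 * cnj g) + k * Re (u * cnj u0))
          + 2 * Re (\<i> * of_real m * (u - u0) * cnj u0))" for d k m :: real and u u0 u1 u2 g
        unfolding cmod_power2 by (simp add: algebra_simps power2_eq_square)
      from this[of "\<delta>^3" "w2 t r" "K / r\<^sup>2" ?x "\<kappa> / r\<^sup>2" ?y ?z ?g] show ?thesis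
        unfolding eqn[OF t r] Z_def by (simp only: power_divide times_divide_eq_left times_divide_eq_right)
    qed
    have b1: "2 * Re (?z * cnj ?g) \<le> (cmod ?z)\<^sup>2 + (cmod ?g)\<^sup>2"
      using zero_le_power2[of "cmod (?z - ?g)"] unfolding cmod_power2 by (simp add: power2_eq_square algebra_simps)
    have b2: "2 * Re (?x * cnj ?y) / r\<^sup>2 \<le> (cmod ?x / r)\<^sup>2 + (cmod ?y / r)\<^sup>2"
    proof -
      have "2 * Re (?x * cnj ?y) \<le> (cmod ?x)\<^sup>2 + (cmod ?y)\<^sup>2"
        using zero_le_power2[of "cmod (?x - ?y)"] unfolding cmod_power2 by (simp add: power2_eq_square algebra_simps)
      then have "2 * Re (?x * cnj ?y) / r\<^sup>2 \<le> ((cmod ?x)\<^sup>2 + (cmod ?y)\<^sup>2) / r\<^sup>2"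
        by (rule divide_right_mono) simp
      then show ?thesis by (simp only: power_divide add_divide_distrib)
    qed
    have b3: "2 * Re (\<i> * of_real (\<kappa> / r\<^sup>2) * (?x - ?y) * cnj ?y) \<le> \<theta> * (cmod ?y)\<^sup>2 + (cmod (?x - ?y))\<^sup>2 / \<theta>"
    proof -
      have "Re (\<i> * of_real (\<kappa> / r\<^sup>2) * (?x - ?y) * cnj ?y) \<le> 1 / r\<^sup>2 * (cmod (?x - ?y) * cmod ?y)"
        by (rule order_trans[OF complex_Re_le_cmod]) (use \<kappa>1 in \<open>simp add: norm_mult norm_divide norm_power\<close>)
      also have "\<dots> \<le> 1 * (cmod (?x - ?y) * cmod ?y)"
        using r by (intro mult_right_mono) (auto simp: divide_le_eq one_le_power)
      finally have "2 * Re (\<i> * of_real (\<kappa> / r\<^sup>2) * (?x - ?y) * cnj ?y) \<le> 2 * (cmod (?x - ?y) * cmod ?y)" by linarith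
      also have "2 * (cmod (?x - ?y) * cmod ?y) \<le> \<theta> * (cmod ?y)\<^sup>2 + (cmod (?x - ?y))\<^sup>2 / \<theta>"
      proof -
        have "2 * (x * y) \<le> \<theta> * y\<^sup>2 + x\<^sup>2 / \<theta>" for x y :: real
        proof -
          have "0 \<le> (\<theta> * y - x)\<^sup>2 / \<theta>" using \<theta> by simp
          then show ?thesis using \<theta> by (simp add: power2_eq_square field_simps)
        qed
        then show ?thesis .
      qed
      finally show ?thesis .
    qed
    have "- 2 * \<delta>^3 * ((cmod ?z)\<^sup>2 + K * (cmod ?x / r)\<^sup>2) + 2 * \<delta>^3 * (Re (?z * cnj ?g) + K * Re (?x * cnj ?y) / r\<^sup>2)
        \<le> - (\<delta>^3) * ((cmod ?z)\<^sup>2 + K * (cmod ?x / r)\<^sup>2) + \<delta>^3 * ((cmod ?g)\<^sup>2 + K * (cmod ?y / r)\<^sup>2)"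
    proof -
      have "\<delta>^3 * (2 * Re (?z * cnj ?g) + K * (2 * Re (?x * cnj ?y) / r\<^sup>2))
        \<le> \<delta>^3 * (((cmod ?z)\<^sup>2 + (cmod ?g)\<^sup>2) + K * ((cmod ?x / r)\<^sup>2 + (cmod ?y / r)\<^sup>2))"
        using \<delta> K by (intro mult_left_mono add_mono b1 b2) auto
      moreover have "- 2 * d * (a + k * b) + 2 * d * (x + k * y / q) \<le> - d * (a + k * b) + d * (e + k * f)"
        if "d * (2 * x + k * (2 * y / q)) \<le> d * ((a + e) + k * (b + f))" for d a k b x y q e f :: real
        using that by (simp add: algebra_simps)
      ultimately show ?thesis by blast
    qed
    then have "- 2 * \<delta>^3 * ((cmod ?z)\<^sup>2 + K * (cmod ?x / r)\<^sup>2) + 2 * \<delta>^3 * (Re (?z * cnj ?g) + K * Re (?x * cnj ?y) / r\<^sup>2)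
        + 2 * Re (\<i> * of_real (\<kappa> / r\<^sup>2) * (?x - ?y) * cnj ?y)
        \<le> - (\<delta>^3) * ((cmod ?z)\<^sup>2 + K * (cmod ?x / r)\<^sup>2) + \<delta>^3 * ((cmod ?g)\<^sup>2 + K * (cmod ?y / r)\<^sup>2)
          + \<theta> * (cmod ?y)\<^sup>2 + (cmod (?x - ?y))\<^sup>2 / \<theta>"
      using b3 by argo
    then show "?l r
      \<le> ?b r"
      unfolding id using \<beta> by (intro mult_left_mono) auto
  qed
  then have "D \<le> defect_rate \<theta> t"
    by simp
  with D show ?thesis by (rule that)
qed

text \<open>If the gradient exceeded that of the datum throughout \<open>(0, t0)\<close>, the squared distance to the
  datum would decrease at a definite rate, although it tends to zero at the initial time.\<close>

lemma initial_layer: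
  assumes \<eta>: "\<eta> > 0" and t0: "t0 > 0"
  obtains \<sigma> where "0 < \<sigma>" "\<sigma> < t0" "energy 0 0 \<sigma> \<le> 2 * mass0 + \<eta>" "grad_sq \<sigma> \<le> grad0 + K * hardy0 + \<eta>"
proof -
  \<comment> \<open>This choice gives \<theta> \<open>mass0\<close> \<le> \<delta>^3\<eta>/4; the 1
    added to \<open>mass0\<close> covers a zero datum.\<close>
  define \<theta> where "\<theta> = \<delta>^3 * \<eta> / (4 * (mass0 + 1))"
  have \<theta>: "\<theta> > 0" using \<delta> \<eta> datum_nonneg by (simp add: \<theta>_def)
  have \<theta>m: "\<theta> * mass0 \<le> \<delta>^3 * \<eta> / 4"
  proof -
    have "\<theta> * mass0 \<le> \<theta> * (mass0 + 1)" using \<theta> by (intro mult_left_mono) auto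
    also have "\<dots> = \<delta>^3 * \<eta> / 4"
    proof -
      have "x / (4 * y) * y = x / 4" if "y \<noteq> 0" for x y :: real using that by simp
      from this[of "mass0 + 1" "\<delta>^3 * \<eta>"] show ?thesis unfolding \<theta>_def using datum_nonneg by linarith
    qed
    finally show ?thesis .
  qed
  \<comment> \<open>The first entry gives \<open>defect\<close>/\<theta> \<le> \<delta>^3\<eta>/4,
    so that half of the surplus \<delta>^3\<eta> of the gradient remains as decay; the second gives
    2 \<open>defect\<close> \<le> \<eta> in the final bound on the mass.\<close>
  define \<epsilon> where "\<epsilon> = min (\<theta> * (\<delta>^3 * \<eta> / 4)) (\<eta> / 2)"
  have "\<epsilon> > 0" using \<theta> \<delta> \<eta> by (simp add: \<epsilon>_def)
  then obtain d where d: "d > 0" "\<And>t. 0 < t \<Longrightarrow> t < d \<Longrightarrow> defect t < \<epsilon>" by (rule defect_small) blast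
  define \<tau> where "\<tau> = min d t0 / 2"
  have \<tau>: "\<tau> > 0" "\<tau> < d" "\<tau> < t0" using d t0 by (auto simp: \<tau>_def min_def)
  define q where "q = \<beta> * \<delta>^3 * \<eta> / 2"
  have q: "q > 0" using \<beta> \<delta> \<eta> by (simp add: q_def)
  have "\<exists>\<sigma>. 0 < \<sigma> \<and> \<sigma> \<le> \<tau> \<and> grad_sq \<sigma> \<le> grad0 + K * hardy0 + \<eta>"
  proof (rule ccontr)
    assume "\<not> ?thesis"
    then have big: "grad_sq s > grad0 + K * hardy0 + \<eta>" if "0 < s" "s \<le> \<tau>" for s
      using that by force
    \<comment> \<open>Between s \<le> \<tau>/2 and \<tau> the defect would have to fall by at least
      q\<tau>/2, which is more than its value at s.\<close>
    obtain d' where d': "d' > 0" "\<And>t. 0 < t \<Longrightarrow> t < d' \<Longrightarrow> defect t < q * (\<tau> / 2)"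
      by (rule defect_small[of "q * (\<tau> / 2)"]) (use q \<tau> in auto)
    define s where "s = min d' \<tau> / 2"
    have s: "0 < s" "s < d'" "s \<le> \<tau> / 2" using d' \<tau> by (auto simp: s_def min_def)
    have "\<forall>x. \<exists>D. x > 0 \<longrightarrow> (defect has_real_derivative D) (at x) \<and>
      D \<le> defect_rate \<theta> x"
      using defect_derivative[OF _ \<theta>] by metis
    then obtain D where D: "\<And>x. x > 0 \<Longrightarrow> (defect has_real_derivative D x) (at x)"
      "\<And>x. x > 0 \<Longrightarrow> D x \<le> defect_rate \<theta> x"
      by metis
    have "integral {s..\<tau>} (\<lambda>x. q) \<le> defect s"
    proof (rule integral_le_of_derivative_le[where f' = D])
      show "s \<le> \<tau>" using s \<tau> by simp
      show "0 \<le> defect \<tau>" by (rule defect_nonneg[OF \<tau>(1)])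
      fix x assume x: "x \<in> {s..\<tau>}"
      then have x0: "x > 0" "x \<le> \<tau>" "x < d" using s \<tau> by auto
      show "(defect has_real_derivative D x) (at x)" by (rule D(1)[OF x0(1)])
      have "grad_sq x + K * hardy_sq x \<ge> grad0 + K * hardy0 + \<eta>"
        using big[OF x0(1,2)] squares_nonneg(2)[OF x0(1)] K by (simp add: add_increasing2)
      then have gradx: "\<delta>^3 * (grad0 + K * hardy0 + \<eta>) \<le> \<delta>^3 * (grad_sq x + K * hardy_sq x)"
        using \<delta> by (intro mult_left_mono) auto
      have defx: "defect x / \<theta> \<le> \<delta>^3 * \<eta> / 4"
        using d(2)[OF x0(1,3)] \<theta> by (simp add: \<epsilon>_def pos_divide_le_eq mult.commute)
      have "- (\<delta>^3) * (grad_sq x + K * hardy_sq x) + \<delta>^3 * (grad0 + K * hardy0) + \<theta> * mass0 + defect x / \<theta>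
          \<le> - (\<delta>^3 * \<eta> / 2)"
      proof -
        have "- d * a + d * b + x + y \<le> - (d * \<eta> / 2)"
          if "d * (b + \<eta>) \<le> d * a" "y \<le> d * \<eta> / 4" "x \<le> d * \<eta> / 4" for d a b x y :: real
          using that by (simp add: distrib_left)
        from this[OF gradx defx \<theta>m] show ?thesis .
      qed
      then have "defect_rate \<theta> x
          \<le> \<beta> * - (\<delta>^3 * \<eta> / 2)"
        unfolding defect_rate_def using \<beta> by (intro mult_left_mono) auto
      with D(2)[OF x0(1)] show "D x \<le> - q" by (simp add: q_def)
    qed (rule continuous_on_const)
    then have "q * (\<tau> - s) \<le> defect s" using s \<tau> by (simp add: mult.commute)
    moreover have "q * (\<tau> / 2) \<le> q * (\<tau> - s)" using q s by (intro mult_left_mono) auto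
    ultimately show False using d'(2)[OF s(1,2)] by simp
  qed
  then obtain \<sigma> where \<sigma>: "0 < \<sigma>" "\<sigma> \<le> \<tau>" "grad_sq \<sigma> \<le> grad0 + K * hardy0 + \<eta>" by blast
  have "energy 0 0 \<sigma> \<le> 2 * mass0 + 2 * defect \<sigma>"
  proof (rule has_integral_le[OF has_integral_squares(4)[OF \<sigma>(1)]
      has_integral_add[OF has_integral_mult_right[OF has_integral_datum(1)] has_integral_mult_right[OF has_integral_datum(4)[OF \<sigma>(1)]]]])
    fix r
    have "cmod (w \<sigma> r) \<le> cmod (w0 r) + cmod (w \<sigma> r - w0 r)"
      using norm_triangle_ineq[of "w0 r" "w \<sigma> r - w0 r"] by simp
    then have "(cmod (w \<sigma> r))\<^sup>2 \<le> (cmod (w0 r) + cmod (w \<sigma> r - w0 r))\<^sup>2" by (intro power_mono) auto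
    also have "\<dots> \<le> 2 * (cmod (w0 r))\<^sup>2 + 2 * (cmod (w \<sigma> r - w0 r))\<^sup>2"
      by (rule power2_sum_le)
    finally show "(cmod (w \<sigma> r))\<^sup>2 \<le> 2 * (cmod (w0 r))\<^sup>2 + 2 * (cmod (w \<sigma> r - w0 r))\<^sup>2" .
  qed
  moreover have "defect \<sigma> < \<epsilon>" using \<sigma> \<tau> by (intro d(2)) auto
  ultimately have "energy 0 0 \<sigma> \<le> 2 * mass0 + \<eta>" by (simp add: \<epsilon>_def)
  with \<sigma> \<tau> show ?thesis by (intro that[of \<sigma>]) auto
qed

end

section \<open>The weighted estimate\<close>

context radial_flow_datum
begin

text \<open>The majorant m of the stream-function energy depends on the regime: tail integrals for
  \<delta>p \<le> 1, where \<delta>^2 K \<le> 1 makes hypocoercivity available, and mass for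
  \<delta>p > 1, where viscosity alone exceeds the required rate. Obtaining m first makes it
  independent of s and t.\<close>

lemma majorant_bound:
  assumes p: "1 \<le> p" and Kp: "K = (real p)\<^sup>2 - 1/4" and c: "0 \<le> c" "c \<le> 1/800" and a: "a = c * \<beta> * \<delta> / R\<^sup>2"
  obtains m where "continuous_on {0<..} m" "\<And>t. t > 0 \<Longrightarrow> 0 \<le> m t"
    "m = (\<lambda>t. 4 * profile_sq p t) \<or> m = (\<lambda>t. 2 * R\<^sup>2 / (real p)\<^sup>2 * energy 0 0 t)"
    "\<And>s t. 0 < s \<Longrightarrow> s \<le> t \<Longrightarrow> real p * \<beta> / R^4 * integral {s..t} (\<lambda>x. exp (2 * a * x) * m x)
      \<le> 200000 * (mass0 + R\<^sup>2 * hardy0 + \<delta>\<^sup>2 * R\<^sup>2 * grad0)"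
proof -
  let ?A = "mass0 + R\<^sup>2 * hardy0 + \<delta>\<^sup>2 * R\<^sup>2 * grad0" and ?k = "real p * \<beta> / R^4"
  have a0: "0 \<le> a" using c \<beta> \<delta> by (simp add: a)
  have p1: "1 \<le> real p" using p by simp
  have pK: "3 / 4 * (real p)\<^sup>2 \<le> K" "K \<le> (real p)\<^sup>2"
    using power_mono[OF p1, of 2] by (simp_all add: Kp)
  \<comment> \<open>Starting times below 1/(2a + 1) keep the weight at most e \<le> 3.\<close>
  have esmall: "exp (2 * a * \<sigma>) \<le> 3" if "0 < \<sigma>" "\<sigma> < 1 / (2 * a + 1)" for \<sigma>
  proof -
    have "2 * a * \<sigma> \<le> (2 * a + 1) * \<sigma>" using that by (intro mult_right_mono) auto
    also have "\<dots> \<le> 1" using that a0 by (simp add: pos_less_divide_eq mult.commute less_imp_le)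
    finally have "exp (2 * a * \<sigma>) \<le> exp 1" by simp
    then show ?thesis using exp_le by linarith
  qed
  have start: "\<exists>\<sigma>. 0 < \<sigma> \<and> \<sigma> \<le> s \<and> exp (2 * a * \<sigma>) \<le> 3 \<and> energy 0 0 \<sigma> \<le> 2 * mass0 + \<eta> \<and>
      grad_sq \<sigma> \<le> grad0 + K * hardy0 + \<eta>" if s: "0 < s" and \<eta>: "\<eta> > 0" for s \<eta>
  proof -
    have "min s (1 / (2 * a + 1)) > 0" using s a0 by simp
    from initial_layer[OF \<eta> this] obtain \<sigma> where "0 < \<sigma>" "\<sigma> < min s (1 / (2 * a + 1))"
      "energy 0 0 \<sigma> \<le> 2 * mass0 + \<eta>" "grad_sq \<sigma> \<le> grad0 + K * hardy0 + \<eta>" by blast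
    then show ?thesis using esmall[of \<sigma>] by (intro exI[of _ \<sigma>]) auto
  qed
  \<comment> \<open>The integrand is nonnegative, so the lower limit may be moved down to a
    favourable time in the initial layer.\<close>
  have enlarge: "integral {s..t} (\<lambda>x. exp (2 * a * x) * m x) \<le> integral {\<sigma>..t} (\<lambda>x. exp (2 * a * x) * m x)"
    if "continuous_on {0<..} m" "\<And>t. t > 0 \<Longrightarrow> 0 \<le> m t" "0 < \<sigma>" "\<sigma> \<le> s" for m s t \<sigma>
  proof (rule integral_subset_le)
    have cm: "continuous_on {x..y} m" if "0 < x" for x y
      using that by (intro continuous_on_subset[OF \<open>continuous_on {0<..} m\<close>]) auto
    show "(\<lambda>x. exp (2 * a * x) * m x) integrable_on {s..t}" "(\<lambda>x. exp (2 * a * x) * m x) integrable_on {\<sigma>..t}"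
      using that by (auto intro!: integrable_continuous_interval continuous_intros cm)
  qed (use that in auto)
  have pR: "0 \<le> ?k" using \<beta> by simp
  show ?thesis
  proof (cases "\<delta> * real p \<le> 1")
    case True
    have \<delta>p: "\<delta>\<^sup>2 * (real p)\<^sup>2 \<le> 1"
      using power_mono[OF True, of 2] \<delta> by (simp add: power_mult_distrib)
    have \<delta>1: "\<delta> \<le> 1"
    proof -
      have "\<delta> * 1 \<le> \<delta> * real p" using \<delta> p1 by (intro mult_left_mono) auto
      then show ?thesis using True by simp
    qed
    have \<delta>K: "\<delta>\<^sup>2 * K \<le> 1"
      using mult_left_mono[OF pK(2), of "\<delta>\<^sup>2"] \<delta>p by simp
    have ac: "a \<le> \<beta> * \<delta> / (800 * R\<^sup>2)"
    proof -
      have "c * (\<beta> * \<delta> / R\<^sup>2) \<le> 1/800 * (\<beta> * \<delta> / R\<^sup>2)"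
        using c \<beta> \<delta> by (intro mult_right_mono) auto
      then show ?thesis by (simp add: a mult.assoc)
    qed
    let ?m = "\<lambda>t. 4 * profile_sq p t"
    have cm: "continuous_on {0<..} ?m" by (intro continuous_intros continuous_on_profile_sq)
    have m0: "0 \<le> ?m t" if "t > 0" for t using profile_sq_nonneg[OF that] by simp
    show ?thesis
    proof (rule that[OF cm m0])
      show "?m = (\<lambda>t. 4 * profile_sq p t) \<or> ?m = (\<lambda>t. 2 * R\<^sup>2 / (real p)\<^sup>2 * energy 0 0 t)" by simp
      fix s t :: real assume s: "0 < s" and t: "s \<le> t"
      show "?k * integral {s..t} (\<lambda>x. exp (2 * a * x) * ?m x)
        \<le> 200000 * ?A"
      proof (rule field_le_epsilon)
        fix e :: real assume e: "e > 0"
        \<comment> \<open>46080 is 4 times 3840 times 3, the factor in front of the energy bound at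
          \<sigma>; the slack (2 + R^2)\<eta> in that bound thus becomes exactly e.\<close>
        define \<eta> where "\<eta> = e / 46080 / (2 + R\<^sup>2)"
        have R2: "0 < 2 + R\<^sup>2" by (simp add: add_pos_nonneg)
        have "(2 + R\<^sup>2) * \<eta> = e / 46080" 
          using R2 unfolding \<eta>_def by (metis less_irrefl nonzero_mult_div_cancel_left times_divide_eq_right)
        then have \<eta>: "\<eta> > 0" "46080 * ((2 + R\<^sup>2) * \<eta>) = e" using e R2 zero_less_mult_pos[of "2 + R\<^sup>2" \<eta>] by auto
        obtain \<sigma> where \<sigma>: "0 < \<sigma>" "\<sigma> \<le> s" "exp (2 * a * \<sigma>) \<le> 3" "energy 0 0 \<sigma> \<le> 2 * mass0 + \<eta>"
            "grad_sq \<sigma> \<le> grad0 + K * hardy0 + \<eta>"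
          using start[OF s \<eta>(1)] by blast
        have "\<delta>\<^sup>2 * R\<^sup>2 / 20 * grad_sq \<sigma> \<le> \<delta>\<^sup>2 * R\<^sup>2 / 20 * (grad0 + K * hardy0 + \<eta>)"
          by (intro mult_left_mono \<sigma>) simp
        also have "\<dots> = (\<delta>\<^sup>2 * R\<^sup>2 * grad0 + \<delta>\<^sup>2 * K * (R\<^sup>2 * hardy0) + \<delta>\<^sup>2 * (R\<^sup>2 * \<eta>)) / 20"
          by (simp add: algebra_simps add_divide_distrib)
        \<comment> \<open>The initial layer bounds the gradient with a term K \<open>hardy0\<close>;
          the factor \<delta>^2 in the energy compensates for K, as \<delta>^2 K \<le> 1.\<close>
        also have "\<dots> \<le> (\<delta>\<^sup>2 * R\<^sup>2 * grad0 + 1 * (R\<^sup>2 * hardy0) + 1 * (R\<^sup>2 * \<eta>)) / 20"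
          using \<delta> \<delta>1 \<eta> datum_nonneg by (intro divide_right_mono add_mono mult_right_mono \<delta>K order_refl) (auto simp: power_le_one)
        also have "\<dots> \<le> \<delta>\<^sup>2 * R\<^sup>2 * grad0 + R\<^sup>2 * hardy0 + R\<^sup>2 * \<eta>"
        proof -
          have "0 \<le> \<delta>\<^sup>2 * R\<^sup>2 * grad0" "0 \<le> R\<^sup>2 * hardy0" "0 \<le> R\<^sup>2 * \<eta>" using datum_nonneg \<eta> by simp_all
          moreover have "(x + 1 * y + 1 * z) / 20 \<le> x + y + z" if "0 \<le> x" "0 \<le> y" "0 \<le> z" for x y z :: real
            using that by simp
          ultimately show ?thesis by blast
        qed
        finally have hypo: "hypo_energy \<sigma> \<le> 4 * mass0 + R\<^sup>2 * hardy0 + \<delta>\<^sup>2 * R\<^sup>2 * grad0 + (2 + R\<^sup>2) * \<eta>"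
          using hypo_energy_bounds(2)[OF \<sigma>(1)] \<sigma>(4) by (simp add: distrib_right)
        have "?k * integral {s..t} (\<lambda>x. exp (2 * a * x) * ?m x)
            \<le> ?k * integral {\<sigma>..t} (\<lambda>x. exp (2 * a * x) * ?m x)"
          by (intro mult_left_mono[OF enlarge pR] cm m0 \<sigma>)
        also have "\<dots> = 4 * (?k * integral {\<sigma>..t} (\<lambda>x. exp (2 * a * x) * profile_sq p x))"
        proof -
          have "integral {\<sigma>..t} (\<lambda>x. exp (2 * a * x) * ?m x) = integral {\<sigma>..t} (\<lambda>x. 4 * (exp (2 * a * x) * profile_sq p x))"
            by (simp add: mult_ac)
          also have "\<dots> = 4 * integral {\<sigma>..t} (\<lambda>x. exp (2 * a * x) * profile_sq p x)"
            by (rule integral_mult_right)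
          finally show ?thesis by (simp only: mult_ac)
        qed
        also have "\<dots> \<le> 4 * (3840 * (exp (2 * a * \<sigma>) * hypo_energy \<sigma>))"
          using \<sigma> t by (intro mult_left_mono weighted_profile_bound \<delta>1 \<delta>K a0 ac) auto
        also have "\<dots> \<le> 4 * (3840 * (3 * (4 * mass0 + R\<^sup>2 * hardy0 + \<delta>\<^sup>2 * R\<^sup>2 * grad0 + (2 + R\<^sup>2) * \<eta>)))"
          using \<sigma> hypo_energy_bounds(1)[OF \<sigma>(1)] by (intro mult_left_mono mult_mono hypo) auto
        also have "\<dots> = 184320 * mass0 + 46080 * (R\<^sup>2 * hardy0 + \<delta>\<^sup>2 * R\<^sup>2 * grad0) + e"
          unfolding \<eta>(2)[symmetric] by (simp add: distrib_left)
        also have "\<dots> \<le> 200000 * ?A + e"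
        proof -
          have "0 \<le> \<delta>\<^sup>2 * R\<^sup>2 * grad0" "0 \<le> R\<^sup>2 * hardy0" "0 \<le> mass0" using datum_nonneg by simp_all
          moreover have "184320 * x + 46080 * (y + z) + e \<le> 200000 * (x + y + z) + e" if "0 \<le> z" "0 \<le> y" "0 \<le> x" for x y z :: real
            using that by simp
          ultimately show ?thesis by blast
        qed
        finally show "?k * integral {s..t} (\<lambda>x. exp (2 * a * x) * ?m x)
          \<le> 200000 * ?A + e" .
      qed
    qed
  next
    case False
    then have \<delta>p: "1 < \<delta> * real p" by simp
    have \<delta>p2: "1 \<le> \<delta>\<^sup>2 * (real p)\<^sup>2" and \<delta>p3: "1 \<le> \<delta>^3 * (real p)^3"
      using power_mono[of 1 "\<delta> * real p" 2] power_mono[of 1 "\<delta> * real p" 3] \<delta>p by (simp_all add: power_mult_distrib)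
    \<comment> \<open>In this regime the viscous rate \<beta>\<delta>^3 K/R^2 is at least 3/4 of
      \<beta>\<delta>/R^2, far above 2a.\<close>
    have \<delta>K: "3 / 4 \<le> \<delta>\<^sup>2 * K"
      using mult_left_mono[OF pK(1), of "\<delta>\<^sup>2"] \<delta>p2 by simp
    have ac: "2 * a \<le> \<beta> * \<delta>^3 * K / R\<^sup>2"
    proof -
      have "2 * c \<le> \<delta>\<^sup>2 * K" using c \<delta>K by simp
      then have "2 * c * (\<beta> * \<delta> / R\<^sup>2) \<le> \<delta>\<^sup>2 * K * (\<beta> * \<delta> / R\<^sup>2)"
        using \<beta> \<delta> by (intro mult_right_mono) auto
      then show ?thesis by (simp add: a power2_eq_square power3_eq_cube mult_ac)
    qed
    let ?q = "2 * R\<^sup>2 / (real p)\<^sup>2"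
    let ?m = "\<lambda>t. ?q * energy 0 0 t"
    have cm: "continuous_on {0<..} ?m" by (intro continuous_intros continuous_on_squares(4))
    have e0: "0 \<le> energy 0 0 t" if "t > 0" for t
      by (rule has_integral_nonneg[OF has_integral_squares(4)[OF that]]) simp
    have m0: "0 \<le> ?m t" if "t > 0" for t using e0[OF that] by simp
    show ?thesis
    proof (rule that[OF cm m0])
      show "?m = (\<lambda>t. 4 * profile_sq p t) \<or> ?m = (\<lambda>t. 2 * R\<^sup>2 / (real p)\<^sup>2 * energy 0 0 t)" by simp
      fix s t :: real assume s: "0 < s" and t: "s \<le> t"
      show "?k * integral {s..t} (\<lambda>x. exp (2 * a * x) * ?m x)
        \<le> 200000 * ?A"
      proof (rule field_le_epsilon)
        fix e :: real assume e: "e > 0"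
        obtain \<sigma> where \<sigma>: "0 < \<sigma>" "\<sigma> \<le> s" "exp (2 * a * \<sigma>) \<le> 3" "energy 0 0 \<sigma> \<le> 2 * mass0 + e / 8"
          using start[OF s, of "e / 8"] e by auto
        have "?k * integral {s..t} (\<lambda>x. exp (2 * a * x) * ?m x)
            \<le> ?k * integral {\<sigma>..t} (\<lambda>x. exp (2 * a * x) * ?m x)"
          by (intro mult_left_mono[OF enlarge pR] cm m0 \<sigma>)
        also have "integral {\<sigma>..t} (\<lambda>x. exp (2 * a * x) * ?m x) = ?q * integral {\<sigma>..t} (\<lambda>x. exp (2 * a * x) * energy 0 0 x)"
          unfolding integral_mult_right[symmetric] by (simp only: mult.left_commute)
        also have "?k * (?q * integral {\<sigma>..t} (\<lambda>x. exp (2 * a * x) * energy 0 0 x))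
            \<le> ?k * (?q * (R\<^sup>2 / (\<beta> * \<delta>^3 * K) * (exp (2 * a * \<sigma>) * energy 0 0 \<sigma>)))"
          using \<sigma> t pR by (intro mult_left_mono weighted_mass_bound a0 ac) auto
        also have "\<dots> = 2 / (real p * \<delta>^3 * K) * (exp (2 * a * \<sigma>) * energy 0 0 \<sigma>)"
        proof -
          have "P * \<beta> / R^4 * (2 * R\<^sup>2 / P\<^sup>2 * (R\<^sup>2 / (\<beta> * D * L) * y)) = 2 / (P * D * L) * y"
            if "P \<noteq> 0" "D \<noteq> 0" "L \<noteq> 0" for P D L y :: real
            using that \<beta> R by (simp add: field_simps power2_eq_square eval_nat_numeral)
          then show ?thesis using p \<delta> K by simp
        qed
        also have "\<dots> \<le> 8 / 3 * (3 * (2 * mass0 + e / 8))"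
        proof (rule mult_mono)
          \<comment> \<open>The prefactor p, the p^(-2) of the stream-function bound and the viscous
            rate combine to the inverse of p\<delta>^3 K, and p\<delta>^3 K \<ge> (3/4)(\<delta>p)^3
            \<ge> 3/4.\<close>
          have "3 / 4 * 1 \<le> 3 / 4 * (\<delta>^3 * (real p)^3)" using \<delta>p3 by simp
          also have "\<dots> = real p * \<delta>^3 * (3 / 4 * (real p)\<^sup>2)" by (simp add: power2_eq_square power3_eq_cube mult_ac)
          also have "\<dots> \<le> real p * \<delta>^3 * K" using \<delta> by (intro mult_left_mono pK) auto
          finally have "3 / 4 \<le> real p * \<delta>^3 * K" by simp
          then have "2 / (real p * \<delta>^3 * K) \<le> 2 / (3 / 4)" by (intro divide_left_mono) auto
          then show "2 / (real p * \<delta>^3 * K) \<le> 8 / 3" by simp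
          show "exp (2 * a * \<sigma>) * energy 0 0 \<sigma> \<le> 3 * (2 * mass0 + e / 8)"
            using \<sigma> e0[OF \<sigma>(1)] by (intro mult_mono) auto
        qed (use e0[OF \<sigma>(1)] in auto)
        also have "\<dots> = 16 * mass0 + e" by simp
        also have "\<dots> \<le> 200000 * ?A + e"
        proof -
          have "0 \<le> \<delta>\<^sup>2 * R\<^sup>2 * grad0" "0 \<le> R\<^sup>2 * hardy0" "0 \<le> mass0" using datum_nonneg by simp_all
          moreover have "16 * x + e \<le> 200000 * (x + y + z) + e" if "0 \<le> z" "0 \<le> y" "0 \<le> x" for x y z :: real
            using that by simp
          ultimately show ?thesis by blast
        qed
        finally show "?k * integral {s..t} (\<lambda>x. exp (2 * a * x) * ?m x)
          \<le> 200000 * ?A + e" .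
      qed
    qed
  qed
qed

end

section \<open>Passage to the half-line and to the original variables\<close>

text \<open>The half-line is exhausted by [1/(n+1), n+1], and monotone convergence applies to the
  truncations of h. The function g enters only through its pointwise bound: in the application it is
  a norm of the stream function, whose dependence on time is not prescribed separately.\<close>

lemma nn_integral_halfline_le:
  fixes h :: "real \<Rightarrow> real"
  assumes h: "continuous_on {0<..} h" and nn: "\<And>t. t > 0 \<Longrightarrow> 0 \<le> h t"
    and bound: "\<And>s t. 0 < s \<Longrightarrow> s \<le> t \<Longrightarrow> integral {s..t} h \<le> M"
    and g: "\<And>t. t > 0 \<Longrightarrow> g t \<le> ennreal (h t)"
  shows "(\<integral>\<^sup>+ t. g t \<partial>lebesgue_on {0..}) \<le> ennreal M"
proof -
  define A where "A n = {1 / real (Suc n)..real (Suc n)}" for n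
  have A: "A n \<subseteq> {0<..}" "A n \<in> sets lebesgue" for n
    unfolding A_def by (auto intro: less_le_trans[rotated])
  have hA: "integrable (lebesgue_on (A n)) h" for n
    unfolding A_def
    by (intro absolutely_integrable_imp_integrable absolutely_integrable_continuous_real
        continuous_on_subset[OF h A(1)[of n, unfolded A_def]]) simp
  define f where "f n t = ennreal (h t) * indicator (A n) t" for n t
  have meas: "f n \<in> borel_measurable lebesgue" for n
  proof -
    have "(\<lambda>t. ennreal (h t)) \<in> borel_measurable (lebesgue_on (A n))"
      using borel_measurable_integrable[OF hA] by (rule measurable_compose) simp
    then show ?thesis
      unfolding f_def using A(2) by (subst (asm) borel_measurable_restrict_space_iff_ennreal) (auto simp: mult.commute)
  qed
  have fint: "(\<integral>\<^sup>+ t. f n t \<partial>lebesgue) \<le> ennreal M" for n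
  proof -
    have "(\<integral>\<^sup>+ t. f n t \<partial>lebesgue) = (\<integral>\<^sup>+ t. ennreal (h t) \<partial>lebesgue_on (A n))"
      unfolding f_def using A(2) by (subst nn_integral_restrict_space) auto
    also have "\<dots> = ennreal (integral\<^sup>L (lebesgue_on (A n)) h)"
      using A(1)[of n] nn by (intro nn_integral_eq_integral hA) (auto intro!: AE_I2)
    also have "integral\<^sup>L (lebesgue_on (A n)) h = integral (A n) h"
      by (rule lebesgue_integral_eq_integral[OF hA A(2)])
    also have "\<dots> \<le> M"
      unfolding A_def
    proof (rule bound)
      have "1 / real (Suc n) \<le> 1" "1 \<le> real (Suc n)" by simp_all
      then show "1 / real (Suc n) \<le> real (Suc n)" by (rule order_trans)
    qed simp
    finally show ?thesis by (simp add: ennreal_leI)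
  qed
  have inc: "incseq f"
  proof (rule incseq_SucI, rule le_funI)
    fix n t
    have "A n \<subseteq> A (Suc n)" unfolding A_def by (auto simp: field_simps)
    then show "f n t \<le> f (Suc n) t" unfolding f_def by (intro mult_left_mono) (auto simp: indicator_def)
  qed
  have sup: "g t * indicator {0..} t \<le> (SUP n. f n t)" if t0: "t \<noteq> 0" for t
  proof (cases "t > 0")
    case True
    obtain n :: nat where n: "max t (1 / t) \<le> real n" using real_arch_simple by blast
    have "t \<in> A n"
    proof -
      have "1 / t \<le> real (Suc n)" using n by simp
      then have "1 / real (Suc n) \<le> t" using True by (simp add: field_simps)
      then show ?thesis using n by (simp add: A_def)
    qed
    then have "g t * indicator {0..} t \<le> f n t" using g[OF True] True by (simp add: f_def)
    also have "\<dots> \<le> (SUP n. f n t)" by (rule SUP_upper) simp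
    finally show ?thesis .
  next
    case False
    then show ?thesis using t0 by simp
  qed
  have "(\<integral>\<^sup>+ t. g t \<partial>lebesgue_on {0..}) = (\<integral>\<^sup>+ t. g t * indicator {0..} t \<partial>lebesgue)"
    by (rule nn_integral_restrict_space) simp
  also have "\<dots> \<le> (\<integral>\<^sup>+ t. (SUP n. f n t) \<partial>lebesgue)"
  proof (rule nn_integral_mono_AE)
    \<comment> \<open>Time 0, where no bound on g is available, is a null set.\<close>
    have "AE t in lebesgue. t \<noteq> (0::real)"
      by (rule AE_I[of _ _ "{0}"]) auto
    then show "AE t in lebesgue. g t * indicator {0..} t \<le> (SUP n. f n t)"
      by eventually_elim (rule sup)
  qed
  also have "\<dots> = (SUP n. \<integral>\<^sup>+ t. f n t \<partial>lebesgue)"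
    by (rule nn_integral_monotone_convergence_SUP[OF inc meas])
  also have "\<dots> \<le> ennreal M" by (rule SUP_least) (rule fint)
  finally show ?thesis .
qed

lemma has_vector_derivative_dr:
  "f differentiable (at r within {1..R}) \<Longrightarrow> (f has_vector_derivative dr R f r) (at r within {1..R})"
  unfolding dr_def by (simp only: vector_derivative_works)

text \<open>The dictionary \<nu> = \<beta>\<delta>^3 and kB = \<beta>\<kappa> turns the given
  equation into the rescaled one; kB \<noteq> 0 gives \<kappa>^2 = 1, and |k| \<ge> 1 gives K \<ge>
  3/4.\<close>

lemma radial_flow_datum_of_solution:
  assumes \<nu>: "\<nu> > 0" and B: "B \<noteq> 0" and R: "R > 1" and k: "\<bar>k\<bar> \<ge> 1"
    and H1: "H1_deriv R w0 w0'" and bc0: "vanishes_at_ends R w0" and sol: "vorticity_solution \<nu> k B R w0 w"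
  defines "\<beta> \<equiv> \<bar>real_of_int k * B\<bar>" and "K \<equiv> (real_of_int k)\<^sup>2 - 1/4"
  shows "radial_flow_datum R \<beta> ((\<nu> / \<beta>) powr (1/3)) K (sgn (real_of_int k * B)) w
    (\<lambda>t. dr R (w t)) (\<lambda>t. dr R (dr R (w t))) (dt w) w0 w0'"
proof -
  have k0: "real_of_int k \<noteq> 0" using k by auto
  have \<beta>: "\<beta> > 0" using B k0 by (simp add: \<beta>_def)
  have C: "C12 R w" and eqn: "\<And>t r. t > 0 \<Longrightarrow> r \<in> {1..R} \<Longrightarrow> dt w t r - of_real \<nu> * radial_op k R (w t) r
          + \<i> * of_real (real_of_int k * B / r\<^sup>2) * w t r = 0"
    and bc: "\<And>t. t > 0 \<Longrightarrow> vanishes_at_ends R (w t)"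
    and lim: "((\<lambda>t. L2_sq R (\<lambda>r. w t r - w0 r)) \<longlongrightarrow> 0) (at_right 0)"
    using sol unfolding vorticity_solution_def by blast+
  have k2: "1 \<le> (real_of_int k)\<^sup>2"
  proof -
    have "1 \<le> \<bar>real_of_int k\<bar>" using k by linarith
    then show ?thesis by (simp add: abs_le_square_iff[of 1, simplified])
  qed
  have \<delta>3: "((\<nu> / \<beta>) powr (1/3)) ^ 3 = \<nu> / \<beta>"
    using \<nu> \<beta> by (simp add: powr_power)
  have \<kappa>: "\<beta> * sgn (real_of_int k * B) = real_of_int k * B"
    by (simp add: \<beta>_def abs_mult_sgn)
  show ?thesis
  proof
    show "1 < R" "0 < \<beta>" by fact+
    show "0 < (\<nu> / \<beta>) powr (1/3)" using \<nu> \<beta> by simp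
    show "3 / 4 \<le> K" using k2 by (simp add: K_def)
    show "(sgn (real_of_int k * B))\<^sup>2 = 1" using k0 B by (simp add: sgn_mult sgn_if power_mult_distrib)
    show "H1_deriv R w0 w0'" "vanishes_at_ends R w0" by fact+
    show "((\<lambda>t. L2_sq R (\<lambda>r. w t r - w0 r)) \<longlongrightarrow> 0) (at_right 0)" by fact
    show "w t 1 = 0" "w t R = 0" if "t > 0" for t using bc[OF that] by (auto simp: vanishes_at_ends_def)
    show "(w t has_vector_derivative dr R (w t) r) (at r within {1..R})"
      "(dr R (w t) has_vector_derivative dr R (dr R (w t)) r) (at r within {1..R})"
      if tr: "t > 0" "r \<in> {1..R}" for t r
    proof -
      have "twice_differentiable R (w t)" using C tr unfolding C12_def by blast
      then have d: "w t differentiable (at r within {1..R})" "dr R (w t) differentiable (at r within {1..R})"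
        using tr(2) unfolding twice_differentiable_def by blast+
      show "(w t has_vector_derivative dr R (w t) r) (at r within {1..R})"
        "(dr R (w t) has_vector_derivative dr R (dr R (w t)) r) (at r within {1..R})"
        by (rule has_vector_derivative_dr[OF d(1)], rule has_vector_derivative_dr[OF d(2)])
    qed
    show "((\<lambda>s. w s r) has_vector_derivative dt w t r) (at t)" if tr: "t > 0" "r \<in> {1..R}" for t r
    proof -
      have "(\<lambda>s. w s r) differentiable (at t)" using C tr unfolding C12_def by blast
      then show ?thesis unfolding dt_def by (simp only: vector_derivative_works)
    qed
    show "continuous_on ({0<..} \<times> {1..R}) (\<lambda>(t, r). w t r)" "continuous_on ({0<..} \<times> {1..R}) (\<lambda>(t, r). dr R (w t) r)"
      "continuous_on ({0<..} \<times> {1..R}) (\<lambda>(t, r). dr R (dr R (w t)) r)" "continuous_on ({0<..} \<times> {1..R}) (\<lambda>(t, r). dt w t r)"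
      using C unfolding C12_def by blast+
    fix t r :: real assume tr: "t > 0" "r \<in> {1..R}"
    have "dt w t r = of_real \<nu> * radial_op k R (w t) r - \<i> * of_real (real_of_int k * B / r\<^sup>2) * w t r"
      using eqn[OF tr] by (simp add: algebra_simps add_eq_0_iff)
    moreover have "of_real b * (of_real n * X - \<i> * of_real (s / r\<^sup>2) * W)
        = of_real (b * n) * X - \<i> * of_real (b * s / r\<^sup>2) * W" for b n s X W
      by (simp add: algebra_simps)
    moreover have "\<beta> * (\<nu> / \<beta>) = \<nu>" using \<beta> by simp
    ultimately show "dt w t r = of_real \<beta> * (of_real (((\<nu> / \<beta>) powr (1/3)) ^ 3) *
        (dr R (dr R (w t)) r - of_real (K / r\<^sup>2) * w t r)
        - \<i> * of_real (sgn (real_of_int k * B) / r\<^sup>2) * w t r)"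
      unfolding \<delta>3 radial_op_def K_def by (simp only: \<kappa>)
  qed
qed

text \<open>Both sides equal \<nu>^(1/3)|kB|^(2/3), so the prescribed rate is
  c'\<beta>\<delta>/R^2.\<close>

lemma rate_rescaling:
  assumes \<nu>: "\<nu> > 0" and B: "B \<noteq> 0" and k: "(k::int) \<noteq> 0"
  shows "(\<nu> * (real_of_int k)\<^sup>2) powr (1/3) * \<bar>B\<bar> powr (2/3)
    = \<bar>real_of_int k * B\<bar> * (\<nu> / \<bar>real_of_int k * B\<bar>) powr (1/3)"
proof -
  let ?k = "\<bar>real_of_int k\<bar>" and ?b = "\<bar>B\<bar>"
  have pos: "?k > 0" "?b > 0" using k B by auto
  have c: "x = x powr (1/3) * x powr (2/3)" if "x > 0" for x :: real
    using that by (simp flip: powr_add)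
  have k2: "((real_of_int k)\<^sup>2) powr (1/3) = ?k powr (2/3)"
  proof -
    have "(real_of_int k)\<^sup>2 = ?k powr 2" using pos by simp
    then have "((real_of_int k)\<^sup>2) powr (1/3) = (?k powr 2) powr (1/3)" by (simp only:)
    also have "\<dots> = ?k powr (2/3)" unfolding powr_powr by simp
    finally show ?thesis .
  qed
  have "(\<nu> * (real_of_int k)\<^sup>2) powr (1/3) * ?b powr (2/3) = \<nu> powr (1/3) * (?k powr (2/3) * ?b powr (2/3))"
    using \<nu> pos by (simp add: powr_mult k2)
  also have "\<dots> = (?k powr (1/3) * ?k powr (2/3)) * (?b powr (1/3) * ?b powr (2/3)) * (\<nu> powr (1/3) / (?k powr (1/3) * ?b powr (1/3)))"
    using pos by (simp add: field_simps)
  also have "\<dots> = ?k * ?b * (\<nu> / (?k * ?b)) powr (1/3)"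
    using \<nu> pos by (simp add: powr_mult powr_divide flip: c)
  finally show ?thesis by (simp add: abs_mult)
qed

lemma weighted_velocity_bound:
  assumes \<nu>: "\<nu> > 0" and B: "B \<noteq> 0" and R: "R > 1" and k: "\<bar>k\<bar> \<ge> 1" and c': "0 \<le> c'" "c' \<le> 1/800"
    and H1: "H1_deriv R w0 w0'" and bc0: "vanishes_at_ends R w0" and sol: "vorticity_solution \<nu> k B R w0 w"
    and str: "\<forall>t>0. stream_function k R (w t) (\<phi> t)"
    and a: "a = c' * (\<nu> * (real_of_int k)\<^sup>2) powr (1/3) * \<bar>B\<bar> powr (2/3) / R\<^sup>2"
  shows "ennreal ((real_of_int k)\<^sup>2 * \<bar>B\<bar> / R^4) *
       (L2L2_sq R (\<lambda>t r. exp (a * t) *\<^sub>R dr R (\<phi> t) r)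
        + ennreal (\<bar>real_of_int k\<bar>\<^sup>2) * L2L2_sq R (\<lambda>t r. exp (a * t) *\<^sub>R (\<phi> t r /\<^sub>R r)))
    \<le> ennreal 800000 * (ennreal (R^6) * L2_sq R (\<lambda>r. w0 r /\<^sub>R r^3)
        + ennreal ((\<nu> / \<bar>real_of_int k * B\<bar>) powr (2/3) * R\<^sup>2) * L2_sq R w0')" (is "?lhs \<le> _")
proof -
  define \<beta> where "\<beta> = \<bar>real_of_int k * B\<bar>"
  define \<delta> where "\<delta> = (\<nu> / \<beta>) powr (1/3)"
  define p where "p = nat \<bar>k\<bar>"
  have p: "1 \<le> p" "real p = \<bar>real_of_int k\<bar>" "(real p)\<^sup>2 = (real_of_int k)\<^sup>2" using k by (auto simp: p_def)
  have \<beta>0: "\<beta> > 0" using B k by (auto simp: \<beta>_def)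
  interpret radial_flow_datum R \<beta> \<delta> "(real_of_int k)\<^sup>2 - 1/4" "sgn (real_of_int k * B)" w
    "\<lambda>t. dr R (w t)" "\<lambda>t. dr R (dr R (w t))" "dt w" w0 w0'
    unfolding \<beta>_def \<delta>_def by (rule radial_flow_datum_of_solution[OF \<nu> B R k H1 bc0 sol])
  have a': "a = c' * \<beta> * \<delta> / R\<^sup>2"
    unfolding a \<beta>_def \<delta>_def mult.assoc using rate_rescaling[OF \<nu> B, of k] k by auto
  obtain m where cm: "continuous_on {0<..} m" and m0: "\<And>t. t > 0 \<Longrightarrow> 0 \<le> m t"
    and mE: "m = (\<lambda>t. 4 * profile_sq p t) \<or> m = (\<lambda>t. 2 * R\<^sup>2 / (real p)\<^sup>2 * energy 0 0 t)"
    and mI: "\<And>s t. 0 < s \<Longrightarrow> s \<le> t \<Longrightarrow> real p * \<beta> / R^4 * integral {s..t} (\<lambda>x. exp (2 * a * x) * m x)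
    \<le> 200000 * (mass0 + R\<^sup>2 * hardy0 + \<delta>\<^sup>2 * R\<^sup>2 * grad0)"
  proof (rule majorant_bound[OF p(1) _ _ _ a'])
    show "(real_of_int k)\<^sup>2 - 1/4 = (real p)\<^sup>2 - 1/4" by (simp add: p(3))
    show "0 \<le> c'" "c' \<le> 1/800" by fact+
  qed blast
  \<comment> \<open>The prefactor k^2|B| is p times \<beta>, the normalisation of the majorant
    bound.\<close>
  define q where "q = real p * \<beta> / R^4"
  have q: "q > 0" "q = (real_of_int k)\<^sup>2 * \<bar>B\<bar> / R^4"
  proof -
    show "q > 0" using p(1) \<beta>0 R by (simp add: q_def)
    have "real p * \<beta> = (real p)\<^sup>2 * \<bar>B\<bar>" by (simp add: \<beta>_def abs_mult p(2)[symmetric] power2_eq_square)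
    then show "q = (real_of_int k)\<^sup>2 * \<bar>B\<bar> / R^4" by (simp only: q_def p(3))
  qed
  define M where "M = 200000 * (mass0 + R\<^sup>2 * hardy0 + \<delta>\<^sup>2 * R\<^sup>2 * grad0)"
  have M0: "0 \<le> M" using datum_nonneg by (simp add: M_def)
  define h where "h t = exp (2 * a * t) * m t" for t
  have ch: "continuous_on {0<..} h" unfolding h_def by (intro continuous_intros cm)
  have h0: "0 \<le> h t" if "t > 0" for t using m0[OF that] by (simp add: h_def)
  have hI: "integral {s..t} h \<le> M / q" if "0 < s" "s \<le> t" for s t
    using mI[OF that] q(1) unfolding q_def[symmetric] M_def h_def by (simp add: pos_le_divide_eq mult.commute)
  \<comment> \<open>One majorant serves both norms, as each summand of the energy is at most the
    whole; in the second, p^2 is divided out and later restored by the factor |k|^2.\<close>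
  have E: "L2_sq R (\<lambda>r. exp (a * t) *\<^sub>R dr R (\<phi> t) r) \<le> ennreal (h t)"
    "L2_sq R (\<lambda>r. exp (a * t) *\<^sub>R (\<phi> t r /\<^sub>R r)) \<le> ennreal (h t / (real p)\<^sup>2)" if t: "t > 0" for t
  proof -
    have sf: "stream_function k R (w t) (\<phi> t)" using str t by blast
    have d1: "(\<phi> t has_vector_derivative dr R (\<phi> t) r) (at r within {1..R})"
      and d2: "(dr R (\<phi> t) has_vector_derivative dr R (dr R (\<phi> t)) r) (at r within {1..R})"
      if r: "r \<in> {1..R}" for r
    proof -
      have "twice_differentiable R (\<phi> t)" using sf unfolding stream_function_def by blast
      then have d: "\<phi> t differentiable (at r within {1..R})" "dr R (\<phi> t) differentiable (at r within {1..R})"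
        using r unfolding twice_differentiable_def by blast+
      show "(\<phi> t has_vector_derivative dr R (\<phi> t) r) (at r within {1..R})"
        "(dr R (\<phi> t) has_vector_derivative dr R (dr R (\<phi> t)) r) (at r within {1..R})"
        by (rule has_vector_derivative_dr[OF d(1)], rule has_vector_derivative_dr[OF d(2)])
    qed
    have eq: "dr R (dr R (\<phi> t)) r - of_real (((real p)\<^sup>2 - 1/4) / r\<^sup>2) * \<phi> t r = w t r" if "r \<in> {1..R}" for r
      using sf that unfolding stream_function_def radial_op_def p(3) by blast
    have bc: "\<phi> t 1 = 0" "\<phi> t R = 0" using sf unfolding stream_function_def vanishes_at_ends_def by blast+
    have c\<phi>: "continuous_on {1..R} (\<phi> t)" and cd: "continuous_on {1..R} (dr R (\<phi> t))"
      using stream_energy_bounds(1,2)[OF R p(1) d1 d2 eq bc continuous_on_w(1)[OF t]] by blast+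
    let ?e1 = "\<lambda>r. (cmod (dr R (\<phi> t) r))\<^sup>2" and ?e2 = "\<lambda>r. (real p)\<^sup>2 * (cmod (\<phi> t r) / r)\<^sup>2"
    have i: "?e1 integrable_on {1..R}" "?e2 integrable_on {1..R}"
      by (intro integrable_continuous_interval continuous_intros c\<phi> cd; simp)+
    have nn: "0 \<le> integral {1..R} ?e1" "0 \<le> integral {1..R} ?e2"
      by (intro integral_nonneg i; simp)+
    have "integral {1..R} (\<lambda>r. ?e1 r + ?e2 r) \<le> m t"
      using mE stream_energy_bounds(3,4)[OF R p(1) d1 d2 eq bc continuous_on_w(1)[OF t]]
      by (auto simp: profile_sq_def energy_def)
    then have le: "integral {1..R} ?e1 \<le> m t" "integral {1..R} ?e2 \<le> m t"
      using integral_add[OF i] nn by auto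
    have ex: "(exp (a * t))\<^sup>2 = exp (2 * a * t)" by (simp add: power2_eq_square flip: exp_add)
    have "L2_sq R (\<lambda>r. exp (a * t) *\<^sub>R dr R (\<phi> t) r) = ennreal (integral {1..R} (\<lambda>r. exp (2 * a * t) * ?e1 r))"
      by (subst L2_sq_eq_ennreal_integral(3)) (auto intro!: in_L2_continuous continuous_intros cd simp: power_mult_distrib ex)
    also have "\<dots> \<le> ennreal (h t)"
      unfolding h_def integral_mult_right by (intro ennreal_leI mult_left_mono le) simp
    finally show "L2_sq R (\<lambda>r. exp (a * t) *\<^sub>R dr R (\<phi> t) r) \<le> ennreal (h t)" .
    have "continuous_on {1..R} (\<lambda>r. exp (a * t) *\<^sub>R (\<phi> t r /\<^sub>R r))" by (intro continuous_intros c\<phi>) auto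
    then have "L2_sq R (\<lambda>r. exp (a * t) *\<^sub>R (\<phi> t r /\<^sub>R r))
        = ennreal (integral {1..R} (\<lambda>r. (cmod (exp (a * t) *\<^sub>R (\<phi> t r /\<^sub>R r)))\<^sup>2))"
      by (intro L2_sq_eq_ennreal_integral(3) in_L2_continuous)
    also have "integral {1..R} (\<lambda>r. (cmod (exp (a * t) *\<^sub>R (\<phi> t r /\<^sub>R r)))\<^sup>2)
        = integral {1..R} (\<lambda>r. exp (2 * a * t) / (real p)\<^sup>2 * ?e2 r)"
      using p(1) by (intro integral_cong) (simp add: power_mult_distrib ex power_divide field_simps)
    also have "\<dots> = exp (2 * a * t) / (real p)\<^sup>2 * integral {1..R} ?e2" by (rule integral_mult_right)
    also have "\<dots> \<le> exp (2 * a * t) / (real p)\<^sup>2 * m t" by (intro mult_left_mono le) simp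
    finally show "L2_sq R (\<lambda>r. exp (a * t) *\<^sub>R (\<phi> t r /\<^sub>R r)) \<le> ennreal (h t / (real p)\<^sup>2)"
      by (simp add: h_def ennreal_leI)
  qed
  have L1: "L2L2_sq R (\<lambda>t r. exp (a * t) *\<^sub>R dr R (\<phi> t) r) \<le> ennreal (M / q)"
    unfolding L2L2_sq_def by (rule nn_integral_halfline_le[OF ch h0 hI E(1)])
  have L2: "L2L2_sq R (\<lambda>t r. exp (a * t) *\<^sub>R (\<phi> t r /\<^sub>R r)) \<le> ennreal (M / q / (real p)\<^sup>2)"
    unfolding L2L2_sq_def
  proof (rule nn_integral_halfline_le[OF _ _ _ E(2)])
    show "continuous_on {0<..} (\<lambda>t. h t / (real p)\<^sup>2)" using p(1) by (intro continuous_intros ch) auto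
    show "integral {s..t} (\<lambda>t. h t / (real p)\<^sup>2) \<le> M / q / (real p)\<^sup>2" if "0 < s" "s \<le> t" for s t
      using divide_right_mono[OF hI[OF that], of "(real p)\<^sup>2"] by simp
  qed (use h0 in auto)
  have "?lhs
    \<le> ennreal q * (ennreal (M / q) + ennreal ((real p)\<^sup>2) * ennreal (M / q / (real p)\<^sup>2))"
    unfolding q(2)[symmetric] p(2)[symmetric] by (intro mult_left_mono add_mono L1 L2) auto
  also have "\<dots> = ennreal (q * (M / q + (real p)\<^sup>2 * (M / q / (real p)\<^sup>2)))"
  proof -
    have "ennreal x * (ennreal y + ennreal z * ennreal u) = ennreal (x * (y + z * u))"
      if "0 \<le> x" "0 \<le> y" "0 \<le> z" "0 \<le> u" for x y z u
      using that by (simp add: ennreal_mult ennreal_plus)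
    then show ?thesis using q(1) M0 by simp
  qed
  also have "q * (M / q + (real p)\<^sup>2 * (M / q / (real p)\<^sup>2)) = 2 * M"
    using q(1) p(1) by (simp add: distrib_left)
  finally have lhs: "?lhs \<le> ennreal (2 * M)" .
  define X where "X = integral {1..R} (\<lambda>r. (cmod (w0 r /\<^sub>R r^3))\<^sup>2)"
  have cX: "continuous_on {1..R} (\<lambda>r. w0 r /\<^sub>R r^3)" by (intro continuous_intros w0_facts(4)) auto
  have X: "L2_sq R (\<lambda>r. w0 r /\<^sub>R r^3) = ennreal X"
    unfolding X_def by (rule L2_sq_eq_ennreal_integral(3)[OF in_L2_continuous[OF cX]])
  have iX: "((\<lambda>r. (cmod (w0 r /\<^sub>R r^3))\<^sup>2) has_integral X) {1..R}"
    unfolding X_def by (intro has_integral_of_continuous continuous_intros cX)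
  have X0: "0 \<le> X" by (rule has_integral_nonneg[OF iX]) simp
  \<comment> \<open>Mass and Hardy norm are both absorbed by the norm with weight r^(-3), since r
    \<le> R.\<close>
  have weight: "(cmod (w0 r))\<^sup>2 \<le> R^6 * (cmod (w0 r /\<^sub>R r^3))\<^sup>2"
    "R\<^sup>2 * (cmod (w0 r) / r)\<^sup>2 \<le> R^6 * (cmod (w0 r /\<^sub>R r^3))\<^sup>2" if r: "r \<in> {1..R}" for r
  proof -
    let ?x = "(cmod (w0 r /\<^sub>R r^3))\<^sup>2"
    have e: "(cmod (w0 r))\<^sup>2 = r^6 * ?x" "(cmod (w0 r) / r)\<^sup>2 = r^4 * ?x"
      using r by (simp_all add: power_divide field_simps power_mult_distrib eval_nat_numeral)
    show "(cmod (w0 r))\<^sup>2 \<le> R^6 * ?x"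
      unfolding e using r by (intro mult_right_mono power_mono) auto
    have "R\<^sup>2 * (r^4 * ?x) \<le> R\<^sup>2 * (R^4 * ?x)"
      using r by (intro mult_left_mono mult_right_mono power_mono) auto
    also have "\<dots> = R^6 * ?x" by (simp add: eval_nat_numeral)
    finally show "R\<^sup>2 * (cmod (w0 r) / r)\<^sup>2 \<le> R^6 * ?x" unfolding e .
  qed
  have b1: "mass0 \<le> R^6 * X"
    by (rule has_integral_le[OF has_integral_datum(1) has_integral_mult_right[OF iX] weight(1)])
  have b2: "R\<^sup>2 * hardy0 \<le> R^6 * X"
    by (rule has_integral_le[OF has_integral_mult_right[OF has_integral_datum(2)] has_integral_mult_right[OF iX] weight(2)])
  have G: "L2_sq R w0' = ennreal grad0"
    unfolding grad0_def using H1 by (intro L2_sq_eq_ennreal_integral(3)) (simp add: H1_deriv_def)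
  have \<delta>2: "(\<nu> / \<bar>real_of_int k * B\<bar>) powr (2/3) = \<delta>\<^sup>2"
    using \<nu> \<beta>0 by (simp add: \<delta>_def \<beta>_def[symmetric] powr_power)
  \<comment> \<open>2M carries the factor 400000; the term with R^6 collects mass and Hardy norm,
    which doubles it.\<close>
  have "2 * M \<le> 800000 * (R^6 * X + \<delta>\<^sup>2 * R\<^sup>2 * grad0)"
  proof -
    have "0 \<le> R^6 * X" "0 \<le> \<delta>\<^sup>2 * R\<^sup>2 * grad0" using X0 datum_nonneg by simp_all
    moreover have "2 * (200000 * (x + y + z)) \<le> 800000 * (u + z)"
      if "x \<le> u" "y \<le> u" "0 \<le> u" "0 \<le> z" for x y z u :: real
      using that by simp
    ultimately show ?thesis unfolding M_def using b1 b2 by blast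
  qed
  then have "ennreal (2 * M) \<le> ennreal (800000 * (R^6 * X + \<delta>\<^sup>2 * R\<^sup>2 * grad0))" by (rule ennreal_leI)
  also have "\<dots> = ennreal 800000 * (ennreal (R^6) * L2_sq R (\<lambda>r. w0 r /\<^sub>R r^3)
      + ennreal ((\<nu> / \<bar>real_of_int k * B\<bar>) powr (2/3) * R\<^sup>2) * L2_sq R w0')"
    unfolding X G \<delta>2 using X0 datum_nonneg(3) R by (simp add: ennreal_mult ennreal_plus)
  finally show ?thesis using lhs by (rule order_trans[rotated])
qed

theorem lemma4p6:
  "\<exists>c>0. \<forall>c'\<in>{0<..<c}. \<exists>C>0.
     \<forall>(\<nu>::real) (B::real) (R::real) (k::int)
       (w0 :: real \<Rightarrow> complex) (w0' :: real \<Rightarrow> complex)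
       (w :: real \<Rightarrow> real \<Rightarrow> complex) (\<phi> :: real \<Rightarrow> real \<Rightarrow> complex) (a::real).
     \<nu> > 0 \<longrightarrow> B \<noteq> 0 \<longrightarrow> R > 1 \<longrightarrow> \<bar>k\<bar> \<ge> 1 \<longrightarrow>
     H1_deriv R w0 w0' \<longrightarrow> vanishes_at_ends R w0 \<longrightarrow>
     vorticity_solution \<nu> k B R w0 w \<longrightarrow>
     (\<forall>t>0. stream_function k R (w t) (\<phi> t)) \<longrightarrow>
     a = c' * (\<nu> * (real_of_int k)\<^sup>2) powr (1/3) * \<bar>B\<bar> powr (2/3) / R\<^sup>2 \<longrightarrow>
     ennreal ((real_of_int k)\<^sup>2 * \<bar>B\<bar> / R^4) *
       (L2L2_sq R (\<lambda>t r. exp (a * t) *\<^sub>R dr R (\<phi> t) r)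
        + ennreal (\<bar>real_of_int k\<bar>\<^sup>2) * L2L2_sq R (\<lambda>t r. exp (a * t) *\<^sub>R (\<phi> t r /\<^sub>R r)))
     \<le> ennreal C *
       (ennreal (1 / ((ln R)\<^sup>2 * R^4)) * L2_sq R (\<lambda>r. r\<^sup>2 *\<^sub>R w0 r)
        + ennreal (R^6) * L2_sq R (\<lambda>r. w0 r /\<^sub>R r^3)
        + ennreal ((\<nu> / \<bar>real_of_int k * B\<bar>) powr (2/3) * R\<^sup>2) * L2_sq R w0'
        + ennreal ((\<nu> / \<bar>real_of_int k * B\<bar>) powr (1/3) * ln R + 1) *
            (ennreal (1 / R\<^sup>2) * L2_sq R (\<lambda>r. r *\<^sub>R w0 r)
             + ennreal ((\<nu> / \<bar>real_of_int k * B\<bar>) powr (4/3) * (real_of_int k)^4 * R\<^sup>2)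
               * L2_sq R (\<lambda>r. w0 r /\<^sub>R r)))"
proof (rule exI[of _ "1/800"], rule conjI, simp, rule ballI, rule exI[of _ 800000], rule conjI, simp,
    intro allI impI, goal_cases)
  case (1 c' \<nu> B R k w0 w0' w \<phi> a)
  \<comment> \<open>1/800 is the threshold for the rate in the hypocoercive decay, and 800000 serves
    every c' below it.\<close>
  have c': "0 \<le> c'" "c' \<le> 1/800" using 1(1) by auto
  \<comment> \<open>All terms are nonnegative, so the bound by two of them persists in the full
    sum.\<close>
  have "x + y \<le> u + x + y + v" for x y u v :: ennreal
    by (metis add.assoc add.commute add_increasing2 le_add_same_cancel1 order_refl zero_le)
  from order_trans[OF weighted_velocity_bound[OF 1(2-5) c' 1(6-10)] mult_left_mono[OF this]]
  show ?case by simp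
qed

end
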